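(* Let $N>1$ and let $\mathcal H$ denote either $H^2(B_N)$ or $A^2_\alpha(B_N)$ with $\alpha>-1$. Suppose $\varphi$ and $\psi$ are linear-fractional self-maps of $B_N$, and suppose $\varphi(\zeta)=\zeta$ for some $\zeta\in\partial B_N$. If either $\psi(\zeta)\neq\zeta$, or $\psi(\zeta)=\zeta$ and $D_\zeta\varphi_\zeta(\zeta)\neq D_\zeta\psi_\zeta(\zeta)$, then $C_\varphi-C_\psi$ is not compact on $\mathcal H$.
   Context: $B_N$ is the open unit ball of $\mathbb C^N$ with inner product $\langle z,w\rangle=\sum z_j\overline{w_j}$. $H^2(B_N)$ is the space of analytic $f$ on $B_N$ with $\sup_{0<r<1}\int_{\partial B_N}|f(r\zeta)|^2d\sigma(\zeta)<\infty$ ($\sigma$ normalized surface measure); $A^2_\alpha(B_N)$ is the space of analytic $f$ with $\int_{B_N}|f|^2\frac{\Gamma(N+\alpha+1)}{\Gamma(N+1)\Gamma(\alpha+1)}(1-|z|^2)^\alpha d\nu<\infty$ ($\nu$ normalized volume measure). A linear-fractional self-map of $B_N$ is a map $\varphi(z)=\frac{Az+B}{\langle z,C\rangle+d}$ ($A$ an $N\times N$ matrix, $B,C\in\mathbb C^N$, $d\in\mathbb C$) analytic on $B_N$ with $\varphi(B_N)\subseteq B_N$; it is analytic on a neighborhood of $\overline{B_N}$, so its values and derivatives at boundary points are defined. $C_\varphi f=f\circ\varphi$. For $\zeta\in\partial B_N$, $\psi_\zeta(z)=\langle\psi(z),\zeta\rangle$, and for $\eta\in\mathbb C^N$, $D_\eta\psi_\zeta(z)=\langle\psi'(z)\eta,\zeta\rangle$,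 where $\psi'(z)$ is the complex Jacobian matrix. *)

theory Defs
  imports "HOL-Analysis.Analysis" "HOL-Probability.Probability"
begin

definition cinner :: "complex ^ 'n \<Rightarrow> complex ^ 'n \<Rightarrow> complex" where
  "cinner z w = (\<Sum>j\<in>UNIV. z $ j * cnj (w $ j))"

definition ball_measure :: "(complex ^ 'n) measure" where
  "ball_measure = uniform_measure lborel (ball 0 1)"

text \<open>Normalized surface measure on the unit sphere, obtained as the image of the
  normalized volume measure under radial projection (Rudin's construction; it is the
  unique rotation-invariant Borel probability measure on the sphere).\<close>
definition sphere_measure :: "(complex ^ 'n) measure" where
  "sphere_measure = distr ball_measure borel (\<lambda>z. (1 / norm z) *\<^sub>R z)"

definition holo_ball :: "(complex ^ 'n \<Rightarrow> complex) \<Rightarrow> bool" where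
  "holo_ball f \<longleftrightarrow> (\<forall>z\<in>ball 0 1. \<exists>L. (f has_derivative L) (at z) \<and>
       (\<forall>c v. L (c *s v) = c * L v))"

definition hardy_sq :: "(complex ^ 'n \<Rightarrow> complex) \<Rightarrow> ennreal" where
  "hardy_sq f = (SUP r\<in>{0<..<1::real}.
      \<integral>\<^sup>+ \<zeta>. ennreal ((cmod (f (r *\<^sub>R \<zeta>)))\<^sup>2) \<partial>sphere_measure)"

definition hardy_space :: "(complex ^ 'n \<Rightarrow> complex) set" where
  "hardy_space = {f. holo_ball f \<and> hardy_sq f < \<infinity>}"

definition hardy_norm :: "(complex ^ 'n \<Rightarrow> complex) \<Rightarrow> real" where
  "hardy_norm f = sqrt (enn2real (hardy_sq f))"

definition bergman_const :: "real \<Rightarrow> real" where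
  "bergman_const \<alpha> = Gamma (real CARD('n) + \<alpha> + 1) /
      (Gamma (real CARD('n) + 1) * Gamma (\<alpha> + 1))"

definition bergman_sq :: "real \<Rightarrow> (complex ^ 'n \<Rightarrow> complex) \<Rightarrow> ennreal" where
  "bergman_sq \<alpha> f = (\<integral>\<^sup>+ z. ennreal ((cmod (f z))\<^sup>2 * bergman_const TYPE('n) \<alpha>
       * (1 - (norm z)\<^sup>2) powr \<alpha>) \<partial>ball_measure)"

definition bergman_space :: "real \<Rightarrow> (complex ^ 'n \<Rightarrow> complex) set" where
  "bergman_space \<alpha> = {f. holo_ball f \<and> bergman_sq \<alpha> f < \<infinity>}"

definition bergman_norm :: "real \<Rightarrow> (complex ^ 'n \<Rightarrow> complex) \<Rightarrow> real" where
  "bergman_norm \<alpha> f = sqrt (enn2real (bergman_sq \<alpha> f))"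

definition lin_frac :: "complex ^ 'n ^ 'n \<Rightarrow> complex ^ 'n \<Rightarrow> complex ^ 'n \<Rightarrow> complex
     \<Rightarrow> complex ^ 'n \<Rightarrow> complex ^ 'n" where
  "lin_frac A B C d z = (1 / (cinner z C + d)) *s (A *v z + B)"

definition lf_selfmap :: "(complex ^ 'n \<Rightarrow> complex ^ 'n) \<Rightarrow> bool" where
  "lf_selfmap \<phi> \<longleftrightarrow> (\<exists>A B C d. \<phi> = lin_frac A B C d \<and>
      (\<forall>z\<in>ball 0 1. cinner z C + d \<noteq> 0) \<and> \<phi> ` ball 0 1 \<subseteq> ball 0 1)"

text \<open>D_\<eta> \<psi>_\<zeta>(z) = \<langle>\<psi>'(z)\<eta>,\<zeta>\<rangle>, the complex directional derivative.\<close>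
definition Dcomp :: "(complex ^ 'n \<Rightarrow> complex ^ 'n) \<Rightarrow> complex ^ 'n \<Rightarrow> complex ^ 'n
     \<Rightarrow> complex ^ 'n \<Rightarrow> complex" where
  "Dcomp \<psi> \<eta> \<zeta> z = deriv (\<lambda>t. cinner (\<psi> (z + t *s \<eta>)) \<zeta>) 0"

definition compact_op :: "('a \<Rightarrow> 'b::ab_group_add) set \<Rightarrow> (('a \<Rightarrow> 'b) \<Rightarrow> real)
     \<Rightarrow> (('a \<Rightarrow> 'b) \<Rightarrow> ('a \<Rightarrow> 'b)) \<Rightarrow> bool" where
  "compact_op H nrm T \<longleftrightarrow> (\<forall>(f :: nat \<Rightarrow> 'a \<Rightarrow> 'b) (M::real). (\<forall>k. f k \<in> H \<and> nrm (f k) \<le> M) \<longrightarrow>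
      (\<exists>(r :: nat \<Rightarrow> nat) g. strict_mono r \<and> g \<in> H \<and> (\<lambda>k. nrm (T (f (r k)) - g)) \<longlonglongrightarrow> 0))"

definition comp_op :: "('a \<Rightarrow> 'a) \<Rightarrow> ('a \<Rightarrow> 'b) \<Rightarrow> ('a \<Rightarrow> 'b)" where
  "comp_op \<phi> f = f \<circ> \<phi>"

end

theory Submission
  imports Defs "HOL-Complex_Analysis.Complex_Analysis"
begin

text \<open>
  Both spaces have a norm given by rotation-invariant measures, and their reproducing kernels are
  powers of \<open>1 / (1 - \<langle>z,w\<rangle>)\<close>: writing \<open>s = N\<close> for the Hardy space and \<open>s = N + \<alpha> + 1\<close> for the
  Bergman space, the moments \<open>\<integral> \<bar>\<langle>z,\<zeta>\<rangle>\<bar>\<^sup>2\<^sup>n\<close> equal \<open>n! / (s)\<^sub>n\<close>, which by Parseval on circles yields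
  \<open>\<bar>f(r\<zeta>)\<bar>\<^sup>2 \<le> (1 - r\<^sup>2)\<^sup>-\<^sup>s \<parallel>f\<parallel>\<^sup>2\<close>, with equality for \<open>(1 - r\<langle>z,\<zeta>\<rangle>)\<^sup>-\<^sup>s\<close>. Let \<open>f\<^sub>r\<close> be the normalised
  kernel functions. Then \<open>(1 - r\<^sup>2)\<^sup>s\<^sup>/\<^sup>2 f\<^sub>r(\<phi>(r\<zeta>))\<close> tends to \<open>(2 / (1 + a))\<^sup>s\<close> as \<open>r \<rightarrow> 1\<close>, where
  \<open>a = D\<^sub>\<zeta>\<phi>\<^sub>\<zeta>(\<zeta>)\<close> is real and nonnegative, and the same expression for \<open>\<psi>\<close> tends to a different number
  (to \<open>0\<close> if \<open>\<psi>(\<zeta>) \<noteq> \<zeta>\<close>). Hence \<open>(1 - r\<^sup>2)\<^sup>s\<^sup>/\<^sup>2 \<bar>(C\<^sub>\<phi> - C\<^sub>\<psi>) f\<^sub>r (r\<zeta>)\<bar>\<close> stays away from \<open>0\<close>, whereas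
  \<open>(1 - r\<^sup>2)\<^sup>s\<^sup>/\<^sup>2 \<bar>g(r\<zeta>)\<bar>\<close> tends to \<open>0\<close> for every norm limit \<open>g\<close> of the functions \<open>(C\<^sub>\<phi> - C\<^sub>\<psi>) f\<^sub>r\<close>.
\<close>


section \<open>Lebesgue measure: isometries and homogeneous functions\<close>

text \<open>All moments come from one Gaussian computation. A positively homogeneous function
  integrates against a radial weight to its integral over the unit ball times a one-dimensional
  integral; so the Gaussian moments give those of the ball, and these give the weighted-ball and
  sphere moments. The Hardy norm is a supremum rather than an integral. It is handled one radius at
  a time: the sphere of radius \<open>\<rho> < 1\<close> carries a probability measure inside the
  open ball, so both spaces share the same estimates. The number \<open>a\<close> is real and
  nonnegative because the real part of the slice function takes its maximal value 1 at the boundary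
  point 1 and cannot grow along any direction pointing into the disc. The limits for the two maps
  then differ because \<open>x powr (- s)\<close> is injective on positive \<open>x\<close>. The
  decay for a norm limit \<open>g\<close> has this reason: \<open>g\<close> is close in norm to the
  image of one fixed kernel function; that image is a bounded function, so its weighted values tend
  to 0; and the growth estimate transfers this to \<open>g\<close> up to the norm error.\<close>

lemma ball_in_borel [measurable]: "ball (x::'a::metric_space) r \<in> sets borel"
  by (rule borel_open) (rule open_ball)

lemma nn_integral_lborel_translate:
  fixes a :: "'a::euclidean_space" and f :: "'a \<Rightarrow> ennreal"
  assumes [measurable]: "f \<in> borel_measurable borel"
  shows "(\<integral>\<^sup>+x. f (a + x) \<partial>lborel) = (\<integral>\<^sup>+x. f x \<partial>lborel)"
proof -
  have "(\<integral>\<^sup>+x. f x \<partial>lborel) = (\<integral>\<^sup>+x. f x \<partial>distr lborel borel ((+) a))"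
    by (simp add: lborel_distr_plus)
  also have "\<dots> = (\<integral>\<^sup>+x. f (a + x) \<partial>lborel)"
    by (subst nn_integral_distr) auto
  finally show ?thesis ..
qed

lemma nn_integral_lborel_scaleR:
  fixes f :: "'a::euclidean_space \<Rightarrow> ennreal"
  assumes [measurable]: "f \<in> borel_measurable borel" and "t > 0"
  shows "(\<integral>\<^sup>+x. f x \<partial>lborel) = ennreal (t ^ DIM('a)) * (\<integral>\<^sup>+x. f (t *\<^sub>R x) \<partial>lborel)"
proof -
  have "(\<integral>\<^sup>+x. f x \<partial>lborel)
      = (\<integral>\<^sup>+x. f x \<partial>density (distr lborel borel (\<lambda>x. 0 + t *\<^sub>R x)) (\<lambda>_. \<bar>t\<bar>^DIM('a)))"
    using lborel_affine[of t "0::'a"] \<open>t > 0\<close> by simp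
  also have "\<dots> = (\<integral>\<^sup>+x. ennreal (t ^ DIM('a)) * f (t *\<^sub>R x) \<partial>lborel)"
    using \<open>t > 0\<close> by (simp add: nn_integral_density nn_integral_distr)
  also have "\<dots> = ennreal (t ^ DIM('a)) * (\<integral>\<^sup>+x. f (t *\<^sub>R x) \<partial>lborel)"
    by (rule nn_integral_cmult) auto
  finally show ?thesis .
qed

text \<open>The usual uniqueness argument for Haar measure: compute the integral of
  \<open>f (T x + y)\<close> over pairs with \<open>y\<close> in the unit ball in both orders.\<close>

lemma nn_integral_lborel_isometry:
  fixes T :: "'a::euclidean_space \<Rightarrow> 'a" and f :: "'a \<Rightarrow> ennreal"
  assumes lin: "linear T" and nrm: "\<And>x. norm (T x) = norm x"
    and f[measurable]: "f \<in> borel_measurable borel"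
  shows "(\<integral>\<^sup>+x. f (T x) \<partial>lborel) = (\<integral>\<^sup>+x. f x \<partial>lborel)"
proof -
  have inj: "inj T"
    using nrm by (metis lin linear_inj_on_iff_eq_0 norm_eq_zero subspace_UNIV)
  have surj: "surj T"
    using lin inj by (rule linear_injective_imp_surjective) simp
  have contT: "continuous_on UNIV T"
    using lin by (simp add: linear_continuous_on linear_linear)
  note [measurable] = borel_measurable_continuous_onI[OF contT]
  define g :: "'a \<Rightarrow> ennreal" where "g = indicator (ball 0 1)"
  have [measurable]: "g \<in> borel_measurable borel" unfolding g_def by measurable
  define c where "c = (\<integral>\<^sup>+x. g x \<partial>lborel)"
  have c: "c = emeasure lborel (ball (0::'a) 1)" by (simp add: c_def g_def)
  have c_fin: "c \<noteq> \<infinity>" using c emeasure_lborel_ball_finite[of "0::'a" 1] by auto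
  have c_pos: "c \<noteq> 0"
    using c open_not_negligible[of "ball (0::'a) 1"] 
    by (simp add: negligible_iff_null_sets null_sets_def)
  \<comment> \<open>Since \<open>T\<close> is a surjective isometry, the points \<open>x\<close>
    with \<open>T x\<close> within distance 1 of \<open>y\<close> form the unit ball about the
    preimage of \<open>y\<close>, whose volume is again \<open>c\<close>.\<close>
  have cball: "(\<integral>\<^sup>+x. g (y - T x) \<partial>lborel) = c" for y
  proof -
    obtain y' where y: "y = T y'" using surj by blast
    have "g (y - T x) = indicator (ball y' 1) x" for x
      using nrm[of "y' - x"] lin by (simp add: g_def y linear_diff indicator_def dist_norm norm_minus_commute)
    then have "(\<integral>\<^sup>+x. g (y - T x) \<partial>lborel) = (\<integral>\<^sup>+x. indicator (ball y' 1) x \<partial>lborel)" by simp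
    also have "\<dots> = (\<integral>\<^sup>+x. indicator (ball y' 1) (y' + x) \<partial>lborel)"
      by (rule nn_integral_lborel_translate[symmetric]) auto
    also have "\<dots> = c"
      unfolding c_def g_def by (intro nn_integral_cong) (simp add: indicator_def dist_norm)
    finally show ?thesis .
  qed
  have shift: "(\<integral>\<^sup>+x. f (T x + y) \<partial>lborel) = (\<integral>\<^sup>+x. f (T x) \<partial>lborel)" for y
  proof -
    obtain y' where y: "y = T y'" using surj by blast
    have "(\<integral>\<^sup>+x. f (T x + y) \<partial>lborel) = (\<integral>\<^sup>+x. f (T (y' + x)) \<partial>lborel)"
      using lin by (simp add: y linear_add add.commute)
    also have "\<dots> = (\<integral>\<^sup>+x. f (T x) \<partial>lborel)"
      by (rule nn_integral_lborel_translate) measurable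
    finally show ?thesis .
  qed
  have "(\<integral>\<^sup>+x. f (T x) \<partial>lborel) * c = (\<integral>\<^sup>+y. (\<integral>\<^sup>+x. f (T x) \<partial>lborel) * g y \<partial>lborel)"
    unfolding c_def by (rule nn_integral_cmult[symmetric]) auto
  also have "\<dots> = (\<integral>\<^sup>+y. (\<integral>\<^sup>+x. f (T x + y) * g y \<partial>lborel) \<partial>lborel)"
    by (subst nn_integral_multc) (auto simp: shift)
  also have "\<dots> = (\<integral>\<^sup>+x. (\<integral>\<^sup>+y. f (T x + y) * g y \<partial>lborel) \<partial>lborel)"
    by (rule lborel_pair.Fubini') measurable
  also have "\<dots> = (\<integral>\<^sup>+x. (\<integral>\<^sup>+y. f y * g (y - T x) \<partial>lborel) \<partial>lborel)"
  proof (rule nn_integral_cong)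
    fix x
    have "(\<integral>\<^sup>+y. f (T x + y) * g y \<partial>lborel) = (\<integral>\<^sup>+y. f (T x + y) * g ((T x + y) - T x) \<partial>lborel)" by simp
    also have "\<dots> = (\<integral>\<^sup>+y. f y * g (y - T x) \<partial>lborel)"
      by (rule nn_integral_lborel_translate) measurable
    finally show "(\<integral>\<^sup>+y. f (T x + y) * g y \<partial>lborel) = (\<integral>\<^sup>+y. f y * g (y - T x) \<partial>lborel)" .
  qed
  also have "\<dots> = (\<integral>\<^sup>+y. (\<integral>\<^sup>+x. f y * g (y - T x) \<partial>lborel) \<partial>lborel)"
    by (rule lborel_pair.Fubini') measurable
  also have "\<dots> = (\<integral>\<^sup>+y. f y * c \<partial>lborel)"
    by (subst nn_integral_cmult) (auto simp: cball)
  also have "\<dots> = (\<integral>\<^sup>+y. f y \<partial>lborel) * c"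
    by (rule nn_integral_multc) auto
  finally show ?thesis
    using c_fin c_pos by (metis ennreal_mult_divide_eq infinity_ennreal_def)
qed

text \<open>Distribution function of the radial density, whose factor \<open>K\<close> gives mass 1
  to the unit interval. It serves to recognise a measure on the line from its values on
  half-lines.\<close>

lemma nn_integral_power_lessThan:
  assumes "K > 0"
  shows "(\<integral>\<^sup>+u. ennreal (real K * u ^ (K - 1)) * indicator {0..} u * indicator {..<v} u \<partial>lborel)
     = ennreal (max 0 v ^ K)"
proof (cases "v > 0")
  case True
  have "(\<integral>\<^sup>+u. ennreal (real K * u ^ (K - 1)) * indicator {0..} u * indicator {..<v} u \<partial>lborel)
      = (\<integral>\<^sup>+u. ennreal (real K * u ^ (K - 1)) * indicator {0..v} u \<partial>lborel)"
    by (intro nn_integral_cong_AE, use AE_lborel_singleton[of v] in eventually_elim)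
       (auto simp: indicator_def)
  also have "\<dots> = ennreal (v ^ K - 0 ^ K)"
    using True assms
    by (intro nn_integral_FTC_Icc) (auto intro!: derivative_eq_intros)
  finally show ?thesis using True assms by (simp add: max_def)
next
  case False
  have "(\<integral>\<^sup>+u. ennreal (real K * u ^ (K - 1)) * indicator {0..} u * indicator {..<v} u \<partial>lborel)
      = (\<integral>\<^sup>+(u::real). 0 \<partial>lborel)"
    using False by (intro nn_integral_cong) (auto simp: indicator_def)
  then show ?thesis using False assms by (simp add: max_def)
qed

text \<open>Takes the place of polar coordinates. The real dimension is twice
  \<open>CARD('n)\<close>, so scaling by \<open>sqrt v\<close> shows that \<open>h\<close> gives the
  set \<open>|z|^2 < v\<close> the mass \<open>v ^ (CARD('n) + k)\<close> times that of the unit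
  ball. This determines the image of the measure \<open>h dz\<close> under the squared norm.\<close>

lemma nn_integral_homogeneous_radial:
  fixes h :: "complex ^ 'n \<Rightarrow> ennreal" and F :: "real \<Rightarrow> ennreal"
  assumes h[measurable]: "h \<in> borel_measurable borel"
    and hom: "\<And>t z. t > 0 \<Longrightarrow> h (t *\<^sub>R z) = ennreal (t ^ (2 * k)) * h z"
    and fin: "(\<integral>\<^sup>+z. h z * indicator (ball 0 1) z \<partial>lborel) < \<infinity>"
    and F[measurable]: "F \<in> borel_measurable borel"
  shows "(\<integral>\<^sup>+z. h z * F ((norm z)\<^sup>2) \<partial>lborel)
    = (\<integral>\<^sup>+z. h z * indicator (ball 0 1) z \<partial>lborel) *
      (\<integral>\<^sup>+u. ennreal (real (CARD('n) + k) * u ^ (CARD('n) + k - 1)) * indicator {0..} u * F u \<partial>lborel)"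
proof -
  define c where "c = (\<integral>\<^sup>+z. h z * indicator (ball 0 1) z \<partial>lborel)"
  define K where "K = CARD('n) + k"
  have K: "K > 0" unfolding K_def by simp
  define q where "q u = ennreal (real K * u ^ (K - 1)) * indicator {0..} u" for u :: real
  have [measurable]: "q \<in> borel_measurable borel" unfolding q_def by measurable
  \<comment> \<open>\<open>M\<close> is the true image measure and \<open>M'\<close> the candidate
    with the explicit density; they are compared on half-lines, which form an intersection-stable
    generator.\<close>
  define M where "M = distr (density lborel h) borel (\<lambda>z. (norm z)\<^sup>2)"
  define M' where "M' = density lborel (\<lambda>u. c * q u)"
  have eM: "emeasure M {..<v} = c * ennreal (max 0 v ^ K)" for v
  proof -
    have "emeasure M {..<v} = (\<integral>\<^sup>+z. h z * indicator {..<v} ((norm z)\<^sup>2) \<partial>lborel)"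
    proof -
      have "emeasure M {..<v} = emeasure (density lborel h) ((\<lambda>z. (norm z)\<^sup>2) -` {..<v})"
        unfolding M_def by (subst emeasure_distr) auto
      also have "\<dots> = (\<integral>\<^sup>+z. h z * indicator ((\<lambda>z. (norm z)\<^sup>2) -` {..<v}) z \<partial>lborel)"
        by (rule emeasure_density) (auto intro!: measurable_sets_borel[of _ borel])
      also have "\<dots> = (\<integral>\<^sup>+z. h z * indicator {..<v} ((norm z)\<^sup>2) \<partial>lborel)"
        by (intro nn_integral_cong) (auto simp: indicator_def)
      finally show ?thesis .
    qed
    also have "\<dots> = c * ennreal (max 0 v ^ K)"
    proof (cases "v > 0")
      case True
      define t where "t = sqrt v"
      have t: "t > 0" "t\<^sup>2 = v" using True by (auto simp: t_def)
      have "(\<integral>\<^sup>+z. h z * indicator {..<v} ((norm z)\<^sup>2) \<partial>lborel)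
        = ennreal (t ^ DIM(complex^'n)) * (\<integral>\<^sup>+z. h (t *\<^sub>R z) * indicator {..<v} ((norm (t *\<^sub>R z))\<^sup>2) \<partial>lborel)"
        by (rule nn_integral_lborel_scaleR) (use t in auto)
      also have "(\<integral>\<^sup>+z. h (t *\<^sub>R z) * indicator {..<v} ((norm (t *\<^sub>R z))\<^sup>2) \<partial>lborel)
         = (\<integral>\<^sup>+z. ennreal (t ^ (2 * k)) * (h z * indicator (ball 0 1) z) \<partial>lborel)"
      proof (intro nn_integral_cong)
        fix z :: "complex^'n"
        have "(norm (t *\<^sub>R z))\<^sup>2 < v \<longleftrightarrow> norm z < 1"
          using t by (simp add: power_mult_distrib flip: t(2)) (metis abs_norm_cancel abs_square_less_1)
        then show "h (t *\<^sub>R z) * indicator {..<v} ((norm (t *\<^sub>R z))\<^sup>2)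
            = ennreal (t ^ (2 * k)) * (h z * indicator (ball 0 1) z)"
          using hom[OF t(1), of z] by (simp add: indicator_def)
      qed
      also have "\<dots> = ennreal (t ^ (2 * k)) * c"
        unfolding c_def by (rule nn_integral_cmult) measurable
      also have "ennreal (t ^ DIM(complex^'n)) * (ennreal (t ^ (2 * k)) * c) = c * ennreal (t ^ DIM(complex^'n) * t ^ (2 * k))"
        using t by (simp add: ennreal_mult mult_ac)
      also have "t ^ DIM(complex^'n) * t ^ (2 * k) = v ^ K"
        by (simp add: K_def power_add t(2)[symmetric] flip: power_mult) (simp add: mult.commute)
      finally show ?thesis using True by (simp add: max_def)
    next
      case False
      have "(\<integral>\<^sup>+z. h z * indicator {..<v} ((norm z)\<^sup>2) \<partial>lborel) = (\<integral>\<^sup>+(z::complex^'n). 0 \<partial>lborel)"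
      proof (intro nn_integral_cong)
        fix z :: "complex^'n"
        have "\<not> (norm z)\<^sup>2 < v" using False by (meson not_less order_trans zero_le_power2)
        then show "h z * indicator {..<v} ((norm z)\<^sup>2) = 0" by (simp add: indicator_def)
      qed
      then show ?thesis using False K by (simp add: max_def)
    qed
    finally show ?thesis .
  qed
  have eM': "emeasure M' {..<v} = c * ennreal (max 0 v ^ K)" for v
  proof -
    have "emeasure M' {..<v} = (\<integral>\<^sup>+u. c * (q u * indicator {..<v} u) \<partial>lborel)"
      unfolding M'_def by (subst emeasure_density) (auto simp: mult_ac)
    also have "\<dots> = c * (\<integral>\<^sup>+u. q u * indicator {..<v} u \<partial>lborel)"
      by (rule nn_integral_cmult) auto
    also have "\<dots> = c * ennreal (max 0 v ^ K)"
      unfolding q_def by (subst nn_integral_power_lessThan[OF K]) simp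
    finally show ?thesis .
  qed
  have "M = M'"
  proof (rule measure_eqI_generator_eq[where E = "range lessThan" and \<Omega> = UNIV and A = "\<lambda>i. {..<real i}"])
    show "Int_stable (range (lessThan :: real \<Rightarrow> _))"
    proof -
      have "{..<a} \<inter> {..<b} = {..<min a b}" for a b :: real by auto
      then show ?thesis by (auto simp: Int_stable_def)
    qed
    show "sets M = sigma_sets UNIV (range lessThan)" "sets M' = sigma_sets UNIV (range lessThan)"
      by (simp_all add: M_def M'_def borel_Iio)
    show "(\<Union>i. {..<real i}) = UNIV"
      by (auto simp: reals_Archimedean2)
    show "emeasure M {..<real i} \<noteq> \<infinity>" for i
      using fin by (simp add: eM c_def[symmetric] ennreal_mult_eq_top_iff)
  qed (auto simp: eM eM')
  have "(\<integral>\<^sup>+z. h z * F ((norm z)\<^sup>2) \<partial>lborel) = (\<integral>\<^sup>+u. F u \<partial>M)"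
    unfolding M_def by (simp add: nn_integral_distr nn_integral_density)
  also have "\<dots> = (\<integral>\<^sup>+u. c * (q u * F u) \<partial>lborel)"
    unfolding \<open>M = M'\<close> M'_def by (simp add: nn_integral_density mult.assoc)
  also have "\<dots> = c * (\<integral>\<^sup>+u. q u * F u \<partial>lborel)"
    by (rule nn_integral_cmult) auto
  finally show ?thesis unfolding c_def q_def K_def .
qed


section \<open>The Hermitian inner product\<close>

lemma cinner_add_left: "cinner (x + y) w = cinner x w + cinner y w"
  by (simp add: cinner_def distrib_right sum.distrib)

lemma cinner_diff_left: "cinner (x - y) w = cinner x w - cinner y w"
  by (simp add: cinner_def left_diff_distrib sum_subtractf)

lemma cinner_smult_left: "cinner (c *s x) w = c * cinner x w"
  by (simp add: cinner_def sum_distrib_left mult.assoc)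

lemma cinner_scaleR_left: "cinner (r *\<^sub>R x) w = of_real r * cinner x w"
  unfolding cinner_def sum_distrib_left
  by (intro sum.cong refl) (simp add: scaleR_conv_of_real[where 'a = complex])

lemma cinner_commute: "cinner x y = cnj (cinner y x)"
  by (simp add: cinner_def mult.commute)

lemma cinner_self: "cinner z z = of_real ((norm z)\<^sup>2)"
proof -
  have "(norm z)\<^sup>2 = (\<Sum>j\<in>UNIV. (cmod (z $ j))\<^sup>2)"
    by (simp add: norm_vec_def L2_set_def sum_nonneg)
  then show ?thesis
    by (simp only: cinner_def complex_norm_square of_real_sum)
qed

lemma Re_cinner: "Re (cinner z w) = z \<bullet> w"
  by (simp add: cinner_def inner_vec_def inner_complex_def)

lemma norm_smult_complex: "norm (c *s (z::complex^'n)) = cmod c * norm z"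
proof -
  have "(norm (c *s z))\<^sup>2 = (cmod c * norm z)\<^sup>2"
    by (simp add: norm_vec_def L2_set_def sum_nonneg norm_mult power_mult_distrib sum_distrib_left)
  then show ?thesis by simp
qed

lemma continuous_on_cinner [continuous_intros]:
  "continuous_on S f \<Longrightarrow> continuous_on S (\<lambda>x. cinner (f x) w)"
  unfolding cinner_def by (intro continuous_intros)

lemma borel_measurable_cinner [measurable]: "(\<lambda>z. cinner z w) \<in> borel_measurable borel"
  by (intro borel_measurable_continuous_onI continuous_intros)

lemma continuous_on_smult [continuous_intros]:
  fixes f :: "'a::topological_space \<Rightarrow> complex" and g :: "'a \<Rightarrow> complex ^ 'n"
  shows "continuous_on S f \<Longrightarrow> continuous_on S g \<Longrightarrow> continuous_on S (\<lambda>x. f x *s g x)"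
  unfolding vector_scalar_mult_def by (intro continuous_intros)

text \<open>The vector \<open>z - cinner z \<zeta> *s \<zeta>\<close> is orthogonal to
  \<open>\<zeta>\<close>. With \<open>a = cinner z \<zeta>\<close> and \<open>c = 1\<close> this
  splits the norm of \<open>z\<close>; with unimodular \<open>c\<close> it shows that rotating the
  orthogonal part is an isometry.\<close>

lemma cinner_pythagoras:
  assumes "norm \<zeta> = 1"
  shows "(norm (a *s \<zeta> + c *s (z - cinner z \<zeta> *s \<zeta>)))\<^sup>2
      = (cmod a)\<^sup>2 + (cmod c)\<^sup>2 * (norm (z - cinner z \<zeta> *s \<zeta>))\<^sup>2"
proof -
  define v where "v = z - cinner z \<zeta> *s \<zeta>"
  have v: "cinner v \<zeta> = 0"
    using assms by (simp add: v_def cinner_diff_left cinner_smult_left cinner_self)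
  have v': "cinner \<zeta> v = 0" using v cinner_commute[of \<zeta> v] by simp
  have right: "cinner x (a *s \<zeta> + c *s v) = cnj a * cinner x \<zeta> + cnj c * cinner x v" for x
    by (subst (1 2 3) cinner_commute) (simp add: cinner_add_left cinner_smult_left)
  have "complex_of_real ((norm (a *s \<zeta> + c *s v))\<^sup>2) = cinner (a *s \<zeta> + c *s v) (a *s \<zeta> + c *s v)"
    by (simp only: cinner_self)
  also have "\<dots> = a * cnj a + c * cnj c * cinner v v"
    using assms by (simp only: right cinner_add_left cinner_smult_left v v' cinner_self[of \<zeta>]) simp
  also have "\<dots> = complex_of_real ((cmod a)\<^sup>2 + (cmod c)\<^sup>2 * (norm v)\<^sup>2)"
    by (simp only: cinner_self complex_norm_square of_real_add of_real_mult)
  finally show ?thesis unfolding v_def of_real_eq_iff .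
qed

lemma norm_cinner_le:
  assumes "norm \<zeta> = 1"
  shows "cmod (cinner z \<zeta>) \<le> norm z"
proof -
  have "(norm z)\<^sup>2 = (cmod (cinner z \<zeta>))\<^sup>2 + (norm (z - cinner z \<zeta> *s \<zeta>))\<^sup>2"
    using cinner_pythagoras[OF assms, of "cinner z \<zeta>" 1 z] by simp
  then have "(cmod (cinner z \<zeta>))\<^sup>2 \<le> (norm z)\<^sup>2" by simp
  then show ?thesis by (simp add: power2_le_iff_abs_le)
qed

section \<open>Parseval's identity on the circle\<close>

lemma has_integral_cis_int:
  "((\<lambda>t. cis (2 * pi * (of_int j * t))) has_integral (if j = 0 then 1 else 0)) {0..1}"
proof (cases "j = 0")
  case True
  then show ?thesis using has_integral_const_real[of "1::complex" 0 1] by simp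
next
  case False
  define F where "F = (\<lambda>t. cis (2 * pi * (of_int j * t)) / (2 * pi * of_int j * \<i>))"
  have "((\<lambda>t. cis (2 * pi * (of_int j * t))) has_integral (F 1 - F 0)) {0..1}"
  proof (rule fundamental_theorem_of_calculus)
    fix t :: real
    have "((\<lambda>z. exp (\<i> * (2 * pi * (of_int j * z))) / (2 * pi * of_int j * \<i>))
          has_field_derivative exp (\<i> * (2 * pi * (of_int j * of_real t)))) (at (of_real t))"
      using False by (auto intro!: derivative_eq_intros)
    from has_vector_derivative_real_field[OF this]
    show "(F has_vector_derivative cis (2 * pi * (of_int j * t))) (at t within {0..1})"
      by (simp add: F_def cis_conv_exp)
  qed simp
  moreover have "cis (2 * pi * of_int j) = 1"
    using cis_multiple_2pi[of "of_int j"] by simp 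
  ultimately show ?thesis using False by (simp add: F_def)
qed

lemma has_integral_trig_poly_square:
  "((\<lambda>t. (cmod (\<Sum>n<K. b n * cis (2 * pi * t) ^ n))\<^sup>2) has_integral (\<Sum>n<K. (cmod (b n))\<^sup>2)) {0..1}"
proof -
  have eq: "complex_of_real ((cmod (\<Sum>n<K. b n * cis (2 * pi * t) ^ n))\<^sup>2)
     = (\<Sum>n<K. \<Sum>m<K. b n * cnj (b m) * cis (2 * pi * (of_int (int n - int m) * t)))" for t
  proof -
    have "complex_of_real ((cmod (\<Sum>n<K. b n * cis (2 * pi * t) ^ n))\<^sup>2)
      = (\<Sum>n<K. b n * cis (2 * pi * t) ^ n) * (\<Sum>m<K. cnj (b m) * cis (- (2 * pi * t)) ^ m)"
      by (subst complex_norm_square) (simp add: cis_cnj)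
    also have "\<dots> = (\<Sum>n<K. \<Sum>m<K. b n * cnj (b m) * (cis (2 * pi * t) ^ n * cis (- (2 * pi * t)) ^ m))"
      by (simp add: sum_product mult_ac)
    also have "\<dots> = (\<Sum>n<K. \<Sum>m<K. b n * cnj (b m) * cis (2 * pi * (of_int (int n - int m) * t)))"
      by (intro sum.cong refl arg_cong2[where f = "(*)"])
         (simp add: Complex.DeMoivre cis_mult algebra_simps)
    finally show ?thesis .
  qed
  have "((\<lambda>t. \<Sum>n<K. \<Sum>m<K. b n * cnj (b m) * cis (2 * pi * (of_int (int n - int m) * t)))
     has_integral (\<Sum>n<K. \<Sum>m<K. b n * cnj (b m) * (if int n - int m = 0 then 1 else 0))) {0..1}"
    by (intro has_integral_sum has_integral_mult_right has_integral_cis_int) auto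
  also have "(\<Sum>n<K. \<Sum>m<K. b n * cnj (b m) * (if int n - int m = 0 then 1 else 0))
     = complex_of_real (\<Sum>n<K. (cmod (b n))\<^sup>2)"
    by (simp add: if_distrib sum.delta flip: complex_norm_square cong: if_cong)
  finally have "((\<lambda>t. complex_of_real ((cmod (\<Sum>n<K. b n * cis (2 * pi * t) ^ n))\<^sup>2))
      has_integral complex_of_real (\<Sum>n<K. (cmod (b n))\<^sup>2)) {0..1}"
    by (simp only: eq)
  from has_integral_linear[OF this bounded_linear_Re] show ?thesis
    by (simp add: o_def)
qed

text \<open>Limit of the identity for trigonometric polynomials. Absolute summability bounds all
  partial sums by one constant \<open>S\<close>, which dominates on the unit interval.\<close>

lemma parseval_circle:
  fixes b :: "nat \<Rightarrow> complex"
  assumes summ: "summable (\<lambda>n. norm (b n))"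
  shows "(\<integral>\<^sup>+t\<in>{0..1}. ennreal ((cmod (\<Sum>n. b n * cis (2 * pi * t) ^ n))\<^sup>2) \<partial>lborel)
     = (\<Sum>n. ennreal ((cmod (b n))\<^sup>2))"
proof -
  define S where "S = (\<Sum>n. norm (b n))"
  have [measurable]: "cis \<in> borel_measurable borel"
    by (intro borel_measurable_continuous_onI continuous_intros)
  define u where "u K t = ennreal ((cmod (\<Sum>n<K. b n * cis (2 * pi * t) ^ n))\<^sup>2) * indicator {0..1} t" for K t
  have [measurable]: "u K \<in> borel_measurable borel" for K
    unfolding u_def by measurable
  have summ': "summable (\<lambda>n. b n * cis (2 * pi * t) ^ n)" for t
    by (rule summable_norm_cancel) (simp add: norm_mult norm_power summ)
  have lim: "(\<lambda>K. u K t) \<longlonglongrightarrow> ennreal ((cmod (\<Sum>n. b n * cis (2 * pi * t) ^ n))\<^sup>2) * indicator {0..1} t" for t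
  proof -
    have "(\<lambda>K. (cmod (\<Sum>n<K. b n * cis (2 * pi * t) ^ n))\<^sup>2 * indicat_real {0..1} t)
        \<longlonglongrightarrow> (cmod (\<Sum>n. b n * cis (2 * pi * t) ^ n))\<^sup>2 * indicat_real {0..1} t"
      by (intro tendsto_intros summable_LIMSEQ summ')
    from tendsto_ennrealI[OF this] show ?thesis
      by (simp add: u_def ennreal_mult' ennreal_indicator)
  qed
  have bd: "u K t \<le> ennreal (S\<^sup>2) * indicator {0..1} t" for K t
  proof -
    have "cmod (\<Sum>n<K. b n * cis (2 * pi * t) ^ n) \<le> (\<Sum>n<K. norm (b n))"
      by (rule order_trans[OF norm_sum]) (simp add: norm_mult norm_power)
    also have "\<dots> \<le> S" unfolding S_def by (rule sum_le_suminf[OF summ]) auto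
    finally have "(cmod (\<Sum>n<K. b n * cis (2 * pi * t) ^ n))\<^sup>2 \<le> S\<^sup>2"
      by (intro power_mono) auto
    then show ?thesis unfolding u_def by (intro mult_right_mono ennreal_leI) auto
  qed
  have int_u: "(\<integral>\<^sup>+t. u K t \<partial>lborel) = (\<Sum>n<K. ennreal ((cmod (b n))\<^sup>2))" for K
  proof -
    have "(\<integral>\<^sup>+t. u K t \<partial>lborel) = (\<integral>\<^sup>+t. ennreal (if t \<in> {0..1} then (cmod (\<Sum>n<K. b n * cis (2 * pi * t) ^ n))\<^sup>2 else 0) \<partial>lborel)"
      unfolding u_def by (intro nn_integral_cong) (simp add: indicator_def)
    also have "\<dots> = ennreal (\<Sum>n<K. (cmod (b n))\<^sup>2)"
      by (rule nn_integral_has_integral_lborel)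
         (use has_integral_trig_poly_square[where b = b and K = K] in
           \<open>auto simp: has_integral_restrict_UNIV simp del: atLeastAtMost_iff\<close>)
    finally show ?thesis by simp
  qed
  have "(\<lambda>K. \<integral>\<^sup>+t. u K t \<partial>lborel) \<longlonglongrightarrow>
      (\<integral>\<^sup>+t. ennreal ((cmod (\<Sum>n. b n * cis (2 * pi * t) ^ n))\<^sup>2) * indicator {0..1} t \<partial>lborel)"
  proof (rule nn_integral_dominated_convergence[where w = "\<lambda>t. ennreal (S\<^sup>2) * indicator {0..1} t"])
    show "(\<lambda>t. ennreal ((cmod (\<Sum>n. b n * cis (2 * pi * t) ^ n))\<^sup>2) * indicator {0..1} t) \<in> borel_measurable lborel"
      by (rule borel_measurable_LIMSEQ_order[where u = u]) (auto simp: lim)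
    show "(\<integral>\<^sup>+t. ennreal (S\<^sup>2) * indicator {0..1::real} t \<partial>lborel) < \<infinity>"
      by (simp add: nn_integral_cmult)
  qed (auto simp: bd lim)
  moreover have "(\<lambda>K. \<integral>\<^sup>+t. u K t \<partial>lborel) \<longlonglongrightarrow> (\<Sum>n. ennreal ((cmod (b n))\<^sup>2))"
    unfolding int_u by (rule summable_LIMSEQ) auto
  ultimately show ?thesis by (rule LIMSEQ_unique)
qed

text \<open>Applies the circle identity with coefficients \<open>a n * l ^ n\<close>; convergence at
  a radius strictly beyond \<open>cmod l\<close> makes them absolutely summable.\<close>

lemma parseval_power_series:
  fixes a :: "nat \<Rightarrow> complex"
  assumes F: "\<And>w. cmod w < R \<Longrightarrow> (\<lambda>n. a n * w ^ n) sums F w" and l: "cmod l < R"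
  shows "(\<integral>\<^sup>+t\<in>{0..1}. ennreal ((cmod (F (cis (2 * pi * t) * l)))\<^sup>2) \<partial>lborel)
     = (\<Sum>n. ennreal ((cmod (a n))\<^sup>2 * cmod l ^ (2 * n)))"
proof -
  obtain x where x: "cmod l < x" "x < R" using l dense by blast
  have "x \<ge> 0" using x(1) norm_ge_zero[of l] by linarith
  then have "summable (\<lambda>n. a n * of_real x ^ n)"
    using F[of "of_real x"] x by (auto intro: sums_summable)
  then have summ: "summable (\<lambda>n. norm (a n * l ^ n))"
    by (rule powser_insidea) (use x \<open>x \<ge> 0\<close> in simp)
  have "F (cis (2 * pi * t) * l) = (\<Sum>n. (a n * l ^ n) * cis (2 * pi * t) ^ n)" for t
    using F[of "cis (2 * pi * t) * l"] l
    by (simp add: norm_mult sums_iff power_mult_distrib mult_ac)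
  then have "(\<integral>\<^sup>+t\<in>{0..1}. ennreal ((cmod (F (cis (2 * pi * t) * l)))\<^sup>2) \<partial>lborel)
     = (\<Sum>n. ennreal ((cmod (a n * l ^ n))\<^sup>2))"
    using parseval_circle[OF summ] by simp
  also have "(\<lambda>n. (cmod (a n * l ^ n))\<^sup>2) = (\<lambda>n. (cmod (a n))\<^sup>2 * cmod l ^ (2 * n))"
    by (simp add: norm_mult norm_power power_mult_distrib flip: power_mult) (simp add: mult.commute)
  finally show ?thesis .
qed

text \<open>In Parseval's identity on the unit circle, the value at 0 is the single term of index
  0.\<close>

lemma submean_square_holomorphic:
  assumes hol: "k holomorphic_on ball 0 R" and "R > 1"
  shows "ennreal ((cmod (k 0))\<^sup>2) \<le> (\<integral>\<^sup>+t\<in>{0..1}. ennreal ((cmod (k (cis (2 * pi * t))))\<^sup>2) \<partial>lborel)"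
proof -
  define a where "a n = (deriv ^^ n) k 0 / fact n" for n
  have sums: "(\<lambda>n. a n * w ^ n) sums k w" if "cmod w < R" for w
    using holomorphic_power_series[OF hol, of w] that by (simp add: a_def)
  have one: "cmod 1 < R" using \<open>R > 1\<close> by simp
  have "ennreal ((cmod (k 0))\<^sup>2) = (\<Sum>n<1. ennreal ((cmod (a n))\<^sup>2))"
    by (simp add: a_def)
  also have "\<dots> \<le> (\<Sum>n. ennreal ((cmod (a n))\<^sup>2))"
    by (rule sum_le_suminf) auto
  also have "\<dots> = (\<integral>\<^sup>+t\<in>{0..1}. ennreal ((cmod (k (cis (2 * pi * t))))\<^sup>2) \<partial>lborel)"
    using parseval_power_series[of R a k 1, OF sums one, symmetric]
    by (simp only: mult_1_right norm_one power_one)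
  finally show ?thesis .
qed


section \<open>Rotation averages\<close>

text \<open>Each \<open>V t\<close> preserves the measure, so averaging over \<open>t\<close>
  changes nothing; Tonelli moves the average inside. Joint continuity provides the joint
  measurability. It is applied to scalar rotations and to rotations that fix a given vector.\<close>

lemma nn_integral_circle_average:
  fixes V :: "real \<Rightarrow> 'b::second_countable_topology \<Rightarrow> 'b"
  assumes sets[measurable_cong]: "sets \<mu> = sets borel" and "sigma_finite_measure \<mu>"
    and u[measurable]: "u \<in> borel_measurable borel"
    and cont: "continuous_on UNIV (\<lambda>p. V (fst p) (snd p))"
    and inv: "\<And>t. distr \<mu> borel (V t) = \<mu>"
  shows "(\<integral>\<^sup>+z. u z \<partial>\<mu>) = (\<integral>\<^sup>+z. (\<integral>\<^sup>+t\<in>{0..1}. u (V t z) \<partial>lborel) \<partial>\<mu>)"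
proof -
  interpret pair_sigma_finite \<mu> "lborel :: real measure"
    using assms by (intro pair_sigma_finite.intro sigma_finite_lborel)
  have "(\<lambda>p. V (fst p) (snd p)) \<in> borel_measurable (borel \<Otimes>\<^sub>M borel)"
    using borel_measurable_continuous_onI[OF cont] by (simp add: borel_prod)
  then have V: "(\<lambda>(t, z). V t z) \<in> borel_measurable (borel \<Otimes>\<^sub>M borel)"
    by (simp add: case_prod_beta')
  have [measurable]: "(\<lambda>z. V t z) \<in> borel_measurable borel" for t
    using measurable_Pair2[OF V, of t] by simp
  have "(\<integral>\<^sup>+z. (\<integral>\<^sup>+t\<in>{0..1}. u (V t z) \<partial>lborel) \<partial>\<mu>) = (\<integral>\<^sup>+t. (\<integral>\<^sup>+z. u (V t z) * indicator {0..1} t \<partial>\<mu>) \<partial>lborel)"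
  proof (rule Fubini'[symmetric])
    have "(\<lambda>p. u (case_prod V (snd p, fst p)) * indicator {0..1} (snd p)) \<in> borel_measurable (\<mu> \<Otimes>\<^sub>M lborel)"
      using V by measurable
    then show "(\<lambda>(z, t). u (V t z) * indicator {0..1} t) \<in> borel_measurable (\<mu> \<Otimes>\<^sub>M lborel)"
      by (simp add: case_prod_beta')
  qed
  also have "\<dots> = (\<integral>\<^sup>+t. (\<integral>\<^sup>+z. u z \<partial>\<mu>) * indicator {0..1::real} t \<partial>lborel)"
  proof (rule nn_integral_cong)
    fix t :: real
    have "(\<integral>\<^sup>+z. u z \<partial>\<mu>) = (\<integral>\<^sup>+z. u z \<partial>distr \<mu> borel (V t))" by (simp add: inv)
    also have "\<dots> = (\<integral>\<^sup>+z. u (V t z) \<partial>\<mu>)" by (rule nn_integral_distr) auto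
    finally show "(\<integral>\<^sup>+z. u (V t z) * indicator {0..1} t \<partial>\<mu>) = (\<integral>\<^sup>+z. u z \<partial>\<mu>) * indicator {0..1} t"
      by (subst nn_integral_multc) auto
  qed
  also have "\<dots> = (\<integral>\<^sup>+z. u z \<partial>\<mu>)" by (simp add: nn_integral_cmult)
  finally show ?thesis ..
qed

text \<open>Averaging over scalar rotations sends \<open>cinner z \<zeta>\<close> around a full
  circle, where Parseval removes the cross terms, so only the moments of the measure remain. The
  radius is extended-real to cover both entire series under the Gaussian and series on the unit
  disc.\<close>

lemma nn_integral_square_power_series:
  fixes \<mu> :: "(complex ^ 'n) measure" and a :: "nat \<Rightarrow> complex"
  assumes sets[measurable_cong]: "sets \<mu> = sets borel" and sf: "sigma_finite_measure \<mu>"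
    and inv: "\<And>c. cmod c = 1 \<Longrightarrow> distr \<mu> borel (\<lambda>z. c *s z) = \<mu>"
    and F: "\<And>w. ereal (cmod w) < R \<Longrightarrow> (\<lambda>n. a n * w ^ n) sums F w"
    and AE: "AE z in \<mu>. ereal (cmod (cinner z \<zeta>)) < R"
  shows "(\<integral>\<^sup>+z. ennreal ((cmod (F (cinner z \<zeta>)))\<^sup>2) \<partial>\<mu>)
     = (\<Sum>n. ennreal ((cmod (a n))\<^sup>2) * (\<integral>\<^sup>+z. ennreal (cmod (cinner z \<zeta>) ^ (2 * n)) \<partial>\<mu>))"
proof -
  \<comment> \<open>Outside the disc of convergence \<open>F\<close> is arbitrary; the cut-off
    version is a pointwise limit of measurable functions.\<close>
  define F' where "F' w = (if ereal (cmod w) < R then F w else 0)" for w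
  have [measurable]: "F' \<in> borel_measurable borel"
  proof (rule borel_measurable_LIMSEQ_metric)
    fix w
    show "(\<lambda>K. if ereal (cmod w) < R then \<Sum>n<K. a n * w ^ n else 0) \<longlonglongrightarrow> F' w"
      using F[of w] by (simp add: F'_def sums_def)
  qed measurable
  define u where "u z = ennreal ((cmod (F' (cinner z \<zeta>)))\<^sup>2)" for z :: "complex ^ 'n"
  have [measurable]: "u \<in> borel_measurable borel" unfolding u_def by measurable
  have "(\<integral>\<^sup>+z. ennreal ((cmod (F (cinner z \<zeta>)))\<^sup>2) \<partial>\<mu>) = (\<integral>\<^sup>+z. u z \<partial>\<mu>)"
    by (intro nn_integral_cong_AE, use AE in eventually_elim) (simp add: u_def F'_def)
  also have "\<dots> = (\<integral>\<^sup>+z. (\<integral>\<^sup>+t\<in>{0..1}. u (cis (2 * pi * t) *s z) \<partial>lborel) \<partial>\<mu>)"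
    by (rule nn_integral_circle_average[OF sets sf])
       (auto intro!: inv continuous_intros)
  also have "\<dots> = (\<integral>\<^sup>+z. (\<Sum>n. ennreal ((cmod (a n))\<^sup>2 * cmod (cinner z \<zeta>) ^ (2 * n))) \<partial>\<mu>)"
  proof (intro nn_integral_cong_AE, use AE in eventually_elim)
    fix z :: "complex ^ 'n"
    assume "ereal (cmod (cinner z \<zeta>)) < R"
    \<comment> \<open>A real radius is inserted because Parseval for power series is stated for one,
      while \<open>R\<close> may be infinite.\<close>
    then obtain x where x: "cmod (cinner z \<zeta>) < x" "ereal x < R"
      using ereal_dense2 by force
    have Fx: "(\<lambda>n. a n * w ^ n) sums F' w" if "cmod w < x" for w
    proof -
      have "ereal (cmod w) < R" using that x(2) by (meson ereal_less_eq(3) le_less_trans less_imp_le)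
      then show ?thesis using F by (simp add: F'_def)
    qed
    show "(\<integral>\<^sup>+t\<in>{0..1}. u (cis (2 * pi * t) *s z) \<partial>lborel) = (\<Sum>n. ennreal ((cmod (a n))\<^sup>2 * cmod (cinner z \<zeta>) ^ (2 * n)))"
      unfolding u_def cinner_smult_left
      by (rule parseval_power_series[of x a F' "cinner z \<zeta>", OF Fx x(1)])
  qed
  also have "\<dots> = (\<Sum>n. (\<integral>\<^sup>+z. ennreal ((cmod (a n))\<^sup>2 * cmod (cinner z \<zeta>) ^ (2 * n)) \<partial>\<mu>))"
    by (rule nn_integral_suminf) measurable
  also have "\<dots> = (\<Sum>n. ennreal ((cmod (a n))\<^sup>2) * (\<integral>\<^sup>+z. ennreal (cmod (cinner z \<zeta>) ^ (2 * n)) \<partial>\<mu>))"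
    by (simp add: ennreal_mult nn_integral_cmult)
  finally show ?thesis .
qed

section \<open>Moments\<close>

lemma linear_smult_complex: "linear (\<lambda>z::complex^'n. c *s z)"
  by (rule linearI) (auto simp: vec_eq_iff algebra_simps)

lemma ball_moment_finite:
  fixes \<zeta> :: "complex ^ 'n"
  assumes "norm \<zeta> = 1"
  shows "(\<integral>\<^sup>+z. ennreal (cmod (cinner z \<zeta>) ^ (2 * k)) * indicator (ball 0 1) z \<partial>lborel) < \<infinity>"
proof -
  have "(\<integral>\<^sup>+z. ennreal (cmod (cinner z \<zeta>) ^ (2 * k)) * indicator (ball 0 1) z \<partial>lborel)
      \<le> (\<integral>\<^sup>+z. indicator (ball (0::complex^'n) 1) z \<partial>lborel)"
  proof (intro nn_integral_mono)
    fix z :: "complex ^ 'n"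
    have "cmod (cinner z \<zeta>) ^ (2 * k) \<le> 1" if "norm z < 1"
      using norm_cinner_le[OF assms, of z] that by (intro power_le_one) auto
    then show "ennreal (cmod (cinner z \<zeta>) ^ (2 * k)) * indicator (ball 0 1) z \<le> indicator (ball 0 1) z"
      by (auto simp: indicator_def)
  qed
  also have "\<dots> < \<infinity>"
    using emeasure_lborel_ball_finite[of "0::complex^'n" 1] by simp
  finally show ?thesis .
qed

text \<open>The radial factor is the Gamma integral of \<open>K * u ^ (K - 1) * exp (- u)\<close>,
  which equals \<open>fact K\<close> for \<open>K = CARD('n) + k\<close>.\<close>

lemma gaussian_moment_eq_ball_moment:
  fixes \<zeta> :: "complex ^ 'n"
  assumes "norm \<zeta> = 1"
  shows "(\<integral>\<^sup>+z. ennreal (cmod (cinner z \<zeta>) ^ (2 * k)) * ennreal (exp (- (norm z)\<^sup>2)) \<partial>lborel)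
    = (\<integral>\<^sup>+z. ennreal (cmod (cinner z \<zeta>) ^ (2 * k)) * indicator (ball 0 1) z \<partial>lborel)
      * ennreal (fact (CARD('n) + k))"
proof -
  define K where "K = CARD('n) + k"
  have K: "K > 0" unfolding K_def by simp
  have "(\<integral>\<^sup>+u. ennreal (real K * u ^ (K - 1)) * indicator {0..} u * ennreal (exp (- u)) \<partial>lborel)
     = (\<integral>\<^sup>+u. ennreal (real K) * (ennreal (u ^ (K - 1) * exp (- u)) * indicator {0..} u) \<partial>lborel)"
    by (intro nn_integral_cong) (auto simp: indicator_def ennreal_mult[symmetric] mult.assoc)
  also have "\<dots> = ennreal (real K) * ennreal (fact (K - 1))"
    by (simp add: nn_integral_cmult nn_intergal_power_times_exp_Ici)
  also have "\<dots> = ennreal (fact K)"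
    using K by (simp add: ennreal_mult[symmetric] fact_reduce)
  finally have K_int: "(\<integral>\<^sup>+u. ennreal (real K * u ^ (K - 1)) * indicator {0..} u * ennreal (exp (- u)) \<partial>lborel)
     = ennreal (fact K)" .
  show ?thesis
    by (subst nn_integral_homogeneous_radial[where k = k and F = "\<lambda>u. ennreal (exp (- u))"])
       (auto simp: ball_moment_finite[OF assms, simplified] K_int[unfolded K_def, simplified] cinner_scaleR_left norm_mult power_mult_distrib
         ennreal_mult)
qed

text \<open>The generating function \<open>\<integral> \<bar>exp (t \<langle>z,\<zeta>\<rangle>)\<bar>\<^sup>2 exp (- \<bar>z\<bar>\<^sup>2)\<close> is computed by completing the
  square; its coefficients are the Gaussian moments.\<close>

lemma gaussian_generating_function:
  fixes \<zeta> :: "complex ^ 'n"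
  assumes "norm \<zeta> = 1"
  shows "(\<integral>\<^sup>+z. ennreal ((cmod (exp (of_real t * cinner z \<zeta>)))\<^sup>2) * ennreal (exp (- (norm z)\<^sup>2)) \<partial>lborel)
    = ennreal (exp (t\<^sup>2)) * (\<integral>\<^sup>+(z::complex^'n). ennreal (exp (- (norm z)\<^sup>2)) \<partial>lborel)"
proof -
  have eq: "(cmod (exp (of_real t * cinner z \<zeta>)))\<^sup>2 * exp (- (norm z)\<^sup>2)
      = exp (t\<^sup>2) * exp (- (norm (- (t *\<^sub>R \<zeta>) + z))\<^sup>2)" for z
  proof -
    have "(norm (- (t *\<^sub>R \<zeta>) + z))\<^sup>2 = (norm z)\<^sup>2 - 2 * t * (z \<bullet> \<zeta>) + t\<^sup>2"
      using assms unfolding power2_norm_eq_inner norm_eq_1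
      by (simp add: inner_simps inner_commute[of \<zeta> z] power2_eq_square right_diff_distrib)
    moreover have "(cmod (exp (of_real t * cinner z \<zeta>)))\<^sup>2 = exp (2 * t * (z \<bullet> \<zeta>))"
      by (simp add: Re_cinner power2_eq_square flip: exp_add)
    ultimately show ?thesis by (simp flip: exp_add)
  qed
  have "(\<integral>\<^sup>+z. ennreal ((cmod (exp (of_real t * cinner z \<zeta>)))\<^sup>2) * ennreal (exp (- (norm z)\<^sup>2)) \<partial>lborel)
     = (\<integral>\<^sup>+z. ennreal (exp (t\<^sup>2)) * ennreal (exp (- (norm (- (t *\<^sub>R \<zeta>) + z))\<^sup>2)) \<partial>lborel)"
    by (simp only: ennreal_mult'[symmetric] eq zero_le_power2 norm_ge_zero exp_ge_zero ennreal_mult''[symmetric])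
  also have "\<dots> = ennreal (exp (t\<^sup>2)) * (\<integral>\<^sup>+z. ennreal (exp (- (norm (- (t *\<^sub>R \<zeta>) + z))\<^sup>2)) \<partial>lborel)"
    by (rule nn_integral_cmult) auto
  also have "(\<integral>\<^sup>+z. ennreal (exp (- (norm (- (t *\<^sub>R \<zeta>) + z))\<^sup>2)) \<partial>lborel)
      = (\<integral>\<^sup>+(z::complex^'n). ennreal (exp (- (norm z)\<^sup>2)) \<partial>lborel)"
    by (rule nn_integral_lborel_translate) auto
  finally show ?thesis .
qed


text \<open>The sums are compared only at nonnegative points because the variable will be the square
  of a real parameter. Convergence of the difference at 1 gives convergence on the unit interval
  around 0, and zeros of a nonzero power series are isolated, while this one vanishes at all small
  positive points.\<close>

lemma power_series_coeffs_eq_if_sums_nonneg: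
  fixes a b :: "nat \<Rightarrow> real"
  assumes a: "\<And>x. 0 \<le> x \<Longrightarrow> (\<lambda>n. a n * x ^ n) sums f x"
    and b: "\<And>x. 0 \<le> x \<Longrightarrow> (\<lambda>n. b n * x ^ n) sums f x"
  shows "a n = b n"
proof -
  define c where "c n = a n - b n" for n
  have c: "(\<lambda>n. c n * x ^ n) sums 0" if "0 \<le> x" for x
    using sums_diff[OF a[OF that] b[OF that]] by (simp add: c_def algebra_simps)
  have c0: "c 0 = 0"
    using c[of 0] powser_sums_zero_iff[of c 0] by simp
  define g where "g x = (\<Sum>n. c n * x ^ n)" for x
  have g: "(\<lambda>n. c n * (x - 0) ^ n) sums g x" if "norm (x - 0) < 1" for x
  proof -
    have "summable (\<lambda>n. c n * 1 ^ n)" using c[of 1] by (auto intro: sums_summable)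
    from powser_inside[OF this, of x] that show ?thesis
      by (simp add: g_def summable_sums)
  qed
  have "c n = 0"
  proof (rule ccontr)
    assume n: "c n \<noteq> 0"
    then have "n > 0" using c0 by (cases n) auto
    moreover have "g 0 = 0" using c[of 0] by (simp add: g_def sums_iff)
    ultimately obtain s where s: "0 < s" "\<And>z. z \<in> cball 0 s - {0} \<Longrightarrow> g z \<noteq> 0"
      using powser_0_nonzero[where a = c and f = g and \<xi> = 0 and r = 1 and m = n, OF _ g] n by auto
    have "g s = 0" using c[of s] s(1) by (simp add: g_def sums_iff)
    moreover have "s \<in> cball 0 s - {0}" using s(1) by simp
    ultimately show False using s(2) by blast
  qed
  then show ?thesis by (simp add: c_def)
qed

text \<open>The integral of \<open>|exp (t * cinner z \<zeta>)|^2\<close> is evaluated twice: by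
  Parseval as the series of \<open>m n / (fact n)^2 * t^(2 n)\<close>, and by completing the square
  as \<open>m 0 * exp (t^2)\<close>. Comparing coefficients gives
  \<open>m n = fact n * m 0\<close>.\<close>

lemma gaussian_moment:
  fixes \<zeta> :: "complex ^ 'n"
  assumes \<zeta>: "norm \<zeta> = 1"
  shows "(\<integral>\<^sup>+z. ennreal (cmod (cinner z \<zeta>) ^ (2 * k)) * ennreal (exp (- (norm z)\<^sup>2)) \<partial>lborel)
    = ennreal (fact k) * (\<integral>\<^sup>+(z::complex^'n). ennreal (exp (- (norm z)\<^sup>2)) \<partial>lborel)"
proof -
  define M where "M k = (\<integral>\<^sup>+z. ennreal (cmod (cinner z \<zeta>) ^ (2 * k)) * ennreal (exp (- (norm z)\<^sup>2)) \<partial>lborel)" for k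
  \<comment> \<open>Finiteness comes from the ball moments; it lets the generating identity be read
    as one between real power series.\<close>
  have M_fin: "M k < \<infinity>" for k
    using ball_moment_finite[OF \<zeta>, of k]
    unfolding M_def gaussian_moment_eq_ball_moment[OF \<zeta>] by (simp add: ennreal_mult_less_top)
  have M0: "M 0 = (\<integral>\<^sup>+(z::complex^'n). ennreal (exp (- (norm z)\<^sup>2)) \<partial>lborel)"
    by (simp add: M_def)
  define m where "m k = enn2real (M k)" for k
  have Mm: "M k = ennreal (m k)" and m_nonneg: "m k \<ge> 0" for k
    using M_fin[of k] by (simp_all add: m_def less_top)
  define \<mu> :: "(complex ^ 'n) measure" where "\<mu> = density lborel (\<lambda>z. ennreal (exp (- (norm z)\<^sup>2)))"
  have int_\<mu>: "(\<integral>\<^sup>+z. u z \<partial>\<mu>) = (\<integral>\<^sup>+z. u z * ennreal (exp (- (norm z)\<^sup>2)) \<partial>lborel)"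
    if [measurable]: "u \<in> borel_measurable borel" for u
    unfolding \<mu>_def by (simp add: nn_integral_density mult.commute)
  have sets_\<mu>: "sets \<mu> = sets borel" by (simp add: \<mu>_def)
  have "emeasure \<mu> (space \<mu>) = M 0"
    unfolding M0 by (simp add: \<mu>_def emeasure_density)
  then have "finite_measure \<mu>"
    using M_fin[of 0] by (intro finite_measureI) auto
  then have sf: "sigma_finite_measure \<mu>"
    by (simp add: finite_measure.axioms(1))
  have inv: "distr \<mu> borel (\<lambda>z. c *s z) = \<mu>" if "cmod c = 1" for c
  proof (rule measure_eqI)
    fix A assume "A \<in> sets (distr \<mu> borel (\<lambda>z. c *s z))"
    then have [measurable]: "A \<in> sets borel" by simp
    have [measurable]: "(\<lambda>z::complex^'n. c *s z) \<in> borel_measurable borel"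
      by (intro borel_measurable_continuous_onI continuous_intros)
    have [measurable]: "(\<lambda>z::complex^'n. c *s z) \<in> measurable \<mu> borel"
      by (simp add: \<mu>_def)
    have "emeasure (distr \<mu> borel (\<lambda>z. c *s z)) A = (\<integral>\<^sup>+z. indicator A z \<partial>distr \<mu> borel (\<lambda>z. c *s z))"
      by simp
    also have "\<dots> = (\<integral>\<^sup>+z. indicator A (c *s z) \<partial>\<mu>)"
      by (rule nn_integral_distr) auto
    also have "\<dots> = (\<integral>\<^sup>+z. (\<lambda>w. indicator A w * ennreal (exp (- (norm w)\<^sup>2))) (c *s z) \<partial>lborel)"
      by (subst int_\<mu>) (auto simp: norm_smult_complex that)
    also have "\<dots> = (\<integral>\<^sup>+w. indicator A w * ennreal (exp (- (norm w)\<^sup>2)) \<partial>lborel)"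
      by (rule nn_integral_lborel_isometry) (auto simp: linear_smult_complex norm_smult_complex that)
    also have "\<dots> = emeasure \<mu> A"
      by (subst int_\<mu>[symmetric]) (auto simp: sets_\<mu>)
    finally show "emeasure (distr \<mu> borel (\<lambda>z. c *s z)) A = emeasure \<mu> A" .
  qed (simp add: sets_\<mu>)
  have gen: "(\<Sum>n. ennreal ((m n / (fact n)\<^sup>2) * x ^ n)) = ennreal (m 0 * exp x)" if x: "x \<ge> 0" for x
  proof -
    define t where "t = sqrt x"
    have t: "t\<^sup>2 = x" "t \<ge> 0" using x by (auto simp: t_def)
    have "ennreal (m 0 * exp x) = (\<integral>\<^sup>+z. ennreal ((cmod (exp (of_real t * cinner z \<zeta>)))\<^sup>2) \<partial>\<mu>)"
      using gaussian_generating_function[OF \<zeta>, of t] m_nonneg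
      by (subst int_\<mu>) (auto simp: t M0[symmetric] Mm ennreal_mult mult.commute)
    also have "\<dots> = (\<Sum>n. ennreal ((cmod (of_real t ^ n / fact n))\<^sup>2) * (\<integral>\<^sup>+z. ennreal (cmod (cinner z \<zeta>) ^ (2 * n)) \<partial>\<mu>))"
    proof (rule nn_integral_square_power_series[OF sets_\<mu> sf inv, where R = \<infinity> and F = "\<lambda>w. exp (of_real t * w)"])
      show "(\<lambda>n. complex_of_real t ^ n / fact n * w ^ n) sums exp (complex_of_real t * w)" for w
        using exp_converges[of "complex_of_real t * w"]
        by (simp add: scaleR_conv_of_real power_mult_distrib divide_inverse mult_ac)
    qed auto
    also have "\<dots> = (\<Sum>n. ennreal ((m n / (fact n)\<^sup>2) * x ^ n))"
    proof (intro suminf_cong)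
      fix n
      have "(\<integral>\<^sup>+z. ennreal (cmod (cinner z \<zeta>) ^ (2 * n)) \<partial>\<mu>) = ennreal (m n)"
        by (subst int_\<mu>) (auto simp: M_def[symmetric] Mm)
      moreover have "(cmod (of_real t ^ n / fact n))\<^sup>2 = x ^ n / (fact n)\<^sup>2"
        using t by (simp add: norm_divide norm_power power_divide) (metis mult.commute power_mult)
      ultimately show "ennreal ((cmod (of_real t ^ n / fact n))\<^sup>2) * (\<integral>\<^sup>+z. ennreal (cmod (cinner z \<zeta>) ^ (2 * n)) \<partial>\<mu>)
          = ennreal ((m n / (fact n)\<^sup>2) * x ^ n)"
        using x m_nonneg[of n] by (simp add: ennreal_mult[symmetric] mult.commute)
    qed
    finally show ?thesis ..
  qed
  have "m k / (fact k)\<^sup>2 = m 0 / fact k"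
  proof (rule power_series_coeffs_eq_if_sums_nonneg[where f = "\<lambda>x. m 0 * exp x"])
    fix x :: real assume x: "0 \<le> x"
    have nn: "0 \<le> (m n / (fact n)\<^sup>2) * x ^ n" for n using m_nonneg x by simp
    have "summable (\<lambda>n. (m n / (fact n)\<^sup>2) * x ^ n)"
      using nn gen[OF x] by (intro summable_suminf_not_top) auto
    moreover have "(\<Sum>n. (m n / (fact n)\<^sup>2) * x ^ n) = m 0 * exp x"
    proof -
      have "ennreal (\<Sum>n. (m n / (fact n)\<^sup>2) * x ^ n) = ennreal (m 0 * exp x)"
        using gen[OF x] suminf_ennreal[OF nn] by simp
      then show ?thesis
        using m_nonneg[of 0] suminf_nonneg[OF \<open>summable _\<close> nn] by (simp add: ennreal_inj)
    qed
    ultimately show "(\<lambda>n. (m n / (fact n)\<^sup>2) * x ^ n) sums (m 0 * exp x)"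
      by (simp add: sums_iff)
    show "(\<lambda>n. (m 0 / fact n) * x ^ n) sums (m 0 * exp x)"
      using sums_mult[OF exp_converges[of x], of "m 0"] by (simp add: divide_inverse mult_ac)
  qed
  then have "m k = fact k * m 0"
    by (simp add: field_simps power2_eq_square)
  then show ?thesis
    unfolding M_def[symmetric] M0[symmetric] Mm using m_nonneg by (simp add: ennreal_mult)
qed

text \<open>The radial factorisation is used at \<open>k\<close> and at 0: the first expresses the
  Gaussian moment through the ball moment, the second expresses the total Gaussian mass through the
  volume of the ball.\<close>

lemma ball_moment:
  fixes \<zeta> :: "complex ^ 'n"
  assumes \<zeta>: "norm \<zeta> = 1"
  shows "(\<integral>\<^sup>+z. ennreal (cmod (cinner z \<zeta>) ^ (2 * k)) * indicator (ball 0 1) z \<partial>lborel)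
     = emeasure lborel (ball (0::complex^'n) 1) * ennreal (fact k * fact CARD('n) / fact (CARD('n) + k))"
    (is "?B k = _")
proof -
  let ?G = "\<integral>\<^sup>+(z::complex^'n). ennreal (exp (- (norm z)\<^sup>2)) \<partial>lborel"
  have G: "?G = emeasure lborel (ball (0::complex^'n) 1) * ennreal (fact CARD('n))"
    using gaussian_moment_eq_ball_moment[OF \<zeta>, of 0] by simp
  have "?B k * ennreal (fact (CARD('n) + k)) = ennreal (fact k) * ?G"
    using gaussian_moment_eq_ball_moment[OF \<zeta>, of k] gaussian_moment[OF \<zeta>, of k] by simp
  also have "\<dots> = emeasure lborel (ball (0::complex^'n) 1) * ennreal (fact k * fact CARD('n))"
    unfolding G by (simp add: ennreal_mult mult_ac)
  finally have "?B k * ennreal (fact (CARD('n) + k)) * ennreal (1 / fact (CARD('n) + k))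
      = emeasure lborel (ball (0::complex^'n) 1) * ennreal (fact k * fact CARD('n)) * ennreal (1 / fact (CARD('n) + k))"
    by simp
  then show ?thesis
    unfolding mult.assoc by (subst (asm) (1 2) ennreal_mult[symmetric]) auto
qed

section \<open>Normalised measures on the ball and the sphere, and their moments\<close>

lemma nn_integral_ball_measure:
  assumes [measurable]: "f \<in> borel_measurable borel"
  shows "(\<integral>\<^sup>+z. f z \<partial>(ball_measure :: (complex^'n) measure)) =
    (\<integral>\<^sup>+z. f z * indicator (ball 0 1) z \<partial>lborel) / emeasure lborel (ball (0::complex^'n) 1)"
  unfolding ball_measure_def by (rule nn_integral_uniform_measure) auto

text \<open>Common source of the weighted-ball and sphere moments. Restriction to the ball is itself
  a radial weight, the indicator of \<open>u < 1\<close>, and the volume of the ball cancels against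
  the normalisation.\<close>

lemma ball_measure_radial_moment:
  fixes \<zeta> :: "complex ^ 'n" and F :: "real \<Rightarrow> ennreal"
  assumes \<zeta>: "norm \<zeta> = 1" and F[measurable]: "F \<in> borel_measurable borel"
  shows "(\<integral>\<^sup>+z. ennreal (cmod (cinner z \<zeta>) ^ (2 * k)) * F ((norm z)\<^sup>2) \<partial>ball_measure)
     = ennreal (fact k * fact CARD('n) / fact (CARD('n) + k)) *
       (\<integral>\<^sup>+u. ennreal (real (CARD('n) + k) * u ^ (CARD('n) + k - 1)) * indicator {0..} u *
           (F u * indicator {..<1} u) \<partial>lborel)"
proof -
  let ?v = "emeasure lborel (ball (0::complex^'n) 1)"
  have v: "?v \<noteq> \<infinity>" "?v \<noteq> 0"
    using emeasure_lborel_ball_finite[of "0::complex^'n" 1] open_not_negligible[of "ball (0::complex^'n) 1"]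
    by (auto simp: negligible_iff_null_sets null_sets_def)
  have cancel: "?v * X / ?v = X" for X
    using v ennreal_mult_divide_eq[of ?v X] by (simp add: mult.commute)
  have "(\<integral>\<^sup>+z. ennreal (cmod (cinner z \<zeta>) ^ (2 * k)) * F ((norm z)\<^sup>2) \<partial>ball_measure)
    = (\<integral>\<^sup>+z. ennreal (cmod (cinner z \<zeta>) ^ (2 * k)) * (F ((norm z)\<^sup>2) * indicator {..<1} ((norm z)\<^sup>2)) \<partial>lborel) / ?v"
    by (subst nn_integral_ball_measure)
       (auto intro!: nn_integral_cong arg_cong2[where f = "(/)"] simp: indicator_def abs_square_less_1 mult.assoc)
  also have "(\<integral>\<^sup>+z. ennreal (cmod (cinner z \<zeta>) ^ (2 * k)) * (F ((norm z)\<^sup>2) * indicator {..<1} ((norm z)\<^sup>2)) \<partial>lborel)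
    = ?v * (ennreal (fact k * fact CARD('n) / fact (CARD('n) + k)) *
       (\<integral>\<^sup>+u. ennreal (real (CARD('n) + k) * u ^ (CARD('n) + k - 1)) * indicator {0..} u *
           (F u * indicator {..<1} u) \<partial>lborel))"
    unfolding mult.assoc[symmetric, of ?v] ball_moment[OF \<zeta>, symmetric]
    by (rule nn_integral_homogeneous_radial[where F = "\<lambda>u. F u * indicator {..<1} u"])
       (auto simp: ball_moment_finite[OF \<zeta>, simplified] cinner_scaleR_left norm_mult power_mult_distrib ennreal_mult)
  finally show ?thesis by (simp only: cancel)
qed


definition bergman_measure :: "real \<Rightarrow> (complex ^ 'n) measure" where
  "bergman_measure \<alpha> =
     density ball_measure (\<lambda>z. ennreal (bergman_const TYPE('n) \<alpha> * (1 - (norm z)\<^sup>2) powr \<alpha>))"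

text \<open>The radius is put into the measure instead of the argument of the function. For
  \<open>0 \<le> \<rho> < 1\<close> the measure lives on the open ball, like the Bergman measure,
  and the Hardy norm is a supremum over \<open>\<rho>\<close>.\<close>

definition hardy_measure :: "real \<Rightarrow> (complex ^ 'n) measure" where
  "hardy_measure \<rho> = distr sphere_measure borel (\<lambda>z. \<rho> *\<^sub>R z)"

lemma sets_ball_measure [simp, measurable_cong]: "sets ball_measure = sets borel"
  by (simp add: ball_measure_def)

lemma sets_sphere_measure [simp, measurable_cong]: "sets sphere_measure = sets borel"
  by (simp add: sphere_measure_def)

lemma sets_bergman_measure [simp, measurable_cong]: "sets (bergman_measure \<alpha>) = sets borel"
  by (simp add: bergman_measure_def)

lemma sets_hardy_measure [simp, measurable_cong]: "sets (hardy_measure \<rho>) = sets borel"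
  by (simp add: hardy_measure_def)

lemma nn_integral_sphere_measure:
  assumes [measurable]: "f \<in> borel_measurable borel"
  shows "(\<integral>\<^sup>+z. f z \<partial>sphere_measure) = (\<integral>\<^sup>+z. f ((1 / norm z) *\<^sub>R z) \<partial>ball_measure)"
  unfolding sphere_measure_def by (rule nn_integral_distr) auto

lemma nn_integral_hardy_measure:
  assumes [measurable]: "f \<in> borel_measurable borel"
  shows "(\<integral>\<^sup>+z. f z \<partial>hardy_measure \<rho>) = (\<integral>\<^sup>+z. f (\<rho> *\<^sub>R z) \<partial>sphere_measure)"
  unfolding hardy_measure_def by (rule nn_integral_distr) auto

lemma nn_integral_bergman_measure:
  fixes f :: "complex ^ 'n \<Rightarrow> ennreal"
  assumes [measurable]: "f \<in> borel_measurable borel"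
  shows "(\<integral>\<^sup>+z. f z \<partial>bergman_measure \<alpha>)
    = (\<integral>\<^sup>+z. f z * ennreal (bergman_const TYPE('n) \<alpha> * (1 - (norm z)\<^sup>2) powr \<alpha>) \<partial>ball_measure)"
  unfolding bergman_measure_def by (subst nn_integral_density) (auto simp: mult.commute)

lemma bergman_const_pos: "\<alpha> > -1 \<Longrightarrow> bergman_const TYPE('n::finite) \<alpha> > 0"
  unfolding bergman_const_def by (intro divide_pos_pos mult_pos_pos Gamma_real_pos) auto

lemma nn_integral_Beta:
  assumes "K > 0" "\<alpha> > -1"
  shows "(\<integral>\<^sup>+u. ennreal (real K * u ^ (K - 1)) * indicator {0..} u *
     (ennreal ((1 - u) powr \<alpha>) * indicator {..<1} u) \<partial>lborel) = ennreal (real K * Beta (real K) (\<alpha> + 1))"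
proof -
  define f where "f t = (if t \<in> {0..1} then real K * (t powr (real K - 1) * (1 - t) powr (\<alpha> + 1 - 1)) else 0)" for t
  have "(f has_integral real K * Beta (real K) (\<alpha> + 1)) UNIV"
    unfolding f_def has_integral_restrict_UNIV
    using assms by (intro has_integral_mult_right has_integral_Beta_real) auto
  moreover have "f \<in> borel_measurable borel"
    unfolding f_def by measurable
  moreover have "\<And>t. 0 \<le> f t"
    by (simp add: f_def)
  ultimately have "(\<integral>\<^sup>+t. ennreal (f t) \<partial>lborel) = ennreal (real K * Beta (real K) (\<alpha> + 1))"
    by (intro nn_integral_has_integral_lborel)
  moreover have "(\<integral>\<^sup>+u. ennreal (real K * u ^ (K - 1)) * indicator {0..} u *
     (ennreal ((1 - u) powr \<alpha>) * indicator {..<1} u) \<partial>lborel) = (\<integral>\<^sup>+t. ennreal (f t) \<partial>lborel)"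
  \<comment> \<open>The point 0 is discarded because \<open>0 powr 0 = 0\<close> whereas
    \<open>0 ^ 0 = 1\<close>, so the two integrands disagree there when
    \<open>K = 1\<close>.\<close>
  proof (intro nn_integral_cong_AE, use AE_lborel_singleton[of 0] in eventually_elim)
    fix u :: real assume "u \<noteq> 0"
    show "ennreal (real K * u ^ (K - 1)) * indicator {0..} u * (ennreal ((1 - u) powr \<alpha>) * indicator {..<1} u) = ennreal (f u)"
    proof (cases "0 < u \<and> u < 1")
      case True
      have "u powr (real K - 1) = u ^ (K - 1)"
        using True assms(1) by (metis Suc_leI One_nat_def of_nat_1 of_nat_diff powr_realpow)
      then show ?thesis using True by (simp add: f_def ennreal_mult[symmetric])
    next
      case False
      then show ?thesis using \<open>u \<noteq> 0\<close> by (auto simp: f_def indicator_def)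
    qed
  qed
  ultimately show ?thesis by simp
qed

text \<open>The radial integral is a Beta integral; \<open>bergman_const\<close> cancels its Gamma
  factors up to a quotient of two Gamma values, which is the Pochhammer symbol. The case
  \<open>k = 0\<close> says that the measure has mass 1.\<close>

lemma bergman_moment:
  fixes \<zeta> :: "complex ^ 'n"
  assumes \<zeta>: "norm \<zeta> = 1" and \<alpha>: "\<alpha> > -1"
  shows "(\<integral>\<^sup>+z. ennreal (cmod (cinner z \<zeta>) ^ (2 * k)) \<partial>bergman_measure \<alpha>)
     = ennreal (fact k / pochhammer (real CARD('n) + \<alpha> + 1) k)"
proof -
  define N where "N = CARD('n)"
  have N: "N > 0" by (simp add: N_def)
  define C where "C = bergman_const TYPE('n) \<alpha>"
  have C: "C > 0" using bergman_const_pos[OF \<alpha>] by (simp add: C_def)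
  have "(\<integral>\<^sup>+z. ennreal (cmod (cinner z \<zeta>) ^ (2 * k)) \<partial>bergman_measure \<alpha>)
    = (\<integral>\<^sup>+z. ennreal C * (ennreal (cmod (cinner z \<zeta>) ^ (2 * k)) * ennreal ((1 - (norm z)\<^sup>2) powr \<alpha>)) \<partial>ball_measure)"
    by (subst nn_integral_bergman_measure)
       (use C in \<open>auto simp: C_def[symmetric] ennreal_mult[symmetric] mult_ac\<close>)
  also have "\<dots> = ennreal C * (\<integral>\<^sup>+z. ennreal (cmod (cinner z \<zeta>) ^ (2 * k)) * ennreal ((1 - (norm z)\<^sup>2) powr \<alpha>) \<partial>ball_measure)"
    by (rule nn_integral_cmult) auto
  also have "(\<integral>\<^sup>+z. ennreal (cmod (cinner z \<zeta>) ^ (2 * k)) * ennreal ((1 - (norm z)\<^sup>2) powr \<alpha>) \<partial>ball_measure)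
    = ennreal (fact k * fact N / fact (N + k)) * ennreal (real (N + k) * Beta (real (N + k)) (\<alpha> + 1))"
    unfolding N_def
    by (subst ball_measure_radial_moment[OF \<zeta>, where F = "\<lambda>u. ennreal ((1 - u) powr \<alpha>)"])
       (simp, subst nn_integral_Beta, use \<alpha> in auto)
  also have "ennreal C * (ennreal (fact k * fact N / fact (N + k)) * ennreal (real (N + k) * Beta (real (N + k)) (\<alpha> + 1)))
    = ennreal (C * (fact k * fact N / fact (N + k) * (real (N + k) * Beta (real (N + k)) (\<alpha> + 1))))"
    using C \<alpha> N by (simp add: ennreal_mult[symmetric] Beta_def Gamma_real_pos less_imp_le del: of_nat_add)
  also have "C * (fact k * fact N / fact (N + k) * (real (N + k) * Beta (real (N + k)) (\<alpha> + 1)))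
    = fact k / pochhammer (real N + \<alpha> + 1) k"
  proof -
    define g1 where "g1 = Gamma (real N + \<alpha> + 1)"
    define g2 where "g2 = Gamma (\<alpha> + 1)"
    define g3 where "g3 = Gamma (real N + real k + \<alpha> + 1)"
    have pos: "g1 > 0" "g2 > 0" "g3 > 0"
      unfolding g1_def g2_def g3_def using \<alpha> by (auto intro!: Gamma_real_pos)
    have "real N + \<alpha> + 1 > 0" using \<alpha> N by simp
    then have "real N + \<alpha> + 1 \<notin> \<int>\<^sub>\<le>\<^sub>0"
      by (auto elim!: nonpos_Ints_cases)
    then have poch: "pochhammer (real N + \<alpha> + 1) k = g3 / g1"
      by (simp add: pochhammer_Gamma g1_def g3_def add_ac)
    have GN: "Gamma (real N + 1) = fact N"
      using Gamma_fact[of N, where 'a = real] by (simp add: add.commute)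
    have GK: "real (N + k) * Gamma (real (N + k)) = fact (N + k)"
    proof -
      have "Gamma (real (N + k)) = fact (N + k - 1)"
        using Gamma_fact[of "N + k - 1", where 'a = real] N by (simp add: of_nat_diff)
      then show ?thesis using N by (simp add: fact_reduce del: of_nat_add)
    qed
    have "C = g1 / (fact N * g2)"
      by (simp add: C_def bergman_const_def g1_def g2_def GN N_def[symmetric])
    moreover have "real (N + k) * Beta (real (N + k)) (\<alpha> + 1) = fact (N + k) * g2 / g3"
      using GK by (simp add: Beta_def g2_def g3_def add_ac)
    ultimately have "C * (fact k * fact N / fact (N + k) * (real (N + k) * Beta (real (N + k)) (\<alpha> + 1)))
      = g1 / (fact N * g2) * (fact k * fact N / fact (N + k) * (fact (N + k) * g2 / g3))" by simp
    also have "\<dots> = fact k / (g3 / g1)" using pos by simp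
    finally show ?thesis unfolding poch .
  qed
  finally show ?thesis by (simp add: N_def)
qed

text \<open>Radial projection contributes the factor \<open>(1 / u) ^ k\<close>, which lowers the
  radial density from degree \<open>N + k - 1\<close> to \<open>N - 1\<close> and leaves the
  integral \<open>(N + k) / N\<close>. The result is the Bergman formula with -1 in place of
  \<open>\<alpha>\<close>.\<close>

lemma sphere_moment:
  fixes \<zeta> :: "complex ^ 'n"
  assumes \<zeta>: "norm \<zeta> = 1"
  shows "(\<integral>\<^sup>+z. ennreal (cmod (cinner z \<zeta>) ^ (2 * k)) \<partial>sphere_measure)
     = ennreal (fact k / pochhammer (real CARD('n)) k)"
proof -
  define N where "N = CARD('n)"
  have N: "N > 0" by (simp add: N_def)
  have "(\<integral>\<^sup>+z. ennreal (cmod (cinner z \<zeta>) ^ (2 * k)) \<partial>sphere_measure)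
    = (\<integral>\<^sup>+z. ennreal (cmod (cinner z \<zeta>) ^ (2 * k)) * ennreal ((1 / (norm z)\<^sup>2) ^ k) \<partial>ball_measure)"
    by (subst nn_integral_sphere_measure)
       (auto intro!: nn_integral_cong
         simp: cinner_scaleR_left norm_divide power_divide ennreal_mult[symmetric] simp flip: power_mult)
  also have "\<dots> = ennreal (fact k * fact N / fact (N + k)) *
       (\<integral>\<^sup>+u. ennreal (real (N + k) * u ^ (N + k - 1)) * indicator {0..} u *
           (ennreal ((1 / u) ^ k) * indicator {..<1} u) \<partial>lborel)"
    unfolding N_def by (rule ball_measure_radial_moment[OF \<zeta>, where F = "\<lambda>u. ennreal ((1 / u) ^ k)"]) auto
  also have "(\<integral>\<^sup>+u. ennreal (real (N + k) * u ^ (N + k - 1)) * indicator {0..} u *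
           (ennreal ((1 / u) ^ k) * indicator {..<1} u) \<partial>lborel)
     = (\<integral>\<^sup>+u. ennreal (real (N + k) / real N) * (ennreal (real N * u ^ (N - 1)) * indicator {0..} u * indicator {..<1} u) \<partial>lborel)"
  \<comment> \<open>At \<open>u = 0\<close> the convention \<open>1 / 0 = 0\<close> would break the
    cancellation of \<open>u ^ k\<close> against \<open>(1 / u) ^ k\<close>.\<close>
  proof (intro nn_integral_cong_AE, use AE_lborel_singleton[of 0] in eventually_elim)
    fix u :: real assume "u \<noteq> 0"
    have "u ^ (N + k - 1) = u ^ (N - 1) * u ^ k"
      using N by (simp flip: power_add)
    then show "ennreal (real (N + k) * u ^ (N + k - 1)) * indicator {0..} u * (ennreal ((1 / u) ^ k) * indicator {..<1} u)
      = ennreal (real (N + k) / real N) * (ennreal (real N * u ^ (N - 1)) * indicator {0..} u * indicator {..<1} u)"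
      using \<open>u \<noteq> 0\<close> N
      by (auto simp: indicator_def ennreal_mult[symmetric] power_divide simp del: of_nat_add intro!: arg_cong[where f = ennreal])
  qed
  also have "\<dots> = ennreal (real (N + k) / real N)"
    by (subst nn_integral_cmult) (auto simp: nn_integral_power_lessThan[OF N, of 1, simplified])
  also have "ennreal (fact k * fact N / fact (N + k)) * ennreal (real (N + k) / real N)
    = ennreal (fact k / pochhammer (real N) k)"
  proof -
    have *: "fact (N + k) = real (N + k) * fact (N + k - 1)" "fact N = real N * fact (N - 1)"
      using N by (simp_all add: fact_reduce del: of_nat_add)
    have "pochhammer (real N) k * fact (N - 1) = fact (N + k - 1)"
      using N
    proof (induction k)
      case (Suc k)
      have "pochhammer (real N) (Suc k) * fact (N - 1) = (real N + real k) * (pochhammer (real N) k * fact (N - 1))"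
        by (simp add: pochhammer_Suc)
      also have "\<dots> = real (N + k) * fact (N + k - 1)" using Suc by simp
      also have "\<dots> = fact (N + Suc k - 1)" using N by (simp add: fact_reduce[of "N + k"])
      finally show ?case .
    qed simp
    then have "pochhammer (real N) k = fact (N + k - 1) / fact (N - 1)"
      by (simp add: field_simps)
    then show ?thesis using N
      by (simp add: ennreal_mult[symmetric] * del: of_nat_add)
  qed
  finally show ?thesis by (simp add: N_def)
qed

lemma hardy_moment:
  fixes \<zeta> :: "complex ^ 'n"
  assumes "norm \<zeta> = 1" "\<rho> \<ge> 0"
  shows "(\<integral>\<^sup>+z. ennreal (cmod (cinner z \<zeta>) ^ (2 * k)) \<partial>hardy_measure \<rho>)
     = ennreal (\<rho> ^ (2 * k) * (fact k / pochhammer (real CARD('n)) k))"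
proof -
  have "(\<integral>\<^sup>+z. ennreal (cmod (cinner z \<zeta>) ^ (2 * k)) \<partial>hardy_measure \<rho>)
    = (\<integral>\<^sup>+z. ennreal (\<rho> ^ (2 * k)) * ennreal (cmod (cinner z \<zeta>) ^ (2 * k)) \<partial>sphere_measure)"
    by (subst nn_integral_hardy_measure)
       (use assms in \<open>auto simp: cinner_scaleR_left norm_mult power_mult_distrib ennreal_mult\<close>)
  also have "\<dots> = ennreal (\<rho> ^ (2 * k)) * ennreal (fact k / pochhammer (real CARD('n)) k)"
    by (subst nn_integral_cmult) (auto simp: sphere_moment[OF assms(1)])
  finally show ?thesis
    using assms by (subst ennreal_mult) (auto simp: pochhammer_nonneg)
qed

section \<open>Rotation-invariant measures on the ball\<close>

text \<open>\<open>linear\<close> is real linearity, so the group is larger than the unitary group;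
  invariance under it is inherited directly from Lebesgue measure.\<close>

definition isometry_invariant :: "(complex ^ 'n) measure \<Rightarrow> bool" where
  "isometry_invariant \<mu> \<longleftrightarrow> (\<forall>T. linear T \<longrightarrow> (\<forall>z. norm (T z) = norm z) \<longrightarrow> distr \<mu> borel T = \<mu>)"

lemma isometry_invariantI:
  fixes \<mu> :: "(complex ^ 'n) measure"
  assumes sets[measurable_cong]: "sets \<mu> = sets borel"
    and inv: "\<And>T u. linear T \<Longrightarrow> (\<And>z. norm (T z) = norm z) \<Longrightarrow> u \<in> borel_measurable borel
      \<Longrightarrow> T \<in> borel_measurable borel \<Longrightarrow> (\<integral>\<^sup>+z. u (T z) \<partial>\<mu>) = (\<integral>\<^sup>+z. u z \<partial>\<mu>)"
  shows "isometry_invariant \<mu>"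
  unfolding isometry_invariant_def
proof (intro allI impI)
  fix T :: "complex ^ 'n \<Rightarrow> complex ^ 'n"
  assume T: "linear T" "\<forall>z. norm (T z) = norm z"
  have [measurable]: "T \<in> borel_measurable borel"
    using T by (intro borel_measurable_continuous_onI linear_continuous_on) (simp add: linear_linear)
  show "distr \<mu> borel T = \<mu>"
  proof (rule measure_eqI)
    fix A assume "A \<in> sets (distr \<mu> borel T)"
    then have A[measurable]: "A \<in> sets borel" by simp
    have "emeasure (distr \<mu> borel T) A = (\<integral>\<^sup>+z. indicator A z \<partial>distr \<mu> borel T)" by simp
    also have "\<dots> = (\<integral>\<^sup>+z. indicator A (T z) \<partial>\<mu>)" by (rule nn_integral_distr) auto
    also have "\<dots> = (\<integral>\<^sup>+z. indicator A z \<partial>\<mu>)" using T by (intro inv) auto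
    also have "\<dots> = emeasure \<mu> A" by (simp add: sets)
    finally show "emeasure (distr \<mu> borel T) A = emeasure \<mu> A" .
  qed (simp add: sets)
qed

lemma nn_integral_ball_measure_isometry:
  fixes T :: "complex ^ 'n \<Rightarrow> complex ^ 'n"
  assumes "linear T" "\<And>z. norm (T z) = norm z"
    and [measurable]: "u \<in> borel_measurable borel" "T \<in> borel_measurable borel"
  shows "(\<integral>\<^sup>+z. u (T z) \<partial>ball_measure) = (\<integral>\<^sup>+z. u z \<partial>ball_measure)"
proof -
  have "(\<integral>\<^sup>+z. u (T z) * indicator (ball 0 1) z \<partial>lborel)
     = (\<integral>\<^sup>+z. (\<lambda>w. u w * indicator (ball 0 1) w) (T z) \<partial>lborel)"
    by (intro nn_integral_cong) (simp add: indicator_def assms)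
  also have "\<dots> = (\<integral>\<^sup>+z. u z * indicator (ball 0 1) z \<partial>lborel)"
    by (rule nn_integral_lborel_isometry) (use assms in auto)
  finally show ?thesis by (simp add: nn_integral_ball_measure)
qed

lemma isometry_invariant_bergman: "isometry_invariant (bergman_measure \<alpha> :: (complex ^ 'n) measure)"
proof (rule isometry_invariantI)
  fix T :: "complex ^ 'n \<Rightarrow> complex ^ 'n" and u :: "complex ^ 'n \<Rightarrow> ennreal"
  assume T: "linear T" "\<And>z. norm (T z) = norm z" 
    and [measurable]: "u \<in> borel_measurable borel" "T \<in> borel_measurable borel"
  define w where "w z = u z * ennreal (bergman_const TYPE('n) \<alpha> * (1 - (norm z)\<^sup>2) powr \<alpha>)" for z
  have [measurable]: "w \<in> borel_measurable borel" unfolding w_def by measurable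
  have "(\<integral>\<^sup>+z. u (T z) \<partial>bergman_measure \<alpha>) = (\<integral>\<^sup>+z. w (T z) \<partial>ball_measure)"
    by (subst nn_integral_bergman_measure) (auto simp: w_def T)
  also have "\<dots> = (\<integral>\<^sup>+z. w z \<partial>ball_measure)"
    by (rule nn_integral_ball_measure_isometry) (auto simp: T)
  also have "\<dots> = (\<integral>\<^sup>+z. u z \<partial>bergman_measure \<alpha>)"
    by (subst nn_integral_bergman_measure) (auto simp: w_def[abs_def])
  finally show "(\<integral>\<^sup>+z. u (T z) \<partial>bergman_measure \<alpha>) = (\<integral>\<^sup>+z. u z \<partial>bergman_measure \<alpha>)" .
qed simp

lemma isometry_invariant_hardy: "isometry_invariant (hardy_measure \<rho> :: (complex ^ 'n) measure)"
proof (rule isometry_invariantI)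
  fix T :: "complex ^ 'n \<Rightarrow> complex ^ 'n" and u :: "complex ^ 'n \<Rightarrow> ennreal"
  assume T: "linear T" "\<And>z. norm (T z) = norm z"
    and [measurable]: "u \<in> borel_measurable borel" "T \<in> borel_measurable borel"
  define w where "w z = u (\<rho> *\<^sub>R (1 / norm z) *\<^sub>R z)" for z
  have [measurable]: "w \<in> borel_measurable borel" unfolding w_def by measurable
  have "(\<integral>\<^sup>+z. u (T z) \<partial>hardy_measure \<rho>) = (\<integral>\<^sup>+z. w (T z) \<partial>ball_measure)"
    by (simp add: nn_integral_hardy_measure nn_integral_sphere_measure w_def T linear_scale)
  also have "\<dots> = (\<integral>\<^sup>+z. w z \<partial>ball_measure)"
    by (rule nn_integral_ball_measure_isometry) (auto simp: T)
  also have "\<dots> = (\<integral>\<^sup>+z. u z \<partial>hardy_measure \<rho>)"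
    by (simp add: nn_integral_hardy_measure nn_integral_sphere_measure w_def)
  finally show "(\<integral>\<^sup>+z. u (T z) \<partial>hardy_measure \<rho>) = (\<integral>\<^sup>+z. u z \<partial>hardy_measure \<rho>)" .
qed simp


section \<open>Holomorphic functions on the ball\<close>

lemma holo_ball_continuous_on: "holo_ball f \<Longrightarrow> continuous_on (ball 0 1) f"
  unfolding holo_ball_def
  by (metis continuous_at_imp_continuous_on has_derivative_continuous)

text \<open>\<open>holo_ball\<close> leaves the values outside the ball arbitrary, so integrals of
  such functions are taken through this cut-off.\<close>

lemma holo_ball_measurable:
  assumes "holo_ball f"
  shows "(\<lambda>z. if z \<in> ball 0 1 then f z else 0) \<in> borel_measurable borel"
proof -
  have "(\<lambda>z. indicator (ball 0 1) z *\<^sub>R f z) \<in> borel_measurable borel"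
    using holo_ball_continuous_on[OF assms] by (intro borel_measurable_continuous_on_indicator) auto
  moreover have "(\<lambda>z. indicator (ball 0 1) z *\<^sub>R f z) = (\<lambda>z. if z \<in> ball 0 1 then f z else 0)"
    by (auto simp: indicator_def)
  ultimately show ?thesis by simp
qed

lemma bounded_linear_smult_left: "bounded_linear (\<lambda>c::complex. c *s (v :: complex ^ 'n))"
proof (rule bounded_linear_intro[where K = "norm v"])
  show "(r *\<^sub>R x) *s v = r *\<^sub>R (x *s v)" for r x
    by (simp add: vec_eq_iff)
qed (auto simp: norm_smult_complex vec_eq_iff algebra_simps)

lemma has_derivative_affine_line:
  "((\<lambda>c::complex. p + c *s (v :: complex ^ 'n)) has_derivative (\<lambda>c. c *s v)) (at c)"
  using has_derivative_add[OF has_derivative_const[of p] bounded_linear_imp_has_derivative[OF bounded_linear_smult_left]]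
  by simp

text \<open>Complex homogeneity of the derivative \<open>L\<close> turns its restriction to the line
  into multiplication by the number \<open>L v\<close>, which is a complex derivative.\<close>

lemma holo_ball_line_holomorphic:
  fixes f :: "complex ^ 'n \<Rightarrow> complex"
  assumes "holo_ball f" and "\<And>c. c \<in> S \<Longrightarrow> norm (p + c *s v) < 1"
  shows "(\<lambda>c. f (p + c *s v)) holomorphic_on S"
proof (rule holomorphic_onI)
  fix c assume "c \<in> S"
  then obtain L where L: "(f has_derivative L) (at (p + c *s v))" "\<And>c v. L (c *s v) = c * L v"
    using assms unfolding holo_ball_def by (metis mem_ball_0)
  have "((\<lambda>c. f (p + c *s v)) has_derivative (\<lambda>d. L (d *s v))) (at c)"
    using diff_chain_at[OF has_derivative_affine_line L(1)] by (simp add: o_def)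
  then have "((\<lambda>c. f (p + c *s v)) has_field_derivative L v) (at c)"
    by (simp add: has_field_derivative_def L(2) mult.commute[of _ "L v"])
  then show "(\<lambda>c. f (p + c *s v)) field_differentiable (at c within S)"
    by (metis field_differentiable_at_within field_differentiable_def)
qed

definition slice_coeff :: "(complex ^ 'n \<Rightarrow> complex) \<Rightarrow> complex ^ 'n \<Rightarrow> nat \<Rightarrow> complex" where
  "slice_coeff f \<zeta> n = (deriv ^^ n) (\<lambda>c. f (c *s \<zeta>)) 0 / fact n"

lemma slice_coeff_sums:
  assumes "holo_ball f" "norm \<zeta> = 1" "cmod w < 1"
  shows "(\<lambda>n. slice_coeff f \<zeta> n * w ^ n) sums f (w *s \<zeta>)"
proof -
  have "(\<lambda>c. f (0 + c *s \<zeta>)) holomorphic_on ball 0 1"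
    by (rule holo_ball_line_holomorphic[OF assms(1)]) (simp add: norm_smult_complex assms(2))
  then show ?thesis
    using holomorphic_power_series[of "\<lambda>c. f (c *s \<zeta>)" 0 1 w] assms(3) by (simp add: slice_coeff_def)
qed

text \<open>Averaging \<open>\<bar>f\<bar>\<^sup>2\<close> over the rotations fixing \<open>\<zeta>\<close> dominates \<open>\<bar>f\<bar>\<^sup>2\<close> at the projection onto the
  complex line through \<open>\<zeta>\<close>, so restriction to that line does not increase the norm.\<close>

lemma slice_square_le:
  fixes \<mu> :: "(complex ^ 'n) measure"
  assumes sets[measurable_cong]: "sets \<mu> = sets borel" and sf: "sigma_finite_measure \<mu>"
    and inv: "isometry_invariant \<mu>" and AE: "AE z in \<mu>. norm z < 1"
    and f: "holo_ball f" and \<zeta>: "norm \<zeta> = 1"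
  shows "(\<integral>\<^sup>+z. ennreal ((cmod (f (cinner z \<zeta> *s \<zeta>)))\<^sup>2) \<partial>\<mu>) \<le> (\<integral>\<^sup>+z. ennreal ((cmod (f z))\<^sup>2) \<partial>\<mu>)"
proof -
  define g where "g z = (if z \<in> ball 0 1 then f z else 0)" for z
  have [measurable]: "g \<in> borel_measurable borel"
    using holo_ball_measurable[OF f] by (simp add: g_def[abs_def])
  define u where "u z = ennreal ((cmod (g z))\<^sup>2)" for z
  have [measurable]: "u \<in> borel_measurable borel" unfolding u_def by measurable
  \<comment> \<open>\<open>V t\<close> fixes the component along \<open>\<zeta>\<close> and rotates
    the orthogonal component; its average over \<open>t\<close> is a circle average around the
    projection of \<open>z\<close> onto the line through \<open>\<zeta>\<close>.\<close>
  define V where "V t z = cinner z \<zeta> *s \<zeta> + cis (2 * pi * t) *s (z - cinner z \<zeta> *s \<zeta>)" for t z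
  have nV: "norm (V t z) = norm z" for t z
  proof -
    have "(norm (V t z))\<^sup>2 = (norm z)\<^sup>2"
      using cinner_pythagoras[OF \<zeta>, of "cinner z \<zeta>" "cis (2 * pi * t)" z]
        cinner_pythagoras[OF \<zeta>, of "cinner z \<zeta>" 1 z] by (simp add: V_def)
    then show ?thesis by simp
  qed
  have lin: "linear (V t)" for t
    by (rule linearI)
       (simp_all add: V_def vec_eq_iff cinner_add_left cinner_scaleR_left scaleR_conv_of_real[where 'a = complex] algebra_simps)
  have "(\<integral>\<^sup>+z. ennreal ((cmod (f z))\<^sup>2) \<partial>\<mu>) = (\<integral>\<^sup>+z. u z \<partial>\<mu>)"
    by (intro nn_integral_cong_AE, use AE in eventually_elim) (simp add: u_def g_def)
  also have "\<dots> = (\<integral>\<^sup>+z. (\<integral>\<^sup>+t\<in>{0..1}. u (V t z) \<partial>lborel) \<partial>\<mu>)"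
  proof (rule nn_integral_circle_average[OF sets sf])
    show "continuous_on UNIV (\<lambda>p. V (fst p) (snd p))"
      unfolding V_def by (intro continuous_intros)
    show "distr \<mu> borel (V t) = \<mu>" for t
      using inv lin nV unfolding isometry_invariant_def by blast
  qed auto
  finally have eq: "(\<integral>\<^sup>+z. ennreal ((cmod (f z))\<^sup>2) \<partial>\<mu>) = (\<integral>\<^sup>+z. (\<integral>\<^sup>+t\<in>{0..1}. u (V t z) \<partial>lborel) \<partial>\<mu>)" .
  show ?thesis
    unfolding eq
  proof (intro nn_integral_mono_AE, use AE in eventually_elim)
    fix z :: "complex ^ 'n"
    assume z: "norm z < 1"
    define a where "a = cinner z \<zeta>"
    define v where "v = z - cinner z \<zeta> *s \<zeta>"
    define k where "k c = f (a *s \<zeta> + c *s v)" for c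
    \<comment> \<open>Parseval needs holomorphy beyond the unit circle. Here \<open>R^2\<close>
      exceeds 1 by half the gap \<open>1 - |z|^2\<close>, so that \<open>|a|^2 + R^2 |v|^2\<close>
      is at most \<open>(1 + |z|^2) / 2 < 1\<close> and the disc of radius \<open>R\<close> stays in
      the ball.\<close>
    define R where "R = sqrt (1 + (1 - (norm z)\<^sup>2) / 2)"
    have z2: "(norm z)\<^sup>2 < 1" using z by (simp add: abs_square_less_1)
    have R: "R > 1" unfolding R_def using z2 by simp
    have R2: "R\<^sup>2 = 1 + (1 - (norm z)\<^sup>2) / 2" unfolding R_def using z2 by simp
    have av: "(cmod a)\<^sup>2 + (norm v)\<^sup>2 = (norm z)\<^sup>2"
      using cinner_pythagoras[OF \<zeta>, of "cinner z \<zeta>" 1 z] by (simp add: a_def v_def)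
    have "k holomorphic_on ball 0 R"
      unfolding k_def
    proof (rule holo_ball_line_holomorphic[OF f])
      fix c :: complex assume "c \<in> ball 0 R"
      then have "(cmod c)\<^sup>2 \<le> R\<^sup>2" by (intro power_mono) auto
      then have "(cmod c)\<^sup>2 * (norm v)\<^sup>2 \<le> R\<^sup>2 * (norm v)\<^sup>2" by (intro mult_right_mono) auto
      also have "\<dots> = (norm v)\<^sup>2 + (1 - (norm z)\<^sup>2) / 2 * (norm v)\<^sup>2"
        unfolding R2 by (simp add: algebra_simps)
      also have "(1 - (norm z)\<^sup>2) / 2 * (norm v)\<^sup>2 \<le> (1 - (norm z)\<^sup>2) / 2 * 1"
        using z2 av zero_le_power2[of "cmod a"] by (intro mult_left_mono) (linarith, simp)
      finally have "(cmod a)\<^sup>2 + (cmod c)\<^sup>2 * (norm v)\<^sup>2 < 1"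
        using av z2 by (simp add: field_simps)
      then have "(norm (a *s \<zeta> + c *s v))\<^sup>2 < 1"
        unfolding v_def using cinner_pythagoras[OF \<zeta>, of a c z] by simp
      then show "norm (a *s \<zeta> + c *s v) < 1" by (simp add: abs_square_less_1)
    qed
    from submean_square_holomorphic[OF this R]
    have "ennreal ((cmod (k 0))\<^sup>2) \<le> (\<integral>\<^sup>+t\<in>{0..1}. ennreal ((cmod (k (cis (2 * pi * t))))\<^sup>2) \<partial>lborel)" .
    moreover have "u (V t z) = ennreal ((cmod (k (cis (2 * pi * t))))\<^sup>2)" for t
      using nV[of t z] z by (simp add: u_def g_def k_def V_def a_def v_def)
    ultimately show "ennreal ((cmod (f (cinner z \<zeta> *s \<zeta>)))\<^sup>2) \<le> (\<integral>\<^sup>+t\<in>{0..1}. u (V t z) \<partial>lborel)"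
      by (simp add: k_def a_def)
  qed
qed

lemma isometry_invariant_rotation:
  assumes "isometry_invariant (\<mu> :: (complex ^ 'n) measure)" "cmod c = 1"
  shows "distr \<mu> borel (\<lambda>z. c *s z) = \<mu>"
proof -
  have "linear (\<lambda>z::complex^'n. c *s z)" by (rule linear_smult_complex)
  moreover have "norm (c *s z) = norm z" for z :: "complex ^ 'n"
    by (simp add: norm_smult_complex assms(2))
  ultimately show ?thesis using assms(1) unfolding isometry_invariant_def by blast
qed

lemma AE_cinner_less_1:
  assumes "AE z in \<mu>. norm z < 1" "norm \<zeta> = 1"
  shows "AE z in \<mu>. ereal (cmod (cinner z \<zeta>)) < 1"
  using assms(1)
proof eventually_elim
  fix z :: "complex ^ 'a" assume "norm z < 1"
  then have "cmod (cinner z \<zeta>) < 1" using norm_cinner_le[OF assms(2), of z] by linarith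
  then show "ereal (cmod (cinner z \<zeta>)) < 1" by (simp add: one_ereal_def)
qed

text \<open>Parseval evaluates the norm of the restriction to the line through
  \<open>\<zeta>\<close>, and \<open>slice_square_le\<close> bounds that by the norm of
  \<open>f\<close>.\<close>

lemma slice_coeff_moments_le:
  fixes \<mu> :: "(complex ^ 'n) measure"
  assumes sets: "sets \<mu> = sets borel" and sf: "sigma_finite_measure \<mu>"
    and inv: "isometry_invariant \<mu>" and AE: "AE z in \<mu>. norm z < 1"
    and f: "holo_ball f" and \<zeta>: "norm \<zeta> = 1"
  shows "(\<Sum>n. ennreal ((cmod (slice_coeff f \<zeta> n))\<^sup>2) * (\<integral>\<^sup>+z. ennreal (cmod (cinner z \<zeta>) ^ (2 * n)) \<partial>\<mu>))
      \<le> (\<integral>\<^sup>+z. ennreal ((cmod (f z))\<^sup>2) \<partial>\<mu>)"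
proof -
  have "(\<integral>\<^sup>+z. ennreal ((cmod ((\<lambda>w. f (w *s \<zeta>)) (cinner z \<zeta>)))\<^sup>2) \<partial>\<mu>)
    = (\<Sum>n. ennreal ((cmod (slice_coeff f \<zeta> n))\<^sup>2) * (\<integral>\<^sup>+z. ennreal (cmod (cinner z \<zeta>) ^ (2 * n)) \<partial>\<mu>))"
    by (rule nn_integral_square_power_series[OF sets sf isometry_invariant_rotation[OF inv] _ AE_cinner_less_1[OF AE \<zeta>]])
       (auto intro!: slice_coeff_sums[OF f \<zeta>] simp: one_ereal_def)
  then show ?thesis using slice_square_le[OF assms] by simp
qed

section \<open>Binomial series and the resulting pointwise bound\<close>

lemma sums_pochhammer_powr:
  fixes s :: real and w :: complex
  assumes "cmod w < 1"
  shows "(\<lambda>n. of_real (pochhammer s n / fact n) * w ^ n) sums (1 - w) powr (- of_real s)"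
proof -
  have "(\<lambda>n. ((- of_real s) gchoose n) * (- w) ^ n) sums (1 + - w) powr (- of_real s)"
    by (rule gen_binomial_complex) (use assms in simp)
  moreover have "((- of_real s) gchoose n) * (- w) ^ n = of_real (pochhammer s n / fact n) * w ^ n" for n
  proof -
    have "(- 1) ^ n * (- 1) ^ n = (1 :: complex)" by (simp flip: power_mult_distrib)
    then show ?thesis
      by (simp add: gbinomial_pochhammer power_minus[of w] pochhammer_of_real)
  qed
  ultimately show ?thesis by simp
qed

lemma sums_pochhammer_powr_real:
  fixes s x :: real
  assumes "\<bar>x\<bar> < 1"
  shows "(\<lambda>n. pochhammer s n / fact n * x ^ n) sums (1 - x) powr (- s)"
proof -
  have "(\<lambda>n. ((- s) gchoose n) * (- x) ^ n) sums (1 + - x) powr (- s)"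
    by (rule gen_binomial_real) (use assms in simp)
  moreover have "((- s) gchoose n) * (- x) ^ n = pochhammer s n / fact n * x ^ n" for n
  proof -
    have "(- 1) ^ n * (- 1) ^ n = (1 :: real)" by (simp flip: power_mult_distrib)
    then show ?thesis
      by (simp add: gbinomial_pochhammer power_minus[of x])
  qed
  ultimately show ?thesis by simp
qed

text \<open>Cauchy-Schwarz with the moments \<open>m n = fact n / pochhammer s n\<close> as weights.
  The reciprocals of these moments are the binomial coefficients of
  \<open>(1 - x) powr (- s)\<close>, so the second factor is a partial sum of that series at
  \<open>x = r^2\<close>.\<close>

lemma power_series_value_le:
  fixes a :: "nat \<Rightarrow> complex"
  assumes s: "s > 0" and r: "0 \<le> r" "r < 1"
    and sums: "(\<lambda>n. a n * of_real r ^ n) sums w"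
    and S: "\<And>K. (\<Sum>n<K. (cmod (a n))\<^sup>2 * (fact n / pochhammer s n)) \<le> S"
  shows "(cmod w)\<^sup>2 \<le> (1 - r\<^sup>2) powr (- s) * S"
proof -
  define m where "m n = fact n / pochhammer s n" for n
  have m: "m n > 0" for n unfolding m_def using s by (simp add: pochhammer_pos)
  have r2: "\<bar>r\<^sup>2\<bar> < 1" using r by (simp add: abs_square_less_1)
  have S0: "S \<ge> 0" using S[of 0] by simp
  have bd: "(cmod (\<Sum>n<K. a n * of_real r ^ n))\<^sup>2 \<le> (1 - r\<^sup>2) powr (- s) * S" for K
  proof -
    have "cmod (\<Sum>n<K. a n * of_real r ^ n) \<le> (\<Sum>n<K. (cmod (a n) * sqrt (m n)) * (r ^ n / sqrt (m n)))"
      by (rule order_trans[OF norm_sum]) (use r m in \<open>auto intro!: sum_mono simp: norm_mult norm_power less_imp_neq[OF m, symmetric]\<close>)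
    then have "(cmod (\<Sum>n<K. a n * of_real r ^ n))\<^sup>2 \<le> (\<Sum>n<K. (cmod (a n) * sqrt (m n)) * (r ^ n / sqrt (m n)))\<^sup>2"
      by (intro power_mono) auto
    also have "\<dots> \<le> (\<Sum>n<K. (cmod (a n) * sqrt (m n))\<^sup>2) * (\<Sum>n<K. (r ^ n / sqrt (m n))\<^sup>2)"
      by (rule Cauchy_Schwarz_ineq_sum)
    also have "\<dots> \<le> S * (1 - r\<^sup>2) powr (- s)"
    proof (intro mult_mono)
      show "(\<Sum>n<K. (cmod (a n) * sqrt (m n))\<^sup>2) \<le> S"
        using S[of K] m by (simp add: power_mult_distrib less_imp_le flip: m_def)
      have "(\<Sum>n<K. (r ^ n / sqrt (m n))\<^sup>2) = (\<Sum>n<K. pochhammer s n / fact n * (r\<^sup>2) ^ n)"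
        using m by (intro sum.cong refl) (simp add: power_divide less_imp_le m_def mult.commute flip: power_mult)
      also have "\<dots> \<le> (\<Sum>n. pochhammer s n / fact n * (r\<^sup>2) ^ n)"
        by (rule sum_le_suminf)
           (use sums_pochhammer_powr_real[OF r2, of s] s in \<open>auto simp: sums_iff pochhammer_nonneg\<close>)
      also have "\<dots> = (1 - r\<^sup>2) powr (- s)"
        using sums_pochhammer_powr_real[OF r2, of s] by (simp add: sums_iff)
      finally show "(\<Sum>n<K. (r ^ n / sqrt (m n))\<^sup>2) \<le> (1 - r\<^sup>2) powr (- s)" .
    qed (use S0 in \<open>auto intro!: sum_nonneg\<close>)
    finally show ?thesis by (simp add: mult.commute)
  qed
  have "(\<lambda>K. (cmod (\<Sum>n<K. a n * of_real r ^ n))\<^sup>2) \<longlonglongrightarrow> (cmod w)\<^sup>2"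
    using sums unfolding sums_def by (intro tendsto_intros)
  then show ?thesis by (rule LIMSEQ_le_const2) (use bd in blast)
qed


text \<open>What the Bergman measure and each Hardy measure of radius below 1 have in common.
  Estimates proved here are used once for Bergman and, for Hardy, at every radius before taking the
  supremum.\<close>

locale invariant_ball_measure =
  fixes \<mu> :: "(complex ^ 'n) measure"
  assumes sets_\<mu>[measurable_cong]: "sets \<mu> = sets borel"
    and mass: "emeasure \<mu> (space \<mu>) = 1"
    and inv: "isometry_invariant \<mu>"
    and AE_ball: "AE z in \<mu>. norm z < 1"
begin

lemma sigma_finite: "sigma_finite_measure \<mu>"
proof -
  interpret finite_measure \<mu> using mass by (intro finite_measureI) simp
  show ?thesis by unfold_locales
qed

lemma nn_integral_square_cut:
  "(\<integral>\<^sup>+z. ennreal ((cmod (f z))\<^sup>2) \<partial>\<mu>) = (\<integral>\<^sup>+z. ennreal ((cmod (if z \<in> ball 0 1 then f z else 0))\<^sup>2) \<partial>\<mu>)"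
  by (intro nn_integral_cong_AE, use AE_ball in eventually_elim) simp

text \<open>From \<open>(x + y)^2 \<le> 2 x^2 + 2 y^2\<close>. It serves to show that the difference
  of two functions of finite norm has finite norm, and the factor 2 is harmless for that.\<close>

lemma nn_integral_square_diff_le:
  assumes f: "holo_ball f" and g: "holo_ball g"
  shows "(\<integral>\<^sup>+z. ennreal ((cmod ((f - g) z))\<^sup>2) \<partial>\<mu>)
    \<le> 2 * (\<integral>\<^sup>+z. ennreal ((cmod (f z))\<^sup>2) \<partial>\<mu>) + 2 * (\<integral>\<^sup>+z. ennreal ((cmod (g z))\<^sup>2) \<partial>\<mu>)"
proof -
  define f' where "f' z = (if z \<in> ball 0 1 then f z else 0)" for z
  define g' where "g' z = (if z \<in> ball 0 1 then g z else 0)" for z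
  have [measurable]: "f' \<in> borel_measurable borel" "g' \<in> borel_measurable borel"
    using holo_ball_measurable[OF f] holo_ball_measurable[OF g] by (simp_all add: f'_def[abs_def] g'_def[abs_def])
  have "(\<integral>\<^sup>+z. ennreal ((cmod ((f - g) z))\<^sup>2) \<partial>\<mu>) \<le> (\<integral>\<^sup>+z. 2 * ennreal ((cmod (f' z))\<^sup>2) + 2 * ennreal ((cmod (g' z))\<^sup>2) \<partial>\<mu>)"
  proof (intro nn_integral_mono_AE, use AE_ball in eventually_elim)
    fix z :: "complex ^ 'n" assume "norm z < 1"
    have "(cmod (f z - g z))\<^sup>2 \<le> (cmod (f z) + cmod (g z))\<^sup>2"
      by (intro power_mono norm_triangle_ineq4) auto
    also have "\<dots> \<le> 2 * (cmod (f z))\<^sup>2 + 2 * (cmod (g z))\<^sup>2"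
      using zero_le_power2[of "cmod (f z) - cmod (g z)"] by (simp add: power2_sum power2_diff)
    finally have "ennreal ((cmod (f z - g z))\<^sup>2) \<le> ennreal (2 * (cmod (f z))\<^sup>2 + 2 * (cmod (g z))\<^sup>2)"
      by (rule ennreal_leI)
    then show "ennreal ((cmod ((f - g) z))\<^sup>2) \<le> 2 * ennreal ((cmod (f' z))\<^sup>2) + 2 * ennreal ((cmod (g' z))\<^sup>2)"
      using \<open>norm z < 1\<close> by (simp add: f'_def g'_def ennreal_plus ennreal_mult)
  qed
  also have "\<dots> = 2 * (\<integral>\<^sup>+z. ennreal ((cmod (f' z))\<^sup>2) \<partial>\<mu>) + 2 * (\<integral>\<^sup>+z. ennreal ((cmod (g' z))\<^sup>2) \<partial>\<mu>)"
    by (simp add: nn_integral_add nn_integral_cmult)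
  finally show ?thesis
    unfolding nn_integral_square_cut[of f] nn_integral_square_cut[of g] by (simp add: f'_def g'_def)
qed

lemma nn_integral_square_bounded:
  assumes "\<And>z. norm z < 1 \<Longrightarrow> cmod (f z) \<le> B"
  shows "(\<integral>\<^sup>+z. ennreal ((cmod (f z))\<^sup>2) \<partial>\<mu>) \<le> ennreal (B\<^sup>2)"
proof -
  have "(\<integral>\<^sup>+z. ennreal ((cmod (f z))\<^sup>2) \<partial>\<mu>) \<le> (\<integral>\<^sup>+z. ennreal (B\<^sup>2) \<partial>\<mu>)"
    by (intro nn_integral_mono_AE, use AE_ball in eventually_elim)
       (use assms in \<open>auto intro!: ennreal_leI power_mono\<close>)
  then show ?thesis by (simp add: mass)
qed

text \<open>Stated for finite partial sums so that, in the Hardy case, the radius can tend to 1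
  under the sum.\<close>

lemma slice_coeff_partial_moments_le:
  assumes "holo_ball f" "norm \<zeta> = 1"
    and m: "\<And>n. (\<integral>\<^sup>+z. ennreal (cmod (cinner z \<zeta>) ^ (2 * n)) \<partial>\<mu>) = ennreal (m n)" "\<And>n. m n \<ge> 0"
  shows "ennreal (\<Sum>n<K. (cmod (slice_coeff f \<zeta> n))\<^sup>2 * m n) \<le> (\<integral>\<^sup>+z. ennreal ((cmod (f z))\<^sup>2) \<partial>\<mu>)"
proof -
  have "ennreal (\<Sum>n<K. (cmod (slice_coeff f \<zeta> n))\<^sup>2 * m n)
     = (\<Sum>n<K. ennreal ((cmod (slice_coeff f \<zeta> n))\<^sup>2) * ennreal (m n))"
    using m(2) by (simp add: ennreal_mult flip: sum_ennreal)
  also have "\<dots> \<le> (\<Sum>n. ennreal ((cmod (slice_coeff f \<zeta> n))\<^sup>2) * ennreal (m n))"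
    by (rule sum_le_suminf) auto
  also have "\<dots> \<le> (\<integral>\<^sup>+z. ennreal ((cmod (f z))\<^sup>2) \<partial>\<mu>)"
    using slice_coeff_moments_le[OF sets_\<mu> sigma_finite inv AE_ball assms(1,2)] by (simp add: m(1))
  finally show ?thesis .
qed

end

text \<open>The normalised reproducing kernel at the point \<open>r *\<^sub>R \<zeta>\<close>: the
  kernel has squared norm \<open>(1 - r^2) powr (- s)\<close>. For \<open>norm \<zeta> = 1\<close>
  and \<open>0 \<le> r \<le> 1\<close> the base of the complex power has positive real part on the
  ball, so the principal branch is holomorphic there.\<close>

definition kernel_fun :: "real \<Rightarrow> complex ^ 'n \<Rightarrow> real \<Rightarrow> complex ^ 'n \<Rightarrow> complex" where
  "kernel_fun s \<zeta> r z = of_real ((1 - r\<^sup>2) powr (s / 2)) * (1 - of_real r * cinner z \<zeta>) powr (- of_real s)"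

text \<open>Squared coefficients times moments collapse to the binomial series at
  \<open>r^2\<close>, whose sum cancels against the squared normalising constant. Only an upper
  bound on the moments is assumed because those of the Hardy measure of radius \<open>\<rho>\<close>
  carry an extra factor \<open>\<rho> ^ (2 * n)\<close>.\<close>

lemma (in invariant_ball_measure) kernel_fun_norm_le:
  assumes s: "s > 0" and r: "0 \<le> r" "r < 1" and \<zeta>: "norm \<zeta> = 1"
    and m: "\<And>n. (\<integral>\<^sup>+z. ennreal (cmod (cinner z \<zeta>) ^ (2 * n)) \<partial>\<mu>) \<le> ennreal (fact n / pochhammer s n)"
  shows "(\<integral>\<^sup>+z. ennreal ((cmod (kernel_fun s \<zeta> r z))\<^sup>2) \<partial>\<mu>) \<le> 1"
proof -
  define c where "c = (1 - r\<^sup>2) powr (s / 2)"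
  have r2: "\<bar>r\<^sup>2\<bar> < 1" using r by (simp add: abs_square_less_1)
  have c2: "c\<^sup>2 = (1 - r\<^sup>2) powr s"
    using r2 by (simp add: c_def power2_eq_square flip: powr_add)
  define a where "a n = complex_of_real (c * (pochhammer s n / fact n) * r ^ n)" for n
  have "(\<lambda>n. a n * w ^ n) sums (of_real c * (1 - of_real r * w) powr (- of_real s))" if "ereal (cmod w) < 1" for w
  proof -
    have "r * cmod w < 1" using that r
      by (metis ereal_less_eq(3) le_less_trans less_eq_real_def mult_left_le_one_le norm_ge_zero one_ereal_def ereal_less(3) less_ereal.simps(1))
    then have "cmod (of_real r * w) < 1" using r by (simp add: norm_mult)
    from sums_mult[OF sums_pochhammer_powr[OF this, of s], of "of_real c"]
    show ?thesis by (simp add: a_def power_mult_distrib mult_ac)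
  qed
  from nn_integral_square_power_series[OF sets_\<mu> sigma_finite isometry_invariant_rotation[OF inv] this AE_cinner_less_1[OF AE_ball \<zeta>]]
  have "(\<integral>\<^sup>+z. ennreal ((cmod (kernel_fun s \<zeta> r z))\<^sup>2) \<partial>\<mu>)
    = (\<Sum>n. ennreal ((cmod (a n))\<^sup>2) * (\<integral>\<^sup>+z. ennreal (cmod (cinner z \<zeta>) ^ (2 * n)) \<partial>\<mu>))"
    by (simp add: kernel_fun_def c_def)
  also have "\<dots> \<le> (\<Sum>n. ennreal ((cmod (a n))\<^sup>2) * ennreal (fact n / pochhammer s n))"
    by (intro suminf_le mult_left_mono m) auto
  also have "\<dots> = (\<Sum>n. ennreal (c\<^sup>2 * (pochhammer s n / fact n * (r\<^sup>2) ^ n)))"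
  proof (intro suminf_cong)
    fix n
    have p: "pochhammer s n > 0" using s by (rule pochhammer_pos)
    have "(cmod (a n))\<^sup>2 = (c * (pochhammer s n / fact n) * r ^ n)\<^sup>2"
      by (simp only: a_def norm_of_real power2_abs)
    then have "(cmod (a n))\<^sup>2 * (fact n / pochhammer s n) = c\<^sup>2 * (pochhammer s n / fact n * (r\<^sup>2) ^ n)"
      using p by (simp add: power_mult_distrib power2_eq_square field_simps)
    then show "ennreal ((cmod (a n))\<^sup>2) * ennreal (fact n / pochhammer s n) = ennreal (c\<^sup>2 * (pochhammer s n / fact n * (r\<^sup>2) ^ n))"
      using p by (simp flip: ennreal_mult)
  qed
  also have "\<dots> = ennreal (c\<^sup>2 * (1 - r\<^sup>2) powr (- s))"
    using s by (intro suminf_ennreal_eq sums_mult sums_pochhammer_powr_real[OF r2]) (simp add: pochhammer_nonneg)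
  also have "c\<^sup>2 * (1 - r\<^sup>2) powr (- s) = 1"
    using r2 by (simp add: c2 flip: powr_add)
  finally show ?thesis by simp
qed

lemma smult_of_real: "of_real r *s (z :: complex ^ 'n) = r *\<^sub>R z"
  by (simp add: vec_eq_iff scaleR_conv_of_real[where 'a = complex])

text \<open>The growth estimate at \<open>r *\<^sub>R \<zeta>\<close>, read off from the power
  series of the slice. An infinite \<open>S\<close> is separated because the coefficient estimate is
  about real numbers.\<close>

lemma holo_ball_value_le:
  assumes s: "s > 0" and r: "0 \<le> r" "r < 1" and \<zeta>: "norm \<zeta> = 1" and f: "holo_ball f"
    and S: "\<And>K. ennreal (\<Sum>n<K. (cmod (slice_coeff f \<zeta> n))\<^sup>2 * (fact n / pochhammer s n)) \<le> S"
  shows "ennreal ((cmod (f (r *\<^sub>R \<zeta>)))\<^sup>2) \<le> ennreal ((1 - r\<^sup>2) powr (- s)) * S"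
proof (cases "S = \<infinity>")
  case True
  have "1 - r\<^sup>2 > 0" using r by (simp add: abs_square_less_1)
  then show ?thesis using True by (simp add: ennreal_mult_top)
next
  case False
  then obtain S' where S': "S = ennreal S'" "S' \<ge> 0" by (cases S) auto
  have "(cmod (f (r *\<^sub>R \<zeta>)))\<^sup>2 \<le> (1 - r\<^sup>2) powr (- s) * S'"
  proof (rule power_series_value_le[OF s r])
    show "(\<lambda>n. slice_coeff f \<zeta> n * of_real r ^ n) sums f (r *\<^sub>R \<zeta>)"
      using slice_coeff_sums[OF f \<zeta>, of "of_real r"] r by (simp add: smult_of_real)
    show "(\<Sum>n<K. (cmod (slice_coeff f \<zeta> n))\<^sup>2 * (fact n / pochhammer s n)) \<le> S'" for K
      using S[of K] S' by simp
  qed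
  then have "ennreal ((cmod (f (r *\<^sub>R \<zeta>)))\<^sup>2) \<le> ennreal ((1 - r\<^sup>2) powr (- s) * S')" by (rule ennreal_leI)
  then show ?thesis using S' by (simp add: ennreal_mult)
qed

section \<open>The Bergman and Hardy norms as integrals against invariant measures\<close>

lemma AE_ball_measure: "AE z in ball_measure. norm z < 1"
  unfolding ball_measure_def by (rule AE_uniform_measureI) auto

lemma invariant_ball_measure_bergman:
  assumes "\<alpha> > -1"
  shows "invariant_ball_measure (bergman_measure \<alpha> :: (complex ^ 'n) measure)"
proof
  \<comment> \<open>The total mass is the moment of order 0, and any unit vector serves to apply the
    moment formula.\<close>
  have "norm (axis undefined 1 :: complex ^ 'n) = 1" by (simp add: norm_axis_1)
  from bergman_moment[OF this assms, of 0]
  show "emeasure (bergman_measure \<alpha>) (space (bergman_measure \<alpha> :: (complex ^ 'n) measure)) = 1" by simp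
  show "AE z in bergman_measure \<alpha>. norm (z :: complex ^ 'n) < 1"
    unfolding bergman_measure_def using AE_ball_measure by (subst AE_density) auto
qed (simp_all add: isometry_invariant_bergman)

text \<open>Stated with \<open>\<le>\<close> since radial projection sends the origin to 0 by the
  convention \<open>1 / 0 = 0\<close>.\<close>

lemma AE_sphere_measure: "AE z in sphere_measure. norm (z :: complex ^ 'n) \<le> 1"
  unfolding sphere_measure_def by (subst AE_distr_iff) (auto simp: field_simps)

lemma invariant_ball_measure_hardy:
  assumes "0 \<le> \<rho>" "\<rho> < 1"
  shows "invariant_ball_measure (hardy_measure \<rho> :: (complex ^ 'n) measure)"
proof
  have "norm (axis undefined 1 :: complex ^ 'n) = 1" by (simp add: norm_axis_1)
  from hardy_moment[OF this assms(1), of 0]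
  show "emeasure (hardy_measure \<rho>) (space (hardy_measure \<rho> :: (complex ^ 'n) measure)) = 1" by simp
  have "AE z in sphere_measure. norm (\<rho> *\<^sub>R z :: complex ^ 'n) < 1"
    using AE_sphere_measure
  proof eventually_elim
    fix z :: "complex ^ 'n" assume "norm z \<le> 1"
    then have "\<rho> * norm z \<le> \<rho> * 1" using assms by (intro mult_left_mono) auto
    then show "norm (\<rho> *\<^sub>R z) < 1" using assms by simp
  qed
  then show "AE z in hardy_measure \<rho>. norm (z :: complex ^ 'n) < 1"
    unfolding hardy_measure_def by (subst AE_distr_iff) auto
qed (simp_all add: isometry_invariant_hardy)

lemma bergman_sq_eq:
  fixes f :: "complex ^ 'n \<Rightarrow> complex"
  assumes \<alpha>: "\<alpha> > -1" and f: "holo_ball f"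
  shows "bergman_sq \<alpha> f = (\<integral>\<^sup>+z. ennreal ((cmod (f z))\<^sup>2) \<partial>bergman_measure \<alpha>)"
proof -
  interpret invariant_ball_measure "bergman_measure \<alpha> :: (complex ^ 'n) measure"
    by (rule invariant_ball_measure_bergman[OF \<alpha>])
  define g where "g z = (if z \<in> ball 0 1 then f z else 0)" for z
  have [measurable]: "g \<in> borel_measurable borel"
    using holo_ball_measurable[OF f] by (simp add: g_def[abs_def])
  have "(\<integral>\<^sup>+z. ennreal ((cmod (f z))\<^sup>2) \<partial>bergman_measure \<alpha>) = (\<integral>\<^sup>+z. ennreal ((cmod (g z))\<^sup>2) \<partial>bergman_measure \<alpha>)"
    unfolding g_def by (rule nn_integral_square_cut)
  also have "\<dots> = (\<integral>\<^sup>+z. ennreal ((cmod (g z))\<^sup>2) * ennreal (bergman_const TYPE('n) \<alpha> * (1 - (norm z)\<^sup>2) powr \<alpha>) \<partial>ball_measure)"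
    by (rule nn_integral_bergman_measure) measurable
  also have "\<dots> = bergman_sq \<alpha> f"
    unfolding bergman_sq_def
    by (intro nn_integral_cong_AE, use AE_ball_measure in eventually_elim)
       (use bergman_const_pos[OF \<alpha>, where 'n = 'n] in \<open>simp add: g_def ennreal_mult[symmetric] mult.assoc\<close>)
  finally show ?thesis ..
qed

lemma hardy_sq_eq:
  fixes f :: "complex ^ 'n \<Rightarrow> complex"
  assumes f: "holo_ball f"
  shows "hardy_sq f = (SUP \<rho>\<in>{0<..<1}. \<integral>\<^sup>+z. ennreal ((cmod (f z))\<^sup>2) \<partial>hardy_measure \<rho>)"
  unfolding hardy_sq_def
proof (rule SUP_cong)
  fix \<rho> :: real assume "\<rho> \<in> {0<..<1}"
  then have \<rho>: "0 \<le> \<rho>" "\<rho> < 1" by auto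
  interpret invariant_ball_measure "hardy_measure \<rho> :: (complex ^ 'n) measure"
    by (rule invariant_ball_measure_hardy[OF \<rho>])
  define g where "g z = (if z \<in> ball 0 1 then f z else 0)" for z
  have [measurable]: "g \<in> borel_measurable borel"
    using holo_ball_measurable[OF f] by (simp add: g_def[abs_def])
  have "(\<integral>\<^sup>+z. ennreal ((cmod (f z))\<^sup>2) \<partial>hardy_measure \<rho>) = (\<integral>\<^sup>+z. ennreal ((cmod (g z))\<^sup>2) \<partial>hardy_measure \<rho>)"
    unfolding g_def by (rule nn_integral_square_cut)
  also have "\<dots> = (\<integral>\<^sup>+z. ennreal ((cmod (g (\<rho> *\<^sub>R z)))\<^sup>2) \<partial>sphere_measure)"
    by (rule nn_integral_hardy_measure) measurable
  also have "\<dots> = (\<integral>\<^sup>+z. ennreal ((cmod (f (\<rho> *\<^sub>R z)))\<^sup>2) \<partial>sphere_measure)"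
  proof (intro nn_integral_cong_AE, use AE_sphere_measure in eventually_elim)
    fix z :: "complex ^ 'n" assume "norm z \<le> 1"
    then have "\<rho> * norm z \<le> \<rho> * 1" using \<rho> by (intro mult_left_mono) auto
    then show "ennreal ((cmod (g (\<rho> *\<^sub>R z)))\<^sup>2) = ennreal ((cmod (f (\<rho> *\<^sub>R z)))\<^sup>2)"
      using \<rho> by (simp add: g_def)
  qed
  finally show "(\<integral>\<^sup>+z. ennreal ((cmod (f (\<rho> *\<^sub>R z)))\<^sup>2) \<partial>sphere_measure)
      = (\<integral>\<^sup>+z. ennreal ((cmod (f z))\<^sup>2) \<partial>hardy_measure \<rho>)" ..
qed simp


section \<open>Linear-fractional maps\<close>

lemma bounded_linear_cinner: "bounded_linear (\<lambda>z. cinner z w)"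
  unfolding linear_conv_bounded_linear[symmetric]
  by (rule linearI) (auto simp: cinner_add_left cinner_scaleR_left scaleR_conv_of_real[where 'a = complex])

lemma matrix_vector_mult_scaleR_complex: "(A :: complex ^ 'n ^ 'm) *v (r *\<^sub>R x) = r *\<^sub>R (A *v x)"
  by (simp add: vector_scalar_commute flip: smult_of_real)

lemma bounded_linear_matrix_vector_complex: "bounded_linear (\<lambda>z. (A :: complex ^ 'n ^ 'm) *v z)"
  unfolding linear_conv_bounded_linear[symmetric]
  by (rule linearI) (auto simp: matrix_vector_right_distrib matrix_vector_mult_scaleR_complex)

lemma bounded_bilinear_smult: "bounded_bilinear (\<lambda>(c::complex) (v :: complex ^ 'n). c *s v)"
proof
  show "\<exists>K. \<forall>a b. norm (a *s b :: complex ^ 'n) \<le> norm a * norm b * K"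
    by (rule exI[of _ 1]) (simp add: norm_smult_complex)
qed (auto simp: vec_eq_iff algebra_simps)

lemma lin_frac_has_derivative:
  fixes A :: "complex ^ 'n ^ 'n"
  assumes "cinner z C + d \<noteq> 0"
  shows "\<exists>D. (lin_frac A B C d has_derivative D) (at z) \<and> (\<forall>c v. D (c *s v) = c *s D v)"
proof -
  define q where "q = cinner z C + d"
  define D where "D h = inverse q *s (A *v h) + (- (inverse q * cinner h C * inverse q)) *s (A *v z + B)" for h
  have "((\<lambda>z. cinner z C + d) has_derivative (\<lambda>h. cinner h C)) (at z)"
    using has_derivative_add[OF bounded_linear_imp_has_derivative[OF bounded_linear_cinner] has_derivative_const]
    by simp
  then have 1: "((\<lambda>z. inverse (cinner z C + d)) has_derivative (\<lambda>h. - (inverse q * cinner h C * inverse q))) (at z)"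
    unfolding q_def using assms by (intro Deriv.has_derivative_inverse)
  have 2: "((\<lambda>z. A *v z + B) has_derivative (\<lambda>h. A *v h)) (at z)"
    using has_derivative_add[OF bounded_linear_imp_has_derivative[OF bounded_linear_matrix_vector_complex] has_derivative_const]
    by simp
  have "(lin_frac A B C d has_derivative D) (at z)"
    using bounded_bilinear.FDERIV[OF bounded_bilinear_smult 1 2]
    unfolding lin_frac_def[abs_def] D_def q_def by (simp add: inverse_eq_divide)
  moreover have "D (c *s v) = c *s D v" for c v
    unfolding D_def by (simp add: vector_scalar_commute cinner_smult_left vec_eq_iff algebra_simps)
  ultimately show ?thesis by blast
qed

lemma lf_selfmap_ball: "lf_selfmap \<phi> \<Longrightarrow> norm z < 1 \<Longrightarrow> norm (\<phi> z) < 1"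
  unfolding lf_selfmap_def by (metis image_subset_iff mem_ball_0)

lemma holo_ball_comp_op:
  fixes \<phi> :: "complex ^ 'n \<Rightarrow> complex ^ 'n"
  assumes \<phi>: "lf_selfmap \<phi>" and f: "holo_ball f"
  shows "holo_ball (comp_op \<phi> f)"
  unfolding holo_ball_def comp_op_def
proof
  fix z :: "complex ^ 'n" assume z: "z \<in> ball 0 1"
  obtain A B C d where \<phi>_eq: "\<phi> = lin_frac A B C d" and nz: "cinner z C + d \<noteq> 0"
    using \<phi> z unfolding lf_selfmap_def by blast
  obtain D where D: "(\<phi> has_derivative D) (at z)" "\<And>c v. D (c *s v) = c *s D v"
    using lin_frac_has_derivative[OF nz] unfolding \<phi>_eq by blast
  have "\<phi> z \<in> ball 0 1" using lf_selfmap_ball[OF \<phi>, of z] z by simp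
  then obtain L where L: "(f has_derivative L) (at (\<phi> z))" "\<And>c v. L (c *s v) = c * L v"
    using f unfolding holo_ball_def by blast
  have "(f \<circ> \<phi> has_derivative (L \<circ> D)) (at z)"
    using D(1) L(1) by (rule diff_chain_at)
  then show "\<exists>L. (f \<circ> \<phi> has_derivative L) (at z) \<and> (\<forall>c v. L (c *s v) = c * L v)"
    using D(2) L(2) by (intro exI[of _ "L \<circ> D"]) simp
qed

lemma holo_ball_diff:
  assumes "holo_ball f" "holo_ball g"
  shows "holo_ball (f - g)"
  unfolding holo_ball_def
proof
  fix z :: "complex ^ 'a" assume z: "z \<in> ball 0 1"
  obtain L where L: "(f has_derivative L) (at z)" "\<And>c v. L (c *s v) = c * L v"
    using assms(1) z unfolding holo_ball_def by blast
  obtain M where M: "(g has_derivative M) (at z)" "\<And>c v. M (c *s v) = c * M v"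
    using assms(2) z unfolding holo_ball_def by blast
  have "(f - g has_derivative (\<lambda>v. L v - M v)) (at z)"
    using has_derivative_diff[OF L(1) M(1)] by (simp add: fun_diff_def)
  then show "\<exists>L. (f - g has_derivative L) (at z) \<and> (\<forall>c v. L (c *s v) = c * L v)"
    using L(2) M(2) by (intro exI[of _ "\<lambda>v. L v - M v"]) (simp add: algebra_simps)
qed

text \<open>Keeps the base of the kernel function off the branch cut and, for \<open>r < 1\<close>,
  at distance at least \<open>1 - r\<close> from 0.\<close>

lemma Re_one_minus_cinner:
  assumes "norm \<zeta> = 1" "norm z < 1" "0 \<le> r" "r \<le> 1"
  shows "Re (1 - of_real r * cinner z \<zeta>) \<ge> 1 - r" "Re (1 - of_real r * cinner z \<zeta>) > 0"
proof -
  have "Re (cinner z \<zeta>) < 1"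
    using norm_cinner_le[OF assms(1), of z] complex_Re_le_cmod[of "cinner z \<zeta>"] assms(2) by linarith
  then have *: "r * Re (cinner z \<zeta>) \<le> r" "r * Re (cinner z \<zeta>) < 1"
    using assms(3,4) mult_left_mono[of "Re (cinner z \<zeta>)" 1 r]
    by (simp, cases "r = 0") (auto intro: less_le_trans[of _ "r * 1"])
  then show "Re (1 - of_real r * cinner z \<zeta>) \<ge> 1 - r" "Re (1 - of_real r * cinner z \<zeta>) > 0" by auto
qed

lemma holo_ball_kernel_fun:
  fixes \<zeta> :: "complex ^ 'n"
  assumes "norm \<zeta> = 1" "0 \<le> r" "r < 1"
  shows "holo_ball (kernel_fun s \<zeta> r)"
  unfolding holo_ball_def
proof
  fix z :: "complex ^ 'n" assume z: "z \<in> ball 0 1"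
  define c where "c = (1 - r\<^sup>2) powr (s / 2)"
  define F where "F w = of_real c * (1 - of_real r * w) powr (- of_real s)" for w :: complex
  define U where "U = {w :: complex. 0 < Re (1 - of_real r * w)}"
  have "cinner z \<zeta> \<in> U"
    using Re_one_minus_cinner(2)[of \<zeta> z r] assms z by (simp add: U_def)
  moreover have "open U" unfolding U_def by (intro open_Collect_less continuous_intros)
  moreover have "F holomorphic_on U"
    unfolding F_def U_def by (intro holomorphic_intros) (auto simp: complex_nonpos_Reals_iff)
  ultimately have "\<exists>F'. (F has_field_derivative F') (at (cinner z \<zeta>))"
    using holomorphic_on_imp_differentiable_at field_differentiable_def by blast
  then obtain F' where F': "(F has_derivative (\<lambda>h. F' * h)) (at (cinner z \<zeta>))"
    unfolding has_field_derivative_def by (auto simp: mult.commute)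
  have "(F \<circ> (\<lambda>z. cinner z \<zeta>) has_derivative ((\<lambda>h. F' * h) \<circ> (\<lambda>h. cinner h \<zeta>))) (at z)"
    by (rule diff_chain_at[OF bounded_linear_imp_has_derivative[OF bounded_linear_cinner] F'])
  moreover have "F \<circ> (\<lambda>z. cinner z \<zeta>) = kernel_fun s \<zeta> r"
    by (simp add: F_def c_def kernel_fun_def fun_eq_iff)
  ultimately show "\<exists>L. (kernel_fun s \<zeta> r has_derivative L) (at z) \<and> (\<forall>c v. L (c *s v) = c * L v)"
    by (intro exI[of _ "\<lambda>h. F' * cinner h \<zeta>"]) (simp add: o_def cinner_smult_left)
qed

text \<open>The bound depends on \<open>r\<close> but not on \<open>z\<close>, so it survives
  composition with any self-map of the ball.\<close>

lemma kernel_fun_bounded: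
  assumes "norm \<zeta> = 1" "0 \<le> r" "r < 1" "s > 0" "norm z < 1"
  shows "cmod (kernel_fun s \<zeta> r z) \<le> (1 - r\<^sup>2) powr (s / 2) * (1 - r) powr (- s)"
proof -
  have "1 - r \<le> cmod (1 - of_real r * cinner z \<zeta>)"
    using Re_one_minus_cinner(1)[of \<zeta> z r] complex_Re_le_cmod[of "1 - of_real r * cinner z \<zeta>"] assms by linarith
  then have "cmod (1 - of_real r * cinner z \<zeta>) powr (- s) \<le> (1 - r) powr (- s)"
    using assms by (intro powr_mono2') auto
  moreover have "cmod ((1 - of_real r * cinner z \<zeta>) powr (- of_real s)) = cmod (1 - of_real r * cinner z \<zeta>) powr (- s)"
    by (subst norm_powr_real_powr') auto
  ultimately show ?thesis
    unfolding kernel_fun_def norm_mult by (intro mult_mono) auto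
qed

section \<open>Boundary behaviour along the radius\<close>

lemma lin_frac_slice:
  "cinner (lin_frac A B C d (w *s \<zeta>)) \<zeta>
    = (w * cinner (A *v \<zeta>) \<zeta> + cinner B \<zeta>) / (w * cinner \<zeta> C + d)"
  by (simp add: lin_frac_def cinner_smult_left cinner_add_left vector_scalar_commute add_divide_distrib)

text \<open>Since \<open>\<zeta> + t *s \<zeta> = (1 + t) *s \<zeta>\<close>, the directional
  derivative in \<open>Dcomp\<close> is the ordinary derivative at 1 of a scalar linear-fractional
  function.\<close>

lemma lin_frac_slice_has_derivative:
  assumes "cinner \<zeta> C + d \<noteq> 0"
  shows "((\<lambda>w. cinner (lin_frac A B C d (w *s \<zeta>)) \<zeta>) has_field_derivative
      Dcomp (lin_frac A B C d) \<zeta> \<zeta> \<zeta>) (at 1)"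
proof -
  define u where "u w = cinner (lin_frac A B C d (w *s \<zeta>)) \<zeta>" for w
  have u_eq: "u = (\<lambda>w. (w * cinner (A *v \<zeta>) \<zeta> + cinner B \<zeta>) / (w * cinner \<zeta> C + d))"
    by (simp add: fun_eq_iff u_def lin_frac_slice)
  have "\<exists>a. (u has_field_derivative a) (at 1)"
  proof -
    define U where "U = {w. w * cinner \<zeta> C + d \<noteq> 0}"
    have "open U" unfolding U_def by (intro open_Collect_neq continuous_intros)
    moreover have "u holomorphic_on U" unfolding u_eq U_def by (intro holomorphic_intros) auto
    moreover have "1 \<in> U" using assms by (simp add: U_def)
    ultimately show ?thesis
      using holomorphic_on_imp_differentiable_at field_differentiable_def by blast
  qed
  then obtain a where a: "(u has_field_derivative a) (at 1)" by blast
  have "((\<lambda>t. u (t + 1)) has_field_derivative a) (at 0)"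
    using a DERIV_shift[of u a 0 1] by simp
  moreover have "u (t + 1) = cinner (lin_frac A B C d (\<zeta> + t *s \<zeta>)) \<zeta>" for t
    by (simp add: u_def vec_eq_iff algebra_simps)
  ultimately have "Dcomp (lin_frac A B C d) \<zeta> \<zeta> \<zeta> = a"
    unfolding Dcomp_def by (simp add: DERIV_imp_deriv)
  then show ?thesis using a by (simp add: u_def[abs_def])
qed

text \<open>An elementary case of the Julia-Caratheodory theorem. From 1, every direction
  \<open>- Complex 1 y\<close> enters the disc, where \<open>Re u\<close> is at most its value at 1;
  hence \<open>Re (a * Complex 1 y)\<close> is nonnegative. Letting \<open>y\<close> vary over all
  reals forces \<open>Im a = 0\<close>.\<close>

lemma boundary_derivative_nonneg:
  fixes u :: "complex \<Rightarrow> complex"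
  assumes u: "(u has_field_derivative a) (at 1)" and "u 1 = 1"
    and bd: "\<And>w. cmod w < 1 \<Longrightarrow> cmod (u w) \<le> 1"
  shows "a \<in> \<real>" "Re a \<ge> 0"
proof -
  have key: "Re (a * Complex 1 y) \<ge> 0" for y
  proof (rule ccontr)
    define v where "v = Complex 1 y"
    assume "\<not> Re (a * Complex 1 y) \<ge> 0"
    then have neg: "Re (a * (- v)) > 0" by (simp add: v_def)
    have "((\<lambda>t. u (1 + of_real t * (- v))) has_vector_derivative (a * (- v))) (at 0)"
    proof -
      have "((\<lambda>z. u (1 + z * (- v))) has_field_derivative (a * (- v))) (at (of_real 0))"
        by (rule DERIV_chain2[of u a "\<lambda>z. 1 + z * (- v)"]) (use u in \<open>auto intro!: derivative_eq_intros\<close>)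
      from has_vector_derivative_real_field[OF this] show ?thesis by simp
    qed
    then have "((\<lambda>t. Re (u (1 + of_real t * (- v)))) has_vector_derivative Re (a * (- v))) (at 0)"
      by (rule bounded_linear.has_vector_derivative[OF bounded_linear_Re])
    then have "((\<lambda>t. Re (u (1 + of_real t * (- v)))) has_real_derivative Re (a * (- v))) (at 0)"
      by (simp add: has_real_derivative_iff_has_vector_derivative)
    from DERIV_pos_inc_right[OF this neg] obtain e where e: "e > 0"
      and inc: "\<And>h. h > 0 \<Longrightarrow> h < e \<Longrightarrow> 1 < Re (u (1 + of_real h * (- v)))"
      using \<open>u 1 = 1\<close> by auto
    \<comment> \<open>The identity \<open>|1 - h v|^2 = 1 - 2 h + h^2 (1 + y^2)\<close> shows that
      \<open>h (1 + y^2) \<le> 1\<close> keeps the point inside the disc; the other bound keeps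
      \<open>h\<close> where \<open>Re u\<close> exceeds 1.\<close>
    define h where "h = min (e / 2) (1 / (1 + y\<^sup>2))"
    have y2: "1 + y\<^sup>2 > 0" by (simp add: add_pos_nonneg)
    have h: "h > 0" "h < e" "h \<le> 1 / (1 + y\<^sup>2)" using e y2 by (auto simp: h_def)
    have "(cmod (1 + of_real h * (- v)))\<^sup>2 = 1 - 2 * h + h * (h * (1 + y\<^sup>2))"
      unfolding cmod_power2 by (simp add: v_def power2_eq_square algebra_simps)
    also have "\<dots> \<le> 1 - 2 * h + h * 1"
      using h y2 by (intro add_left_mono mult_left_mono) (auto simp: field_simps)
    also have "\<dots> < 1" using h by simp
    finally have "cmod (1 + of_real h * (- v)) < 1" by (simp add: abs_square_less_1)
    then have "Re (u (1 + of_real h * (- v))) \<le> 1"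
      using bd complex_Re_le_cmod order_trans by blast
    then show False using inc[OF h(1,2)] by simp
  qed
  have ineq: "Re a - y * Im a \<ge> 0" for y
    using key[of y] by (simp add: mult.commute)
  show "Re a \<ge> 0" using ineq[of 0] by simp
  have "Im a = 0"
  proof (rule ccontr)
    assume "Im a \<noteq> 0"
    \<comment> \<open>This choice of \<open>y\<close> makes \<open>Re a - y * Im a\<close> equal to
      -1.\<close>
    then show False using ineq[of "(Re a + 1) / Im a"] by simp
  qed
  then show "a \<in> \<real>" by (simp add: complex_is_Real_iff)
qed

lemma lf_selfmap_boundary_derivative:
  assumes \<phi>: "lf_selfmap \<phi>" and \<zeta>: "norm \<zeta> = 1" and fix\<zeta>: "\<phi> \<zeta> = \<zeta>"
  shows "((\<lambda>w. cinner (\<phi> (w *s \<zeta>)) \<zeta>) has_field_derivative Dcomp \<phi> \<zeta> \<zeta> \<zeta>) (at 1)"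
    and "Dcomp \<phi> \<zeta> \<zeta> \<zeta> \<in> \<real>" "Re (Dcomp \<phi> \<zeta> \<zeta> \<zeta>) \<ge> 0"
proof -
  obtain A B C d where eq: "\<phi> = lin_frac A B C d"
    using \<phi> unfolding lf_selfmap_def by blast
  \<comment> \<open>Division by zero yields 0, so a vanishing denominator would give
    \<open>\<phi> \<zeta> = 0\<close> instead of a unit vector.\<close>
  have "cinner \<zeta> C + d \<noteq> 0"
  proof
    assume "cinner \<zeta> C + d = 0"
    then have "\<phi> \<zeta> = 0" by (simp add: eq lin_frac_def)
    then show False using \<zeta> fix\<zeta> by simp
  qed
  then show D: "((\<lambda>w. cinner (\<phi> (w *s \<zeta>)) \<zeta>) has_field_derivative Dcomp \<phi> \<zeta> \<zeta> \<zeta>) (at 1)"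
    unfolding eq by (rule lin_frac_slice_has_derivative)
  have "cinner (\<phi> (1 *s \<zeta>)) \<zeta> = 1" using fix\<zeta> \<zeta> by (simp add: cinner_self)
  moreover have "cmod (cinner (\<phi> (w *s \<zeta>)) \<zeta>) \<le> 1" if "cmod w < 1" for w
  proof -
    have "norm (\<phi> (w *s \<zeta>)) < 1"
      using that \<zeta> by (intro lf_selfmap_ball[OF \<phi>]) (simp add: norm_smult_complex)
    then show ?thesis using norm_cinner_le[OF \<zeta>, of "\<phi> (w *s \<zeta>)"] by simp
  qed
  ultimately show "Dcomp \<phi> \<zeta> \<zeta> \<zeta> \<in> \<real>" "Re (Dcomp \<phi> \<zeta> \<zeta> \<zeta>) \<ge> 0"
    using boundary_derivative_nonneg[OF D] by auto
qed

text \<open>If the denominator vanishes at \<open>\<zeta>\<close>, division by zero makes the value there \<open>0\<close>, while along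
  the radius the map is constant.\<close>

lemma lf_selfmap_radial_limit:
  fixes \<psi> :: "complex ^ 'n \<Rightarrow> complex ^ 'n"
  assumes \<psi>: "lf_selfmap \<psi>" and \<zeta>: "norm \<zeta> = 1" and nfix: "\<psi> \<zeta> \<noteq> \<zeta>"
    and r: "\<And>k. 0 \<le> r k" "\<And>k. r k < 1" "r \<longlonglongrightarrow> 1"
  shows "\<exists>q. q \<noteq> 1 \<and> (\<lambda>k. cinner (\<psi> (r k *\<^sub>R \<zeta>)) \<zeta>) \<longlonglongrightarrow> q"
proof -
  obtain A B C d where eq: "\<psi> = lin_frac A B C d" and nz: "\<And>z. norm z < 1 \<Longrightarrow> cinner z C + d \<noteq> 0"
    using \<psi> unfolding lf_selfmap_def by auto
  have val: "\<psi> (r k *\<^sub>R \<zeta>) = inverse (of_real (r k) * cinner \<zeta> C + d) *s (r k *\<^sub>R (A *v \<zeta>) + B)" for k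
    by (simp add: eq lin_frac_def cinner_scaleR_left matrix_vector_mult_scaleR_complex inverse_eq_divide)
  have in_ball: "norm (\<psi> (r k *\<^sub>R \<zeta>)) < 1" for k
    using r(1)[of k] r(2)[of k] \<zeta> by (intro lf_selfmap_ball[OF \<psi>]) simp
  show ?thesis
  proof (cases "cinner \<zeta> C + d = 0")
    case False
    have "(\<lambda>k. inverse (of_real (r k) * cinner \<zeta> C + d)) \<longlonglongrightarrow> inverse (of_real 1 * cinner \<zeta> C + d)"
      using False by (intro tendsto_intros r(3)) auto
    moreover have "(\<lambda>k. r k *\<^sub>R (A *v \<zeta>) + B) \<longlonglongrightarrow> 1 *\<^sub>R (A *v \<zeta>) + B"
      by (intro tendsto_intros r(3))
    ultimately have "(\<lambda>k. \<psi> (r k *\<^sub>R \<zeta>)) \<longlonglongrightarrow> inverse (of_real 1 * cinner \<zeta> C + d) *s (1 *\<^sub>R (A *v \<zeta>) + B)"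
      unfolding val by (rule bounded_bilinear.tendsto[OF bounded_bilinear_smult])
    also have "inverse (of_real 1 * cinner \<zeta> C + d) *s (1 *\<^sub>R (A *v \<zeta>) + B) = \<psi> \<zeta>"
      by (simp add: eq lin_frac_def inverse_eq_divide)
    finally have lim: "(\<lambda>k. \<psi> (r k *\<^sub>R \<zeta>)) \<longlonglongrightarrow> \<psi> \<zeta>" .
    have le: "norm (\<psi> \<zeta>) \<le> 1"
      using tendsto_norm[OF lim] by (rule LIMSEQ_le_const2) (use in_ball less_imp_le in blast)
    \<comment> \<open>Equality case of Cauchy-Schwarz: a vector of norm at most 1 whose inner
      product with the unit vector \<open>\<zeta>\<close> is 1 must be
      \<open>\<zeta>\<close>.\<close>
    have "cinner (\<psi> \<zeta>) \<zeta> \<noteq> 1"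
    proof
      assume "cinner (\<psi> \<zeta>) \<zeta> = 1"
      then have "\<psi> \<zeta> \<bullet> \<zeta> = 1" by (simp flip: Re_cinner)
      then have "(norm (\<psi> \<zeta> - \<zeta>))\<^sup>2 = (norm (\<psi> \<zeta>))\<^sup>2 - 1"
        using \<zeta> unfolding power2_norm_eq_inner norm_eq_1
        by (simp add: inner_diff_left inner_diff_right inner_commute[of \<zeta> "\<psi> \<zeta>"])
      also have "\<dots> \<le> 0" using le by (simp add: abs_square_le_1)
      finally show False using nfix by simp
    qed
    moreover have "(\<lambda>k. cinner (\<psi> (r k *\<^sub>R \<zeta>)) \<zeta>) \<longlonglongrightarrow> cinner (\<psi> \<zeta>) \<zeta>"
      by (rule bounded_linear.tendsto[OF bounded_linear_cinner lim])
    ultimately show ?thesis by blast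
  next
    case True
    then have d: "d = - cinner \<zeta> C" by (simp add: add_eq_0_iff)
    have \<zeta>C: "cinner \<zeta> C \<noteq> 0" using nz[of 0] d by (auto simp: cinner_def)
    \<comment> \<open>Along the radius the values lie in the ball, so the numerator is bounded by
      the denominator, which tends to 0. Hence the numerator vanishes at \<open>\<zeta>\<close> too,
      and both carry the same factor \<open>r - 1\<close>.\<close>
    have num: "A *v \<zeta> + B = 0"
    proof -
      have "(\<lambda>k. norm (r k *\<^sub>R (A *v \<zeta>) + B)) \<longlonglongrightarrow> norm (1 *\<^sub>R (A *v \<zeta>) + B)"
        by (intro tendsto_intros r(3))
      moreover have "(\<lambda>k. norm (r k *\<^sub>R (A *v \<zeta>) + B)) \<longlonglongrightarrow> 0"
      proof (rule tendsto_sandwich[of "\<lambda>_. 0" _ _ "\<lambda>k. cmod (of_real (r k) * cinner \<zeta> C + d)"])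
        have "(\<lambda>k. cmod (of_real (r k) * cinner \<zeta> C + d)) \<longlonglongrightarrow> cmod (of_real 1 * cinner \<zeta> C + d)"
          by (intro tendsto_intros r(3))
        then show "(\<lambda>k. cmod (of_real (r k) * cinner \<zeta> C + d)) \<longlonglongrightarrow> 0" using True by simp
        have "norm (r k *\<^sub>R (A *v \<zeta>) + B) \<le> cmod (of_real (r k) * cinner \<zeta> C + d)" for k
        proof -
          have "of_real (r k) * cinner \<zeta> C + d \<noteq> 0"
            using nz[of "r k *\<^sub>R \<zeta>"] r(1)[of k] r(2)[of k] \<zeta> by (simp add: cinner_scaleR_left)
          then have "0 < cmod (of_real (r k) * cinner \<zeta> C + d)" by simp
          moreover have "inverse (cmod (of_real (r k) * cinner \<zeta> C + d)) * norm (r k *\<^sub>R (A *v \<zeta>) + B) < 1"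
            using in_ball[of k] unfolding val norm_smult_complex norm_inverse .
          ultimately show ?thesis by (simp add: divide_simps inverse_eq_divide)
        qed
        then show "\<forall>\<^sub>F k in sequentially. norm (r k *\<^sub>R (A *v \<zeta>) + B) \<le> cmod (of_real (r k) * cinner \<zeta> C + d)"
          by simp
      qed auto
      ultimately have "norm (1 *\<^sub>R (A *v \<zeta>) + B) = 0" by (rule LIMSEQ_unique)
      then show ?thesis by simp
    qed
    have "cinner (\<psi> (r k *\<^sub>R \<zeta>)) \<zeta> = cinner (\<psi> 0) \<zeta>" for k
    proof -
      have B: "cinner B \<zeta> = - cinner (A *v \<zeta>) \<zeta>"
        using arg_cong[OF num, of "\<lambda>x. cinner x \<zeta>"] 
        by (simp add: cinner_add_left cinner_def[of 0] add_eq_0_iff)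
      have nz1: "of_real (r k) - 1 \<noteq> (0::complex)"
        using r(2)[of k] by (metis eq_iff_diff_eq_0 less_irrefl of_real_eq_1_iff)
      have "cinner (\<psi> (of_real (r k) *s \<zeta>)) \<zeta>
          = ((of_real (r k) - 1) * cinner (A *v \<zeta>) \<zeta>) / ((of_real (r k) - 1) * cinner \<zeta> C)"
        unfolding eq lin_frac_slice by (simp add: d B left_diff_distrib)
      also have "\<dots> = cinner (\<psi> (0 *s \<zeta>)) \<zeta>"
        unfolding eq lin_frac_slice using nz1 by (simp add: d B)
      finally show ?thesis by (simp add: smult_of_real)
    qed
    moreover have "cinner (\<psi> 0) \<zeta> \<noteq> 1"
      using norm_cinner_le[OF \<zeta>, of "\<psi> 0"] lf_selfmap_ball[OF \<psi>, of 0] by auto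
    ultimately show ?thesis by (intro exI[of _ "cinner (\<psi> 0) \<zeta>"]) simp
  qed
qed


text \<open>A positive real factor passes through the principal branch, since
  \<open>Ln (Y / t) = Ln Y - ln t\<close> for \<open>t > 0\<close>. The weighted value thus becomes
  a power of a quotient that resembles a difference quotient.\<close>

lemma kernel_fun_weighted:
  assumes r: "0 \<le> r" "r < 1" and X: "1 - of_real r * cinner z \<zeta> \<noteq> 0"
  shows "of_real ((1 - r\<^sup>2) powr (s / 2)) * kernel_fun s \<zeta> r z
    = ((1 - of_real r * cinner z \<zeta>) / of_real (1 - r\<^sup>2)) powr (- of_real s)"
proof -
  define t where "t = 1 - r\<^sup>2"
  define Y where "Y = 1 - of_real r * cinner z \<zeta>"
  have t: "t > 0" using r by (simp add: t_def abs_square_less_1)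
  have Y: "Y \<noteq> 0" using X by (simp add: Y_def)
  have "of_real (t powr (s / 2)) * (of_real (t powr (s / 2)) * Y powr (- of_real s))
    = of_real (t powr s) * Y powr (- of_real s)"
    by (simp add: mult.assoc[symmetric] flip: of_real_mult powr_add)
  also have "\<dots> = exp (of_real s * of_real (ln t)) * exp (- of_real s * Ln Y)"
    using t Y by (simp add: powr_def exp_of_real[symmetric])
  also have "\<dots> = exp (- of_real s * (Ln Y - of_real (ln t)))"
    by (simp add: algebra_simps flip: exp_add)
  also have "\<dots> = (Y / of_real t) powr (- of_real s)"
    using t Y by (simp add: powr_def Ln_divide_of_real)
  finally show ?thesis by (simp add: kernel_fun_def t_def Y_def)
qed

text \<open>The base of the power is \<open>1 - w u(w)\<close> at \<open>w = r\<close>, divided by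
  \<open>1 - r^2\<close>, with \<open>u\<close> the slice function. The numerator vanishes at 1 with
  derivative \<open>- (1 + a)\<close>, so the quotient tends to \<open>(1 + a) / 2\<close>, which is
  positive and hence a point of continuity of the principal power.\<close>

lemma kernel_fun_radial_limit:
  fixes \<phi> :: "complex ^ 'n \<Rightarrow> complex ^ 'n"
  assumes \<phi>: "lf_selfmap \<phi>" and \<zeta>: "norm \<zeta> = 1" and fix\<zeta>: "\<phi> \<zeta> = \<zeta>"
    and r: "\<And>k. 0 \<le> r k" "\<And>k. r k < 1" "r \<longlonglongrightarrow> 1"
  shows "(\<lambda>k. of_real ((1 - (r k)\<^sup>2) powr (s / 2)) * kernel_fun s \<zeta> (r k) (\<phi> (r k *\<^sub>R \<zeta>)))
     \<longlonglongrightarrow> of_real (((1 + Re (Dcomp \<phi> \<zeta> \<zeta> \<zeta>)) / 2) powr (- s))"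
proof -
  define a where "a = Re (Dcomp \<phi> \<zeta> \<zeta> \<zeta>)"
  have a: "a \<ge> 0" and Da: "Dcomp \<phi> \<zeta> \<zeta> \<zeta> = of_real a"
    using lf_selfmap_boundary_derivative(2,3)[OF \<phi> \<zeta> fix\<zeta>] by (simp_all add: a_def)
  define g where "g w = 1 - w * cinner (\<phi> (w *s \<zeta>)) \<zeta>" for w
  have u1: "cinner (\<phi> (1 *s \<zeta>)) \<zeta> = 1" using fix\<zeta> \<zeta> by (simp add: cinner_self)
  have "(g has_field_derivative (0 - (1 * cinner (\<phi> (1 *s \<zeta>)) \<zeta> + of_real a * 1))) (at 1)"
    unfolding g_def Da[symmetric]
    by (intro derivative_intros lf_selfmap_boundary_derivative(1)[OF \<phi> \<zeta> fix\<zeta>])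
  then have g': "((\<lambda>w. (g w - g 1) / (w - 1)) \<longlongrightarrow> - (1 + of_real a)) (at 1)"
    unfolding u1 by (simp add: has_field_derivative_iff)
  have "filterlim (\<lambda>k. complex_of_real (r k)) (at 1) sequentially"
    unfolding filterlim_at using r(3) r(2) tendsto_of_real[OF r(3), where 'a = complex]
    by (auto simp: less_le)
  from filterlim_compose[OF g' this]
  have 1: "(\<lambda>k. (g (of_real (r k)) - g 1) / (of_real (r k) - 1)) \<longlonglongrightarrow> - (1 + of_real a)" .
  \<comment> \<open>The factor \<open>- 1 / (1 + r)\<close> turns the denominator
    \<open>r - 1\<close> of the difference quotient into \<open>1 - r^2\<close>.\<close>
  have "(\<lambda>k. (g (of_real (r k)) - g 1) / (of_real (r k) - 1) * (- 1 / (1 + of_real (r k)))) \<longlonglongrightarrow> - (1 + of_real a) * (- 1 / (1 + of_real 1))"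
    by (intro tendsto_intros 1 r(3)) auto
  moreover have "(g (of_real (r k)) - g 1) / (of_real (r k) - 1) * (- 1 / (1 + of_real (r k)))
      = (1 - of_real (r k) * cinner (\<phi> (r k *\<^sub>R \<zeta>)) \<zeta>) / of_real (1 - (r k)\<^sup>2)" for k
  proof -
    have "g 1 = 0" using u1 by (simp add: g_def)
    have "complex_of_real (1 - (r k)\<^sup>2) = - ((of_real (r k) - 1) * (1 + of_real (r k)))"
      by (simp add: power2_eq_square algebra_simps)
    then show ?thesis unfolding \<open>g 1 = 0\<close> by (simp add: g_def smult_of_real)
  qed
  moreover have half: "- (1 + of_real a) * (- 1 / (1 + of_real 1)) = complex_of_real ((1 + a) / 2)"
    by (simp add: complex_eq_iff field_simps)
  ultimately have lim: "(\<lambda>k. (1 - of_real (r k) * cinner (\<phi> (r k *\<^sub>R \<zeta>)) \<zeta>) / of_real (1 - (r k)\<^sup>2)) \<longlonglongrightarrow> of_real ((1 + a) / 2)"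
    by (simp only: half)
  have np: "complex_of_real ((1 + a) / 2) \<notin> \<real>\<^sub>\<le>\<^sub>0" using a by (simp add: complex_nonpos_Reals_iff)
  have "(\<lambda>k. ((1 - of_real (r k) * cinner (\<phi> (r k *\<^sub>R \<zeta>)) \<zeta>) / of_real (1 - (r k)\<^sup>2)) powr (- of_real s))
      \<longlonglongrightarrow> of_real ((1 + a) / 2) powr (- of_real s)"
    by (rule tendsto_powr_complex[OF np lim tendsto_const])
  moreover have "of_real ((1 - (r k)\<^sup>2) powr (s / 2)) * kernel_fun s \<zeta> (r k) (\<phi> (r k *\<^sub>R \<zeta>))
      = ((1 - of_real (r k) * cinner (\<phi> (r k *\<^sub>R \<zeta>)) \<zeta>) / of_real (1 - (r k)\<^sup>2)) powr (- of_real s)" for k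
  proof (rule kernel_fun_weighted[OF r(1,2)])
    have "norm (\<phi> (r k *\<^sub>R \<zeta>)) < 1"
      using r(1)[of k] r(2)[of k] \<zeta> by (intro lf_selfmap_ball[OF \<phi>]) simp
    then have "Re (1 - of_real (r k) * cinner (\<phi> (r k *\<^sub>R \<zeta>)) \<zeta>) > 0"
      using Re_one_minus_cinner(2)[OF \<zeta>] r(1)[of k] r(2)[of k] by (simp add: less_imp_le)
    then show "1 - of_real (r k) * cinner (\<phi> (r k *\<^sub>R \<zeta>)) \<zeta> \<noteq> 0"
      by (metis less_irrefl zero_complex.sel(1))
  qed
  moreover have "complex_of_real ((1 + a) / 2) powr (- of_real s) = of_real (((1 + a) / 2) powr (- s))"
    using a by (subst powr_of_real[symmetric]) auto
  ultimately show ?thesis unfolding a_def by simp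
qed

text \<open>Here the base \<open>1 - r * cinner (\<psi> (r *\<^sub>R \<zeta>)) \<zeta>\<close> has
  the nonzero limit \<open>1 - q\<close>, so its power stays bounded while the two factors
  \<open>(1 - r^2) powr (s / 2)\<close> tend to 0.\<close>

lemma kernel_fun_radial_limit_zero:
  fixes \<psi> :: "complex ^ 'n \<Rightarrow> complex ^ 'n"
  assumes \<psi>: "lf_selfmap \<psi>" and \<zeta>: "norm \<zeta> = 1" and nfix: "\<psi> \<zeta> \<noteq> \<zeta>" and s: "s > 0"
    and r: "\<And>k. 0 \<le> r k" "\<And>k. r k < 1" "r \<longlonglongrightarrow> 1"
  shows "(\<lambda>k. of_real ((1 - (r k)\<^sup>2) powr (s / 2)) * kernel_fun s \<zeta> (r k) (\<psi> (r k *\<^sub>R \<zeta>))) \<longlonglongrightarrow> 0"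
proof -
  obtain q where q: "q \<noteq> 1" "(\<lambda>k. cinner (\<psi> (r k *\<^sub>R \<zeta>)) \<zeta>) \<longlonglongrightarrow> q"
    using lf_selfmap_radial_limit[OF \<psi> \<zeta> nfix r] by blast
  define X where "X k = 1 - of_real (r k) * cinner (\<psi> (r k *\<^sub>R \<zeta>)) \<zeta>" for k
  have "X \<longlonglongrightarrow> 1 - of_real 1 * q"
    unfolding X_def by (intro tendsto_intros r(3) q(2))
  then have "(\<lambda>k. cmod (X k) powr (- s)) \<longlonglongrightarrow> cmod (1 - of_real 1 * q) powr (- s)"
    by (rule tendsto_powr[OF tendsto_norm tendsto_const]) (use q(1) in simp)
  moreover have W: "(\<lambda>k. (1 - (r k)\<^sup>2) powr (s / 2)) \<longlonglongrightarrow> 0"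
  proof (rule tendsto_zero_powrI[where b = "s / 2"])
    have "(\<lambda>k. 1 - (r k)\<^sup>2) \<longlonglongrightarrow> 1 - 1\<^sup>2" by (intro tendsto_intros r(3))
    then show "(\<lambda>k. 1 - (r k)\<^sup>2) \<longlonglongrightarrow> 0" by simp
    show "\<forall>\<^sub>F k in sequentially. 0 \<le> 1 - (r k)\<^sup>2"
      using r(1,2) by (intro always_eventually) (simp add: abs_square_le_1 less_imp_le)
  qed (use s in auto)
  ultimately have lim0: "(\<lambda>k. (1 - (r k)\<^sup>2) powr (s / 2) * ((1 - (r k)\<^sup>2) powr (s / 2) * cmod (X k) powr (- s)))
      \<longlonglongrightarrow> 0 * (0 * cmod (1 - of_real 1 * q) powr (- s))"
    by (intro tendsto_mult)
  have norm_eq: "cmod (of_real ((1 - (r k)\<^sup>2) powr (s / 2)) * kernel_fun s \<zeta> (r k) (\<psi> (r k *\<^sub>R \<zeta>)))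
     = (1 - (r k)\<^sup>2) powr (s / 2) * ((1 - (r k)\<^sup>2) powr (s / 2) * cmod (X k) powr (- s))" for k
    unfolding kernel_fun_def norm_mult X_def by (subst norm_powr_real_powr') auto
  show ?thesis
    by (rule tendsto_norm_zero_cancel) (use lim0 in \<open>simp only: norm_eq mult_zero_left\<close>)
qed

section \<open>Non-compactness\<close>

text \<open>Abstracts from how the squared norm arises, as an integral for Bergman and a supremum of
  integrals for Hardy. It records a growth estimate, unit bounds for the kernel functions, and two
  finiteness tools.\<close>

locale kernel_space =
  fixes sq :: "(complex ^ 'n \<Rightarrow> complex) \<Rightarrow> ennreal" and s :: real and \<zeta> :: "complex ^ 'n"
  assumes s: "s > 0" and \<zeta>: "norm \<zeta> = 1"
    and value_le: "\<And>f r. holo_ball f \<Longrightarrow> 0 \<le> r \<Longrightarrow> r < 1 \<Longrightarrow>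
      ennreal ((cmod (f (r *\<^sub>R \<zeta>)))\<^sup>2) \<le> ennreal ((1 - r\<^sup>2) powr (- s)) * sq f"
    and kernel_le: "\<And>r. 0 \<le> r \<Longrightarrow> r < 1 \<Longrightarrow> sq (kernel_fun s \<zeta> r) \<le> 1"
    and diff_le: "\<And>f g. holo_ball f \<Longrightarrow> holo_ball g \<Longrightarrow> sq (f - g) \<le> 2 * sq f + 2 * sq g"
    and bounded_le: "\<And>f B. holo_ball f \<Longrightarrow> (\<And>z. norm z < 1 \<Longrightarrow> cmod (f z) \<le> B) \<Longrightarrow> sq f \<le> ennreal (B\<^sup>2)"
begin

definition nrm :: "(complex ^ 'n \<Rightarrow> complex) \<Rightarrow> real" where
  "nrm f = sqrt (enn2real (sq f))"

lemma weighted_value_le: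
  assumes f: "holo_ball f" and fin: "sq f < \<infinity>" and r: "0 \<le> r" "r < 1"
  shows "(1 - r\<^sup>2) powr (s / 2) * cmod (f (r *\<^sub>R \<zeta>)) \<le> nrm f"
proof -
  obtain S where S: "sq f = ennreal S" "S \<ge> 0" using fin by (cases "sq f") auto
  have t: "1 - r\<^sup>2 > 0" using r by (simp add: abs_square_less_1)
  have "ennreal ((cmod (f (r *\<^sub>R \<zeta>)))\<^sup>2) \<le> ennreal ((1 - r\<^sup>2) powr (- s) * S)"
    using value_le[OF f r] S by (simp add: ennreal_mult)
  then have *: "(cmod (f (r *\<^sub>R \<zeta>)))\<^sup>2 \<le> (1 - r\<^sup>2) powr (- s) * S"
    using S by (simp add: ennreal_le_iff)
  have "((1 - r\<^sup>2) powr (s / 2) * cmod (f (r *\<^sub>R \<zeta>)))\<^sup>2 = (1 - r\<^sup>2) powr s * (cmod (f (r *\<^sub>R \<zeta>)))\<^sup>2"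
    by (simp add: power_mult_distrib power2_eq_square[of "_ powr _"] flip: powr_add)
  also have "\<dots> \<le> (1 - r\<^sup>2) powr s * ((1 - r\<^sup>2) powr (- s) * S)"
    using * by (intro mult_left_mono) auto
  also have "\<dots> = S" using t by (simp add: mult.assoc[symmetric] flip: powr_add)
  finally show ?thesis unfolding nrm_def S(1) using S(2) by (simp add: real_le_rsqrt)
qed

theorem comp_op_diff_not_compact:
  assumes \<phi>: "lf_selfmap \<phi>" and \<psi>: "lf_selfmap \<psi>" and fix\<zeta>: "\<phi> \<zeta> = \<zeta>"
    and data: "\<psi> \<zeta> \<noteq> \<zeta> \<or> (\<psi> \<zeta> = \<zeta> \<and> Dcomp \<phi> \<zeta> \<zeta> \<zeta> \<noteq> Dcomp \<psi> \<zeta> \<zeta> \<zeta>)"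
  shows "\<not> compact_op {f. holo_ball f \<and> sq f < \<infinity>} nrm (\<lambda>f. comp_op \<phi> f - comp_op \<psi> f)"
proof
  define T where "T f = comp_op \<phi> f - comp_op \<psi> f" for f :: "complex ^ 'n \<Rightarrow> complex"
  assume "compact_op {f. holo_ball f \<and> sq f < \<infinity>} nrm (\<lambda>f. comp_op \<phi> f - comp_op \<psi> f)"
  then have compact: "compact_op {f. holo_ball f \<and> sq f < \<infinity>} nrm T"
    by (simp add: T_def[abs_def])
  define r where "r k = 1 - 1 / real (k + 2)" for k :: nat
  have r: "0 \<le> r k" "r k < 1" for k by (auto simp: r_def)
  have r_lim: "r \<longlonglongrightarrow> 1"
  proof -
    have "(\<lambda>k. 1 - inverse (real (k + 2))) \<longlonglongrightarrow> 1 - 0"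
      by (intro tendsto_intros LIMSEQ_ignore_initial_segment[OF LIMSEQ_inverse_real_of_nat[unfolded filterlim_sequentially_Suc[of "\<lambda>n. inverse (real n)"]]])
    then show ?thesis by (simp add: r_def[abs_def] inverse_eq_divide)
  qed
  define F where "F k = kernel_fun s \<zeta> (r k)" for k
  have F: "holo_ball (F k)" for k
    unfolding F_def using holo_ball_kernel_fun[OF \<zeta>] r by blast
  have F_sq: "sq (F k) \<le> 1" for k unfolding F_def using kernel_le r by blast
  then have F_fin: "sq (F k) < \<infinity>" for k
    by (metis ennreal_one_less_top infinity_ennreal_def order_le_less_trans)
  have F_nrm: "nrm (F k) \<le> 1" for k
  proof -
    have "enn2real (sq (F k)) \<le> 1" using F_sq by (simp add: enn2real_leI)
    then show ?thesis by (simp add: nrm_def)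
  qed
  obtain \<sigma> g where \<sigma>: "strict_mono \<sigma>" and g: "holo_ball g" "sq g < \<infinity>"
    and lim: "(\<lambda>k. nrm (T (F (\<sigma> k)) - g)) \<longlonglongrightarrow> 0"
    using compact[unfolded compact_op_def, rule_format, of F 1] F F_fin F_nrm by auto
  define R where "R k = r (\<sigma> k)" for k
  have R: "0 \<le> R k" "R k < 1" for k using r by (auto simp: R_def)
  have R_lim: "R \<longlonglongrightarrow> 1"
    unfolding R_def using LIMSEQ_subseq_LIMSEQ[OF r_lim \<sigma>] by (simp add: o_def)
  define W where "W k = (1 - (R k)\<^sup>2) powr (s / 2)" for k
  have W: "W k \<ge> 0" for k by (simp add: W_def)
  have W_lim: "W \<longlonglongrightarrow> 0"
    unfolding W_def
  proof (rule tendsto_zero_powrI[where b = "s / 2"])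
    have "(\<lambda>k. 1 - (R k)\<^sup>2) \<longlonglongrightarrow> 1 - 1\<^sup>2" by (intro tendsto_intros R_lim)
    then show "(\<lambda>k. 1 - (R k)\<^sup>2) \<longlonglongrightarrow> 0" by simp
    show "\<forall>\<^sub>F k in sequentially. 0 \<le> 1 - (R k)\<^sup>2"
      using R by (intro always_eventually) (simp add: abs_square_le_1 less_imp_le)
  qed (use s in auto)
  \<comment> \<open>\<open>B k\<close> is finite for each \<open>k\<close> but may grow with
    \<open>k\<close>; below it is used only for a fixed index.\<close>
  define B where "B k = (1 - (r k)\<^sup>2) powr (s / 2) * (1 - r k) powr (- s)" for k
  have F_bd: "cmod (F k z) \<le> B k" if "norm z < 1" for k z
    unfolding F_def B_def using kernel_fun_bounded[OF \<zeta> r s that] .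
  have TF: "holo_ball (T (F k))" for k
    unfolding T_def by (intro holo_ball_diff holo_ball_comp_op \<phi> \<psi> F)
  have TF_bd: "cmod (T (F k) z) \<le> 2 * B k" if "norm z < 1" for k z
  proof -
    have "cmod (T (F k) z) \<le> cmod (F k (\<phi> z)) + cmod (F k (\<psi> z))"
      by (simp add: T_def comp_op_def norm_triangle_ineq4)
    then show ?thesis
      using F_bd[OF lf_selfmap_ball[OF \<phi> that], of k] F_bd[OF lf_selfmap_ball[OF \<psi> that], of k] by linarith
  qed
  \<comment> \<open>Finiteness matters because \<open>nrm\<close> goes through
    \<open>enn2real\<close>, which sends an infinite value to 0 and would void the growth estimate.
    It holds since \<open>T (F k)\<close> is bounded on the ball.\<close>
  have diff: "holo_ball (T (F k) - g)" "sq (T (F k) - g) < \<infinity>" for k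
  proof -
    show "holo_ball (T (F k) - g)" by (intro holo_ball_diff TF g)
    have "sq (T (F k)) < \<infinity>"
      using bounded_le[OF TF TF_bd, of k] by (metis ennreal_less_top infinity_ennreal_def order_le_less_trans)
    then have "2 * sq (T (F k)) + 2 * sq g < \<infinity>" using g(2) by (simp add: ennreal_mult_less_top)
    then show "sq (T (F k) - g) < \<infinity>"
      using diff_le[OF TF g(1), of k] by (rule order_le_less_trans[rotated])
  qed
  define A where "A k = complex_of_real (W k) * T (F (\<sigma> k)) (R k *\<^sub>R \<zeta>)" for k
  define \<epsilon> where "\<epsilon> k = nrm (T (F (\<sigma> k)) - g)" for k
  have close: "W k * cmod (T (F (\<sigma> l)) (R k *\<^sub>R \<zeta>) - g (R k *\<^sub>R \<zeta>)) \<le> \<epsilon> l" for k l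
    using weighted_value_le[OF diff(1)[of "\<sigma> l"] diff(2)[of "\<sigma> l"] R[of k]] by (simp add: W_def \<epsilon>_def)
  \<comment> \<open>Two indices: at the radius \<open>R k\<close>, the images of both
    \<open>F (\<sigma> k)\<close> and \<open>F (\<sigma> l)\<close> are compared with
    \<open>g\<close>, and the second is bounded independently of \<open>k\<close>.\<close>
  have A_le: "cmod (A k) \<le> \<epsilon> k + \<epsilon> l + W k * (2 * B (\<sigma> l))" for k l
  proof -
    let ?z = "R k *\<^sub>R \<zeta>"
    have z: "norm ?z < 1" using R[of k] \<zeta> by simp
    have "cmod (T (F (\<sigma> k)) ?z) \<le> cmod (T (F (\<sigma> k)) ?z - g ?z) + cmod (T (F (\<sigma> l)) ?z - g ?z) + cmod (T (F (\<sigma> l)) ?z)"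
      by norm
    then have "W k * cmod (T (F (\<sigma> k)) ?z) \<le> W k * (cmod (T (F (\<sigma> k)) ?z - g ?z) + cmod (T (F (\<sigma> l)) ?z - g ?z) + cmod (T (F (\<sigma> l)) ?z))"
      using W by (rule mult_left_mono)
    also have "\<dots> = W k * cmod (T (F (\<sigma> k)) ?z - g ?z) + W k * cmod (T (F (\<sigma> l)) ?z - g ?z) + W k * cmod (T (F (\<sigma> l)) ?z)"
      by (simp add: algebra_simps)
    also have "\<dots> \<le> \<epsilon> k + \<epsilon> l + W k * (2 * B (\<sigma> l))"
      using close[of k k] close[of k l] mult_left_mono[OF TF_bd[OF z, of "\<sigma> l"] W[of k]] by linarith
    finally show ?thesis using W[of k] by (simp add: A_def norm_mult)
  qed
  obtain c where c: "c \<noteq> 0" "A \<longlonglongrightarrow> c"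
  proof -
    let ?p = "\<lambda>\<theta>. ((1 + Re (Dcomp \<theta> \<zeta> \<zeta> \<zeta>)) / 2) powr (- s)"
    have A_eq: "A = (\<lambda>k. of_real ((1 - (R k)\<^sup>2) powr (s / 2)) * kernel_fun s \<zeta> (R k) (\<phi> (R k *\<^sub>R \<zeta>))
        - of_real ((1 - (R k)\<^sup>2) powr (s / 2)) * kernel_fun s \<zeta> (R k) (\<psi> (R k *\<^sub>R \<zeta>)))"
      by (simp add: A_def T_def comp_op_def F_def W_def R_def fun_eq_iff right_diff_distrib)
    have \<phi>_lim: "(\<lambda>k. of_real ((1 - (R k)\<^sup>2) powr (s / 2)) * kernel_fun s \<zeta> (R k) (\<phi> (R k *\<^sub>R \<zeta>))) \<longlonglongrightarrow> of_real (?p \<phi>)"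
      by (rule kernel_fun_radial_limit[OF \<phi> \<zeta> fix\<zeta> R R_lim])
    note Re\<phi> = lf_selfmap_boundary_derivative(2,3)[OF \<phi> \<zeta> fix\<zeta>]
    show thesis
    proof (cases "\<psi> \<zeta> = \<zeta>")
      case False
      have "A \<longlonglongrightarrow> of_real (?p \<phi>) - 0"
        unfolding A_eq by (intro tendsto_diff \<phi>_lim kernel_fun_radial_limit_zero[OF \<psi> \<zeta> False s R R_lim])
      moreover have "of_real (?p \<phi>) - 0 \<noteq> (0::complex)" using Re\<phi> by simp
      ultimately show thesis using that by blast
    next
      case True
      note Re\<psi> = lf_selfmap_boundary_derivative(2,3)[OF \<psi> \<zeta> True]
      have ne: "?p \<phi> \<noteq> ?p \<psi>"
      proof
        assume "?p \<phi> = ?p \<psi>"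
        \<comment> \<open>The exponent \<open>- 1 / s\<close> undoes \<open>- s\<close> on the
          positive base \<open>(1 + a) / 2\<close>.\<close>
        then have "?p \<phi> powr (- 1 / s) = ?p \<psi> powr (- 1 / s)" by simp
        then have "Re (Dcomp \<phi> \<zeta> \<zeta> \<zeta>) = Re (Dcomp \<psi> \<zeta> \<zeta> \<zeta>)"
          using s Re\<phi>(2) Re\<psi>(2) by (simp add: powr_powr)
        then have "Dcomp \<phi> \<zeta> \<zeta> \<zeta> = Dcomp \<psi> \<zeta> \<zeta> \<zeta>"
          using Re\<phi>(1) Re\<psi>(1) by (metis of_real_Re)
        then show False using data True by blast
      qed
      have "A \<longlonglongrightarrow> of_real (?p \<phi>) - of_real (?p \<psi>)"
        unfolding A_eq by (intro tendsto_diff \<phi>_lim kernel_fun_radial_limit[OF \<psi> \<zeta> True R R_lim])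
      moreover have "complex_of_real (?p \<phi>) - of_real (?p \<psi>) \<noteq> 0"
        using ne by (simp only: right_minus_eq of_real_eq_iff not_False_eq_True)
      ultimately show thesis using that by blast
    qed
  qed
  have \<epsilon>_lim: "\<epsilon> \<longlonglongrightarrow> 0" using lim by (simp add: \<epsilon>_def[abs_def])
  \<comment> \<open>With \<open>l\<close> fixed, \<open>k\<close> tends to infinity: the weight
    \<open>W k\<close> kills the fixed bound and leaves the error \<open>\<epsilon> l\<close>.
    Afterwards \<open>l\<close> tends to infinity.\<close>
  have "cmod c \<le> \<epsilon> l" for l
  proof (rule LIMSEQ_le)
    show "(\<lambda>k. cmod (A k)) \<longlonglongrightarrow> cmod c" by (intro tendsto_norm c(2))
    have "(\<lambda>k. \<epsilon> k + \<epsilon> l + W k * (2 * B (\<sigma> l))) \<longlonglongrightarrow> 0 + \<epsilon> l + 0 * (2 * B (\<sigma> l))"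
      by (intro tendsto_intros \<epsilon>_lim W_lim)
    then show "(\<lambda>k. \<epsilon> k + \<epsilon> l + W k * (2 * B (\<sigma> l))) \<longlonglongrightarrow> \<epsilon> l" by simp
  qed (use A_le in blast)
  then have "cmod c \<le> 0"
    by (intro LIMSEQ_le_const[OF \<epsilon>_lim]) blast
  then show False using c(1) by simp
qed

end

section \<open>Verification for the Bergman and Hardy spaces\<close>

lemma kernel_space_bergman:
  fixes \<zeta> :: "complex ^ 'n"
  assumes \<alpha>: "\<alpha> > -1" and \<zeta>: "norm \<zeta> = 1"
  shows "kernel_space (bergman_sq \<alpha>) (real CARD('n) + \<alpha> + 1) \<zeta>"
proof -
  define s where "s = real CARD('n) + \<alpha> + 1"
  have s: "s > 0" using \<alpha> by (simp add: s_def add_pos_pos)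
  interpret invariant_ball_measure "bergman_measure \<alpha> :: (complex ^ 'n) measure"
    by (rule invariant_ball_measure_bergman[OF \<alpha>])
  note moment = bergman_moment[OF \<zeta> \<alpha>, folded s_def]
  show ?thesis
    unfolding s_def[symmetric]
  proof
    fix f :: "complex ^ 'n \<Rightarrow> complex" and r :: real
    assume f: "holo_ball f" and r: "0 \<le> r" "r < 1"
    show "ennreal ((cmod (f (r *\<^sub>R \<zeta>)))\<^sup>2) \<le> ennreal ((1 - r\<^sup>2) powr (- s)) * bergman_sq \<alpha> f"
      unfolding bergman_sq_eq[OF \<alpha> f]
      by (rule holo_ball_value_le[OF s r \<zeta> f], rule slice_coeff_partial_moments_le[OF f \<zeta> moment])
         (use s in \<open>simp add: pochhammer_nonneg\<close>)
  next
    fix r :: real assume r: "0 \<le> r" "r < 1"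
    show "bergman_sq \<alpha> (kernel_fun s \<zeta> r) \<le> 1"
      unfolding bergman_sq_eq[OF \<alpha> holo_ball_kernel_fun[OF \<zeta> r]]
      by (rule kernel_fun_norm_le[OF s r \<zeta>]) (simp add: moment)
  next
    fix f g :: "complex ^ 'n \<Rightarrow> complex" assume fg: "holo_ball f" "holo_ball g"
    show "bergman_sq \<alpha> (f - g) \<le> 2 * bergman_sq \<alpha> f + 2 * bergman_sq \<alpha> g"
      unfolding bergman_sq_eq[OF \<alpha> fg(1)] bergman_sq_eq[OF \<alpha> fg(2)] bergman_sq_eq[OF \<alpha> holo_ball_diff[OF fg]]
      by (rule nn_integral_square_diff_le[OF fg])
  next
    fix f :: "complex ^ 'n \<Rightarrow> complex" and B :: real
    assume "holo_ball f" "\<And>z. norm z < 1 \<Longrightarrow> cmod (f z) \<le> B"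
    then show "bergman_sq \<alpha> f \<le> ennreal (B\<^sup>2)"
      using nn_integral_square_bounded[of f B] by (simp add: bergman_sq_eq[OF \<alpha>])
  qed (use s \<zeta> in auto)
qed

text \<open>The upper bounds on the norm hold at each radius and pass to the supremum. The growth
  estimate goes the other way: the radius must tend to 1 to recover the full sphere moments.\<close>

lemma kernel_space_hardy:
  fixes \<zeta> :: "complex ^ 'n"
  assumes \<zeta>: "norm \<zeta> = 1"
  shows "kernel_space hardy_sq (real CARD('n)) \<zeta>"
proof -
  define s where "s = real CARD('n)"
  have s: "s > 0" by (simp add: s_def)
  have ibm: "invariant_ball_measure (hardy_measure \<rho> :: (complex ^ 'n) measure)" if "\<rho> \<in> {0<..<1}" for \<rho>
    using that by (intro invariant_ball_measure_hardy) auto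
  have moment: "(\<integral>\<^sup>+z. ennreal (cmod (cinner z \<zeta>) ^ (2 * n)) \<partial>hardy_measure \<rho>)
      = ennreal (\<rho> ^ (2 * n) * (fact n / pochhammer s n))" if "\<rho> \<in> {0<..<1}" for \<rho> n
    using hardy_moment[OF \<zeta>, of \<rho> n] that by (simp add: s_def)
  show ?thesis
    unfolding s_def[symmetric]
  proof
    fix f :: "complex ^ 'n \<Rightarrow> complex" and r :: real
    assume f: "holo_ball f" and r: "0 \<le> r" "r < 1"
    show "ennreal ((cmod (f (r *\<^sub>R \<zeta>)))\<^sup>2) \<le> ennreal ((1 - r\<^sup>2) powr (- s)) * hardy_sq f"
    proof (rule holo_ball_value_le[OF s r \<zeta> f])
      fix K
      let ?c = "\<lambda>n. (cmod (slice_coeff f \<zeta> n))\<^sup>2" and ?m = "\<lambda>n. fact n / pochhammer s n"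
      have le: "ennreal (\<Sum>n<K. ?c n * (\<rho> ^ (2 * n) * ?m n)) \<le> hardy_sq f" if \<rho>: "\<rho> \<in> {0<..<1}" for \<rho>
      proof -
        interpret invariant_ball_measure "hardy_measure \<rho> :: (complex ^ 'n) measure" by (rule ibm[OF \<rho>])
        have "ennreal (\<Sum>n<K. ?c n * (\<rho> ^ (2 * n) * ?m n)) \<le> (\<integral>\<^sup>+z. ennreal ((cmod (f z))\<^sup>2) \<partial>hardy_measure \<rho>)"
          by (rule slice_coeff_partial_moments_le[OF f \<zeta> moment[OF \<rho>]])
             (use s \<rho> in \<open>simp add: pochhammer_nonneg\<close>)
        also have "\<dots> \<le> hardy_sq f" unfolding hardy_sq_eq[OF f] using \<rho> by (rule SUP_upper)
        finally show ?thesis .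
      qed
      \<comment> \<open>For a finite sum the factors \<open>\<rho> ^ (2 * n)\<close> tend to 1
        together, so the bound valid for each \<open>\<rho> < 1\<close> survives in the
        limit.\<close>
      have "((\<lambda>\<rho>. \<Sum>n<K. ?c n * (\<rho> ^ (2 * n) * ?m n)) \<longlongrightarrow> (\<Sum>n<K. ?c n * (1 ^ (2 * n) * ?m n))) (at_left 1)"
        by (intro tendsto_intros)
      then have "((\<lambda>\<rho>. ennreal (\<Sum>n<K. ?c n * (\<rho> ^ (2 * n) * ?m n))) \<longlongrightarrow> ennreal (\<Sum>n<K. ?c n * ?m n)) (at_left 1)"
        using tendsto_ennrealI by fastforce
      moreover have "\<forall>\<^sub>F \<rho> in at_left (1::real). ennreal (\<Sum>n<K. ?c n * (\<rho> ^ (2 * n) * ?m n)) \<le> hardy_sq f"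
        using eventually_at_left_real[OF zero_less_one] by (rule eventually_mono) (rule le)
      ultimately show "ennreal (\<Sum>n<K. ?c n * ?m n) \<le> hardy_sq f"
        by (rule tendsto_upperbound) simp
    qed
  next
    fix r :: real assume r: "0 \<le> r" "r < 1"
    show "hardy_sq (kernel_fun s \<zeta> r) \<le> 1"
      unfolding hardy_sq_eq[OF holo_ball_kernel_fun[OF \<zeta> r]]
    proof (rule SUP_least)
      fix \<rho> :: real assume \<rho>: "\<rho> \<in> {0<..<1}"
      interpret invariant_ball_measure "hardy_measure \<rho> :: (complex ^ 'n) measure" by (rule ibm[OF \<rho>])
      show "(\<integral>\<^sup>+z. ennreal ((cmod (kernel_fun s \<zeta> r z))\<^sup>2) \<partial>hardy_measure \<rho>) \<le> 1"
      proof (rule kernel_fun_norm_le[OF s r \<zeta>])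
        fix n
        have "\<rho> ^ (2 * n) * (fact n / pochhammer s n) \<le> 1 * (fact n / pochhammer s n)"
          using \<rho> s by (intro mult_right_mono power_le_one) (auto simp: pochhammer_nonneg)
        then show "(\<integral>\<^sup>+z. ennreal (cmod (cinner z \<zeta>) ^ (2 * n)) \<partial>hardy_measure \<rho>) \<le> ennreal (fact n / pochhammer s n)"
          unfolding moment[OF \<rho>] by (intro ennreal_leI) simp
      qed
    qed
  next
    fix f g :: "complex ^ 'n \<Rightarrow> complex" assume fg: "holo_ball f" "holo_ball g"
    show "hardy_sq (f - g) \<le> 2 * hardy_sq f + 2 * hardy_sq g"
      unfolding hardy_sq_eq[OF holo_ball_diff[OF fg]]
    proof (rule SUP_least)
      fix \<rho> :: real assume \<rho>: "\<rho> \<in> {0<..<1}"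
      interpret invariant_ball_measure "hardy_measure \<rho> :: (complex ^ 'n) measure" by (rule ibm[OF \<rho>])
      have "(\<integral>\<^sup>+z. ennreal ((cmod (h z))\<^sup>2) \<partial>hardy_measure \<rho>) \<le> hardy_sq h" if "holo_ball h" for h :: "complex ^ 'n \<Rightarrow> complex"
        unfolding hardy_sq_eq[OF that] using \<rho> by (rule SUP_upper)
      then show "(\<integral>\<^sup>+z. ennreal ((cmod ((f - g) z))\<^sup>2) \<partial>hardy_measure \<rho>) \<le> 2 * hardy_sq f + 2 * hardy_sq g"
        using fg by (intro order_trans[OF nn_integral_square_diff_le[OF fg]] add_mono mult_left_mono) auto
    qed
  next
    fix f :: "complex ^ 'n \<Rightarrow> complex" and B :: real
    assume f: "holo_ball f" "\<And>z. norm z < 1 \<Longrightarrow> cmod (f z) \<le> B"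
    show "hardy_sq f \<le> ennreal (B\<^sup>2)"
      unfolding hardy_sq_eq[OF f(1)]
    proof (rule SUP_least)
      fix \<rho> :: real assume \<rho>: "\<rho> \<in> {0<..<1}"
      interpret invariant_ball_measure "hardy_measure \<rho> :: (complex ^ 'n) measure" by (rule ibm[OF \<rho>])
      show "(\<integral>\<^sup>+z. ennreal ((cmod (f z))\<^sup>2) \<partial>hardy_measure \<rho>) \<le> ennreal (B\<^sup>2)"
        by (rule nn_integral_square_bounded[OF f(2)])
    qed
  qed (use s \<zeta> in auto)
qed

theorem theorem6:
  fixes \<phi> \<psi> :: "complex ^ 'n \<Rightarrow> complex ^ 'n" and \<zeta> :: "complex ^ 'n"
  assumes "CARD('n) > 1"
    and "lf_selfmap \<phi>" and "lf_selfmap \<psi>"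
    and "norm \<zeta> = 1" and "\<phi> \<zeta> = \<zeta>"
    and "\<psi> \<zeta> \<noteq> \<zeta> \<or> (\<psi> \<zeta> = \<zeta> \<and> Dcomp \<phi> \<zeta> \<zeta> \<zeta> \<noteq> Dcomp \<psi> \<zeta> \<zeta> \<zeta>)"
  shows "\<not> compact_op hardy_space hardy_norm (\<lambda>f. comp_op \<phi> f - comp_op \<psi> f)
     \<and> (\<forall>\<alpha>>(-1). \<not> compact_op (bergman_space \<alpha>) (bergman_norm \<alpha>)
                       (\<lambda>f. comp_op \<phi> f - comp_op \<psi> f))"
proof (intro conjI allI impI)
  interpret kernel_space hardy_sq "real CARD('n)" \<zeta>
    by (rule kernel_space_hardy) fact
  have "nrm = hardy_norm" by (simp add: fun_eq_iff nrm_def hardy_norm_def)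
  with comp_op_diff_not_compact[OF assms(2,3,5,6)]
  show "\<not> compact_op hardy_space hardy_norm (\<lambda>f. comp_op \<phi> f - comp_op \<psi> f)"
    by (simp add: hardy_space_def)
next
  fix \<alpha> :: real assume \<alpha>: "\<alpha> > -1"
  interpret kernel_space "bergman_sq \<alpha>" "real CARD('n) + \<alpha> + 1" \<zeta>
    using \<alpha> by (rule kernel_space_bergman) fact
  have "nrm = bergman_norm \<alpha>" by (simp add: fun_eq_iff nrm_def bergman_norm_def)
  with comp_op_diff_not_compact[OF assms(2,3,5,6)]
  show "\<not> compact_op (bergman_space \<alpha>) (bergman_norm \<alpha>) (\<lambda>f. comp_op \<phi> f - comp_op \<psi> f)"
    by (simp add: bergman_space_def)
qed

end
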